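(* Let $N$ be a positive integer, let $\omega_N$ be a primitive $N$th root of unity, and let $\lambda/\mu$ be a skew partition. (a) $s_{\lambda/\mu}(1,\omega_N,\ldots,\omega_N^{N-1})$ is zero unless the $N$-quotient $(\lambda^{(0)}/\mu^{(0)},\ldots,\lambda^{(N-1)}/\mu^{(N-1)})$ of $\lambda/\mu$ exists and $\lambda^{(i)}/\mu^{(i)}$ is a horizontal strip for all $0\le i\le N-1$, in which case $$s_{\lambda/\mu}(1,\omega_N,\ldots,\omega_N^{N-1})=\mathrm{sgn}\left(\chi^{\lambda/\mu}((N^m))\right)\quad\text{with } |\lambda/\mu|=Nm.$$ (b) If $|\lambda/\mu|=Nm$, then $K_{\lambda/\mu,\,m^N}(\omega_N)$ is zero unless the $N$-quotient of $\lambda/\mu$ exists and $\lambda^{(i)}/\mu^{(i)}$ is a horizontal strip for all $0\le i\le N-1$, in which case $$K_{\lambda/\mu,\,m^N}(\omega_N)=(-1)^{(N-1)m}\,\mathrm{sgn}\left(\chi^{\lambda/\mu}((N^m))\right).$$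
   Context: A skew partition $\lambda/\mu$ is a pair of partitions with $\lambda_i\ge\mu_i$ for all $i$; $|\lambda/\mu|=\sum_i(\lambda_i-\mu_i)$; $s_{\lambda/\mu}$ denotes the skew Schur polynomial (or symmetric function). A horizontal strip is a skew shape with no two squares in the same column (the empty shape is allowed). $(a^b)$, also written $a^b$, is the partition with $b$ parts equal to $a$. Skew characters: for $\lambda/\mu$ of size $n$, the integers $\chi^{\lambda/\mu}(\nu)$ ($\nu$ a partition of $n$) are defined by $s_{\lambda/\mu}=\sum_{\nu\vdash n}\chi^{\lambda/\mu}(\nu)\,p_\nu/z_\nu$, where $p_\nu$ is the power-sum symmetric function, $z_\nu=\prod_j m_j!\,j^{m_j}$, and $m_j$ is the number of parts of $\nu$ equal to $j$. For a nonzero integer, $\mathrm{sgn}$ denotes its sign $\pm1$; when the $N$-quotient of $\lambda/\mu$ exists, $\chi^{\lambda/\mu}((N^m))\ne0$. Skew Kostka-Foulkes polynomials: the Kostka-Foulkes polynomials $K_{\lambda,\nu}(q)$ are defined by $s_\lambda(X)=\sum_\nu K_{\lambda,\nu}(q)P_\nu(X;q)$, where $P_\nu(X;q)$ is the Hall-Littlewood symmetric function. Put $Q'_\nu(X;q)=\sum_\gamma K_{\gamma,\nu}(q)s_\gamma(X)$ and $K_{\lambda/\mu,\nu}(q)=\langle s_{\lambda/\mu}(X),Q'_\nu(X;q)\rangle$, where $\langle\cdot,\cdot\rangle$ is the Hall inner product (Schur functions orthonormal). $N$-quotient: let $r=\ell(\lambda)$ be the number of positive parts of $\lambda$. Consider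 $N$ vertical runners numbered $0,1,\ldots,N-1$ from left to right, with positions $0,1,2,\ldots$ marked from left to right along successive rows (so position $p$ lies on runner $p\bmod N$, in row $\lfloor p/N\rfloor$, rows going downward). For $\kappa\in\{\lambda,\mu\}$ (padded with zeros to length $r$), the $N$-abacus of $\kappa$ has a bead at each position $\kappa_i+r-i$, $1\le i\le r$, and the other positions are non-beads. For $0\le i\le N-1$, $\kappa^{(i)}$ is the partition whose $j$th part is the number of non-beads above the $j$th bead from the bottom on runner $i$. The same $r=\ell(\lambda)$ is used for $\lambda$ and $\mu$. The $N$-quotient of $\lambda/\mu$ exists if $\lambda$ and $\mu$ have the same $N$-core (equivalently, for every $i$ the abaci of $\lambda$ and $\mu$ have the same number of beads on runner $i$) and the diagram of $\lambda^{(i)}$ contains that of $\mu^{(i)}$ for all $0\le i\le N-1$; it is then the sequence $(\lambda^{(0)}/\mu^{(0)},\ldots,\lambda^{(N-1)}/\mu^{(N-1)})$. Here the $N$-core of a partition is the partition obtained by removing border strips (connected skew shapes without $2\times 2$ squares) of size $N$ as many times as possible. *)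

theory Defs
  imports
    Complex_Main
    "HOL-Library.FuncSet"
    "HOL-Combinatorics.Permutations"
    "HOL-Computational_Algebra.Polynomial"
begin

section \<open>Partitions and skew shapes\<close>

text \<open>A partition is a weakly decreasing, eventually zero sequence of natural numbers.
  Indices start at 0, so the part usually written with index \<open>i\<close> is \<open>p (i - 1)\<close>;
  padding with zeros is built in.\<close>

definition is_partition :: "(nat \<Rightarrow> nat) \<Rightarrow> bool" where
  "is_partition p \<longleftrightarrow> antimono p \<and> finite {i. p i \<noteq> 0}"

definition plength :: "(nat \<Rightarrow> nat) \<Rightarrow> nat" where
  "plength p = card {i. p i \<noteq> 0}"

definition psize :: "(nat \<Rightarrow> nat) \<Rightarrow> nat" where
  "psize p = (\<Sum>i<plength p. p i)"

definition partitions_of :: "nat \<Rightarrow> (nat \<Rightarrow> nat) set" where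
  "partitions_of n = {p. is_partition p \<and> psize p = n}"

definition part_mult :: "(nat \<Rightarrow> nat) \<Rightarrow> nat \<Rightarrow> nat" where
  "part_mult p j = card {i. p i = j}"

abbreviation empty_partition :: "nat \<Rightarrow> nat" where
  "empty_partition \<equiv> (\<lambda>_. 0)"

text \<open>\<open>rect a b\<close> is the partition $(a^b)$ with \<open>b\<close> parts equal to \<open>a\<close>.\<close>

definition rect :: "nat \<Rightarrow> nat \<Rightarrow> nat \<Rightarrow> nat" where
  "rect a b = (\<lambda>i. if i < b then a else 0)"

definition skew_partition :: "(nat \<Rightarrow> nat) \<Rightarrow> (nat \<Rightarrow> nat) \<Rightarrow> bool" where
  "skew_partition lam mu \<longleftrightarrow> is_partition lam \<and> is_partition mu \<and> (\<forall>i. mu i \<le> lam i)"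

definition skew_size :: "(nat \<Rightarrow> nat) \<Rightarrow> (nat \<Rightarrow> nat) \<Rightarrow> nat" where
  "skew_size lam mu = (\<Sum>i<plength lam. lam i - mu i)"

text \<open>Squares are pairs (row, column).\<close>

definition cells :: "(nat \<Rightarrow> nat) \<Rightarrow> (nat \<Rightarrow> nat) \<Rightarrow> (nat \<times> nat) set" where
  "cells lam mu = {(i, j). mu i \<le> j \<and> j < lam i}"

definition horizontal_strip :: "(nat \<Rightarrow> nat) \<Rightarrow> (nat \<Rightarrow> nat) \<Rightarrow> bool" where
  "horizontal_strip lam mu \<longleftrightarrow> skew_partition lam mu \<and>
     (\<forall>i i' j. (i, j) \<in> cells lam mu \<and> (i', j) \<in> cells lam mu \<longrightarrow> i = i')"


section \<open>Cores and quotients\<close>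

definition adjacent_cells :: "nat \<times> nat \<Rightarrow> nat \<times> nat \<Rightarrow> bool" where
  "adjacent_cells c d \<longleftrightarrow>
     (fst c = fst d \<and> (snd d = Suc (snd c) \<or> snd c = Suc (snd d))) \<or>
     (snd c = snd d \<and> (fst d = Suc (fst c) \<or> fst c = Suc (fst d)))"

definition connected_cells :: "(nat \<times> nat) set \<Rightarrow> bool" where
  "connected_cells D \<longleftrightarrow>
     (\<forall>c\<in>D. \<forall>d\<in>D. (\<lambda>a b. a \<in> D \<and> b \<in> D \<and> adjacent_cells a b)\<^sup>*\<^sup>* c d)"

definition border_strip :: "(nat \<Rightarrow> nat) \<Rightarrow> (nat \<Rightarrow> nat) \<Rightarrow> bool" where
  "border_strip lam mu \<longleftrightarrow> skew_partition lam mu \<and> connected_cells (cells lam mu) \<and>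
     \<not> (\<exists>i j. {(i, j), (i, Suc j), (Suc i, j), (Suc i, Suc j)} \<subseteq> cells lam mu)"

definition remove_strip :: "nat \<Rightarrow> (nat \<Rightarrow> nat) \<Rightarrow> (nat \<Rightarrow> nat) \<Rightarrow> bool" where
  "remove_strip N lam mu \<longleftrightarrow> border_strip lam mu \<and> skew_size lam mu = N"

definition is_core_of :: "nat \<Rightarrow> (nat \<Rightarrow> nat) \<Rightarrow> (nat \<Rightarrow> nat) \<Rightarrow> bool" where
  "is_core_of N lam kap \<longleftrightarrow>
     (remove_strip N)\<^sup>*\<^sup>* lam kap \<and> \<not> (\<exists>rho. remove_strip N kap rho)"

text \<open>With indices from 0 the bead positions $\kappa_i + r - i$, $1 \le i \le r$, become
  \<open>kap i + (r - 1 - i)\<close>, \<open>i < r\<close>.  \<open>runner N r kap i\<close> is the set of rows of the beads on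
  runner \<open>i\<close>.  Rows go downward, so the bottom bead is the one with the largest row.\<close>

definition beads :: "nat \<Rightarrow> (nat \<Rightarrow> nat) \<Rightarrow> nat set" where
  "beads r kap = (\<lambda>i. kap i + (r - 1 - i)) ` {..<r}"

definition runner :: "nat \<Rightarrow> nat \<Rightarrow> (nat \<Rightarrow> nat) \<Rightarrow> nat \<Rightarrow> nat set" where
  "runner N r kap i = {row. row * N + i \<in> beads r kap}"

definition quotient_part :: "nat \<Rightarrow> nat \<Rightarrow> (nat \<Rightarrow> nat) \<Rightarrow> nat \<Rightarrow> nat \<Rightarrow> nat" where
  "quotient_part N r kap i =
     (\<lambda>j. if j < card (runner N r kap i)
          then card {a. a < rev (sorted_list_of_set (runner N r kap i)) ! j \<and>
                        a \<notin> runner N r kap i}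
          else 0)"

text \<open>The same \<open>r\<close>, the length of \<open>lam\<close>, is used for both abaci.\<close>

definition quotient_outer :: "nat \<Rightarrow> (nat \<Rightarrow> nat) \<Rightarrow> (nat \<Rightarrow> nat) \<Rightarrow> nat \<Rightarrow> nat \<Rightarrow> nat" where
  "quotient_outer N lam mu i = quotient_part N (plength lam) lam i"

definition quotient_inner :: "nat \<Rightarrow> (nat \<Rightarrow> nat) \<Rightarrow> (nat \<Rightarrow> nat) \<Rightarrow> nat \<Rightarrow> nat \<Rightarrow> nat" where
  "quotient_inner N lam mu i = quotient_part N (plength lam) mu i"

definition quotient_exists :: "nat \<Rightarrow> (nat \<Rightarrow> nat) \<Rightarrow> (nat \<Rightarrow> nat) \<Rightarrow> bool" where
  "quotient_exists N lam mu \<longleftrightarrow>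
     (\<exists>kap. is_core_of N lam kap \<and> is_core_of N mu kap) \<and>
     (\<forall>i<N. \<forall>j. quotient_inner N lam mu i j \<le> quotient_outer N lam mu i j)"


section \<open>Symmetric functions\<close>

text \<open>A symmetric function \<open>f\<close> over the complex numbers is represented by its polynomial
  functions in finitely many variables: \<open>f n x\<close> is the value of $f(x_0,\ldots,x_{n-1})$.
  Since the complex numbers are infinite, an identity of symmetric functions is the same as an
  identity of these values for all \<open>n\<close> and \<open>x\<close>.\<close>

type_synonym symfun = "nat \<Rightarrow> (nat \<Rightarrow> complex) \<Rightarrow> complex"

definition ssyt :: "(nat \<Rightarrow> nat) \<Rightarrow> (nat \<Rightarrow> nat) \<Rightarrow> nat \<Rightarrow> (nat \<times> nat \<Rightarrow> nat) set" where
  "ssyt lam mu n = {T \<in> cells lam mu \<rightarrow>\<^sub>E {..<n}.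
     (\<forall>i j j'. (i, j) \<in> cells lam mu \<and> (i, j') \<in> cells lam mu \<and> j < j' \<longrightarrow> T (i, j) \<le> T (i, j')) \<and>
     (\<forall>i i' j. (i, j) \<in> cells lam mu \<and> (i', j) \<in> cells lam mu \<and> i < i' \<longrightarrow> T (i, j) < T (i', j))}"

definition skew_schur :: "(nat \<Rightarrow> nat) \<Rightarrow> (nat \<Rightarrow> nat) \<Rightarrow> symfun" where
  "skew_schur lam mu n x = (\<Sum>T\<in>ssyt lam mu n. \<Prod>c\<in>cells lam mu. x (T c))"

definition schur :: "(nat \<Rightarrow> nat) \<Rightarrow> symfun" where
  "schur lam = skew_schur lam empty_partition"

definition power_sum :: "(nat \<Rightarrow> nat) \<Rightarrow> symfun" where
  "power_sum nu n x = (\<Prod>i<plength nu. \<Sum>k<n. x k ^ nu i)"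

definition zee :: "(nat \<Rightarrow> nat) \<Rightarrow> nat" where
  "zee nu = (\<Prod>j=1..psize nu. fact (part_mult nu j) * j ^ part_mult nu j)"

text \<open>In the three definitions by choice below, the chosen object is unique: the power sums, the
  Hall-Littlewood functions and the Schur functions, each indexed by partitions, are linearly
  independent.\<close>

definition skew_character :: "(nat \<Rightarrow> nat) \<Rightarrow> (nat \<Rightarrow> nat) \<Rightarrow> (nat \<Rightarrow> nat) \<Rightarrow> int" where
  "skew_character lam mu = (SOME chi.
     (\<forall>nu. nu \<notin> partitions_of (skew_size lam mu) \<longrightarrow> chi nu = 0) \<and>
     (\<forall>n x. skew_schur lam mu n x =
        (\<Sum>nu\<in>partitions_of (skew_size lam mu).
           of_int (chi nu) * power_sum nu n x / of_nat (zee nu))))"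

text \<open>The Hall-Littlewood function is
  \[ P_\nu(x;q) = \sum_{w \in S_n/S_n^\nu} w\Bigl(x^\nu
       \prod_{\nu_i > \nu_j} \frac{x_i - q x_j}{x_i - x_j}\Bigr), \]
  zero if \<open>\<nu>\<close> has more than \<open>n\<close> parts (Macdonald, Symmetric Functions and Hall Polynomials,
  Chapter III, (2.2)).  The cosets of the stabiliser correspond to the distinct rearrangements
  of $(\nu_1,\ldots,\nu_n)$.  The formula is to be used for pairwise distinct
  $x_0,\ldots,x_{n-1}$, where no denominator vanishes.\<close>

definition rearrangements :: "nat \<Rightarrow> (nat \<Rightarrow> nat) \<Rightarrow> (nat \<Rightarrow> nat) set" where
  "rearrangements n nu = {nu \<circ> w |w. w permutes {..<n}}"

definition hall_littlewood_P :: "(nat \<Rightarrow> nat) \<Rightarrow> complex \<Rightarrow> symfun" where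
  "hall_littlewood_P nu q n x =
     (if plength nu \<le> n
      then \<Sum>a\<in>rearrangements n nu.
             (\<Prod>i<n. x i ^ a i) *
             (\<Prod>(i, j)\<in>{(i, j). i < n \<and> j < n \<and> a i > a j}. (x i - q * x j) / (x i - x j))
      else 0)"

text \<open>Points with pairwise distinct coordinates are Zariski dense, so it suffices to require
  the defining identity there.\<close>

definition kostka_foulkes :: "(nat \<Rightarrow> nat) \<Rightarrow> (nat \<Rightarrow> nat) \<Rightarrow> complex poly" where
  "kostka_foulkes lam = (SOME K.
     (\<forall>nu. nu \<notin> partitions_of (psize lam) \<longrightarrow> K nu = 0) \<and>
     (\<forall>q n x. inj_on x {..<n} \<longrightarrow>
        schur lam n x =
        (\<Sum>nu\<in>partitions_of (psize lam). poly (K nu) q * hall_littlewood_P nu q n x)))"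

definition Q_prime :: "(nat \<Rightarrow> nat) \<Rightarrow> complex \<Rightarrow> symfun" where
  "Q_prime nu q n x =
     (\<Sum>gam\<in>partitions_of (psize nu). poly (kostka_foulkes gam nu) q * schur gam n x)"

text \<open>The Hall inner product is the bilinear form for which the Schur functions are orthonormal.\<close>

definition schur_coeff :: "symfun \<Rightarrow> (nat \<Rightarrow> nat) \<Rightarrow> complex" where
  "schur_coeff f = (SOME c.
     finite {gam. c gam \<noteq> 0} \<and> {gam. c gam \<noteq> 0} \<subseteq> Collect is_partition \<and>
     (\<forall>n x. f n x = (\<Sum>gam | c gam \<noteq> 0. c gam * schur gam n x)))"

definition hall_inner :: "symfun \<Rightarrow> symfun \<Rightarrow> complex" where
  "hall_inner f g = (\<Sum>gam | schur_coeff f gam \<noteq> 0. schur_coeff f gam * schur_coeff g gam)"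

definition skew_kostka_foulkes ::
  "(nat \<Rightarrow> nat) \<Rightarrow> (nat \<Rightarrow> nat) \<Rightarrow> (nat \<Rightarrow> nat) \<Rightarrow> complex \<Rightarrow> complex" where
  "skew_kostka_foulkes lam mu nu q = hall_inner (skew_schur lam mu) (Q_prime nu q)"


section \<open>Roots of unity\<close>

definition primitive_root_of_unity :: "nat \<Rightarrow> complex \<Rightarrow> bool" where
  "primitive_root_of_unity N w \<longleftrightarrow> w ^ N = 1 \<and> (\<forall>k. 0 < k \<and> k < N \<longrightarrow> w ^ k \<noteq> 1)"

end

theory Submission
  imports Defs "Jordan_Normal_Form.Determinant" "HOL-Computational_Algebra.Formal_Power_Series"
    "HOL-Library.Multiset"
begin

text \<open>
  In the abacus picture a one-variable skew Schur polynomial is a Toeplitz minor of \<open>1 / (1 - x X)\<close> with rows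
  and columns indexed by bead sets, so by the Cauchy--Binet formula \<open>s\<^bsub>\<lambda>/\<mu>\<^esub>(x\<^sub>0, \<dots>, x\<^bsub>n-1\<^esub>)\<close> is the minor of
  \<open>\<Prod>i. 1 / (1 - x\<^sub>i X)\<close> (Jacobi--Trudi).  At the \<open>N\<close>th roots of unity this product is \<open>1 / (1 - X ^ N)\<close>, whose
  Toeplitz matrix only connects beads on the same runner.  After sorting the beads by runners the minor is
  triangular with diagonal 1 if the beads of \<open>\<lambda>\<close> and \<open>\<mu>\<close> interlace on every runner, and it vanishes otherwise;
  sorting costs a sign that depends on \<open>\<lambda>\<close> and \<open>\<mu>\<close> separately.  At \<open>j\<close> copies of the roots of unity
  Cauchy--Binet counts chains of length \<open>j\<close>, all with the same sign, while the expansion in power sums is a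
  polynomial in \<open>j\<close> with leading term \<open>\<chi>(N\<^sup>m) j ^ m / m!\<close>; comparing growth gives the sign of the character.

  Part (b) follows since \<open>P\<^sub>\<nu>(1, \<omega>, \<dots>, \<omega> ^ (N - 1); \<omega>)\<close> vanishes for \<open>\<nu> \<noteq> m ^ N\<close>: every
  non-constant rearrangement of \<open>\<nu>\<close> has a cyclic descent, which makes a factor \<open>x\<^sub>i - \<omega> x\<^sub>j\<close> zero.  Existence of the
  Kostka--Foulkes polynomials is obtained by multiplying with the Vandermonde determinant, which shows that
  \<open>P\<^sub>\<nu>\<close> is unitriangular in the Schur polynomials.
\<close>

section \<open>Determinants and the Cauchy--Binet formula\<close>

text \<open>The notions fixed by choice shape much of the work: \<open>skew_character\<close>,
  \<open>kostka_foulkes\<close> and \<open>schur_coeff\<close> can be used only after an object with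
  the defining property has been exhibited. Hence integrality of the characters and polynomiality in
  q of the Kostka-Foulkes coefficients are proved as well, the former from Newton's identities, the
  latter by inverting a unitriangular matrix.

  The chain expansion is carried out in runner order throughout, so only the sorting signs of the
  two end points enter. The chain count is bounded below by j choose m, which has the order j ^ m of
  the dominant term; this forces the leading coefficient to be positive, without a
  Murnaghan-Nakayama rule.

  The Hall-Littlewood formula has denominators, so identities are first proved at generic points.
  Limits carry them to the remaining points, and setting a variable to zero links different numbers
  of variables.

  Cores are defined by border strips, whereas the determinants see bead counts on runners; removal
  of a strip has to be translated into a bead move and back.\<close>

definition leibniz_det :: "nat \<Rightarrow> (nat \<Rightarrow> nat \<Rightarrow> 'a::comm_ring_1) \<Rightarrow> 'a" where
  "leibniz_det n f = (\<Sum>p | p permutes {..<n}. of_int (sign p) * (\<Prod>i<n. f i (p i)))"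

lemma leibniz_det_eq_det: "leibniz_det n f = det (mat n n (\<lambda>(i, j). f i j))"
proof -
  have "det (mat n n (\<lambda>(i, j). f i j)) = (\<Sum>p | p permutes {0..<n}. signof p * (\<Prod>i = 0..<n. mat n n (\<lambda>(i, j). f i j) $$ (i, p i)))"
    by (rule det_def') simp
  also have "\<dots> = leibniz_det n f"
    unfolding leibniz_det_def lessThan_atLeast0
  proof (intro sum.cong refl, goal_cases)
    case (1 p)
    then have "p permutes {0..<n}" by simp
    then have "\<And>i. i < n \<Longrightarrow> p i < n"
      by (metis atLeastLessThan_iff permutes_in_image zero_le)
    then show ?case by simp
  qed
  finally show ?thesis by simp
qed

lemma permutes_lessThan_less: "p permutes {..<n} \<Longrightarrow> i < n \<Longrightarrow> p i < (n::nat)"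
  by (metis lessThan_iff permutes_in_image)

lemma leibniz_det_cong:
  assumes "\<And>i j. i < n \<Longrightarrow> j < n \<Longrightarrow> f i j = g i j"
  shows "leibniz_det n f = leibniz_det n g"
  unfolding leibniz_det_def by (intro sum.cong prod.cong refl arg_cong2[where f="(*)"] assms) (auto simp: permutes_lessThan_less)

lemma leibniz_det_transpose: "leibniz_det n (\<lambda>i j. f j i) = leibniz_det n f"
proof -
  have "transpose_mat (mat n n (\<lambda>(i, j). f i j)) = mat n n (\<lambda>(i, j). f j i)"
    by (rule eq_matI) auto
  then show ?thesis unfolding leibniz_det_eq_det
    by (metis det_transpose mat_carrier)
qed

lemma leibniz_det_permute_rows:
  assumes "p permutes {..<n}"
  shows "leibniz_det n (\<lambda>i j. f (p i) j) = of_int (sign p) * leibniz_det n f"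
proof -
  have "mat n n (\<lambda>(i, j). mat n n (\<lambda>(i, j). f i j) $$ (p i, j)) = mat n n (\<lambda>(i, j). f (p i) j)"
    by (rule eq_matI) (auto simp: permutes_lessThan_less[OF assms])
  then show ?thesis
    using det_permute_rows[of "mat n n (\<lambda>(i, j). f i j)" n p] assms
    unfolding leibniz_det_eq_det by (simp add: lessThan_atLeast0)
qed

lemma leibniz_det_permute_cols:
  assumes "p permutes {..<n}"
  shows "leibniz_det n (\<lambda>i j. f i (p j)) = of_int (sign p) * leibniz_det n f"
  using leibniz_det_permute_rows[OF assms, of "\<lambda>i j. f j i"]
  by (subst (1 2) leibniz_det_transpose[symmetric]) simp

lemma leibniz_det_identical_rows:
  assumes "i \<noteq> j" "i < n" "j < n" "\<And>k. k < n \<Longrightarrow> f i k = f j k"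
  shows "leibniz_det n f = 0"
  unfolding leibniz_det_eq_det
  by (rule det_identical_rows[OF _ assms(1-3)]) (auto simp: assms intro!: eq_vecI)

lemma leibniz_det_upper_triangular:
  assumes "\<And>i j. j < i \<Longrightarrow> i < n \<Longrightarrow> f i j = 0"
  shows "leibniz_det n f = (\<Prod>i<n. f i i)"
proof -
  have "leibniz_det n f = prod_list (diag_mat (mat n n (\<lambda>(i, j). f i j)))"
    unfolding leibniz_det_eq_det by (rule det_upper_triangular[of _ n]) (auto intro!: upper_triangularI assms)
  also have "\<dots> = (\<Prod>i<n. f i i)"
    by (simp add: prod_list_diag_prod lessThan_atLeast0)
  finally show ?thesis .
qed

text \<open>The n - k rows from k on could only use the n - k - 1 columns after k, so by the
  pigeonhole principle every permutation meets a zero entry.\<close>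

lemma leibniz_det_zero_block:
  assumes k: "k < n" and z: "\<And>i j. k \<le> i \<Longrightarrow> i < n \<Longrightarrow> j \<le> k \<Longrightarrow> f i j = 0"
  shows "leibniz_det n f = 0"
  unfolding leibniz_det_def
proof (intro sum.neutral ballI, goal_cases)
  case (1 p)
  then have p: "p permutes {..<n}" by simp
  have "\<exists>i\<in>{k..<n}. p i \<le> k"
  proof (rule ccontr)
    assume "\<not> ?thesis"
    then have "p ` {k..<n} \<subseteq> {Suc k..<n}"
      using permutes_lessThan_less[OF p] by (auto simp: not_le Suc_le_eq)
    moreover have "inj_on p {k..<n}" using p by (metis inj_on_subset permutes_inj subset_UNIV)
    ultimately have "card {k..<n} \<le> card {Suc k..<n}"
      by (metis card_inj_on_le finite_atLeastLessThan)
    then show False using k by simp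
  qed
  then obtain i where "k \<le> i" "i < n" "p i \<le> k" by auto
  then have "(\<Prod>i<n. f i (p i)) = 0" using z by (intro prod_zero) auto
  then show ?case by simp
qed

lemma leibniz_det_mult: "leibniz_det n (\<lambda>i j. \<Sum>k<n. f i k * g k j) = leibniz_det n f * leibniz_det n g"
proof -
  have "mat n n (\<lambda>(i, j). f i j) * mat n n (\<lambda>(i, j). g i j) = mat n n (\<lambda>(i, j). \<Sum>k<n. f i k * g k j)"
    by (rule eq_matI) (auto simp: scalar_prod_def lessThan_atLeast0)
  then show ?thesis unfolding leibniz_det_eq_det
    by (metis det_mult mat_carrier)
qed

text \<open>An injection into K is determined by its image C and the order in which C is visited,
  measured against a fixed enumeration \<open>e C\<close>. The enumeration stays a parameter so that
  Cauchy-Binet can be read in any order of the beads.\<close>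

lemma bij_betw_subset_permutation_inj:
  assumes e: "\<And>C. C \<subseteq> K \<Longrightarrow> card C = n \<Longrightarrow> bij_betw (e C) {..<n} C"
    and K: "finite K"
  shows "bij_betw (\<lambda>(C, p). restrict (e C \<circ> p) {..<n})
     ({C. C \<subseteq> K \<and> card C = n} \<times> {p. p permutes {..<n}}) {f \<in> {..<n} \<rightarrow>\<^sub>E K. inj_on f {..<n}}"
proof (rule bij_betw_imageI)
  show "inj_on (\<lambda>(C, p). restrict (e C \<circ> p) {..<n}) ({C. C \<subseteq> K \<and> card C = n} \<times> {p. p permutes {..<n}})"
  proof (rule inj_onI, clarify)
    fix C C' p p'
    assume C: "C \<subseteq> K" "C' \<subseteq> K" "n = card C" "card C' = card C"
      and p: "p permutes {..<card C}" "p' permutes {..<card C}"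
      and eq: "restrict (e C \<circ> p) {..<card C} = restrict (e C' \<circ> p') {..<card C}"
    have im: "(restrict (e C \<circ> p) {..<card C}) ` {..<card C} = C"
      using bij_betw_trans[OF permutes_imp_bij[OF p(1)], of "e C" C] e[of C] C
      unfolding bij_betw_def by simp
    have im': "(restrict (e C' \<circ> p') {..<card C}) ` {..<card C} = C'"
      using bij_betw_trans[OF permutes_imp_bij[OF p(2)], of "e C'" C'] e[of C'] C
      unfolding bij_betw_def by simp
    have CC: "C = C'" using im im' eq by simp
    have inj: "inj_on (e C) {..<card C}" using e[of C] C by (simp add: bij_betw_def)
    have "p = p'"
    proof
      fix i
      show "p i = p' i"
      proof (cases "i < card C")
        case True
        then have "e C (p i) = e C (p' i)" using fun_cong[OF eq, of i] CC by simp
        moreover have "p i < card C" "p' i < card C" using True p by (auto simp: permutes_lessThan_less)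
        ultimately show ?thesis using inj by (auto simp: inj_on_def)
      next
        case False
        then show ?thesis using p by (simp add: permutes_def)
      qed
    qed
    with CC show "C = C' \<and> p = p'" by simp
  qed
next
  show "(\<lambda>(C, p). restrict (e C \<circ> p) {..<n}) ` ({C. C \<subseteq> K \<and> card C = n} \<times> {p. p permutes {..<n}})
     = {f \<in> {..<n} \<rightarrow>\<^sub>E K. inj_on f {..<n}}" (is "?L = ?R")
  proof
    show "?L \<subseteq> ?R"
    proof clarify
      fix C p assume C: "C \<subseteq> K" "n = card C" and p: "p permutes {..<card C}"
      have b: "bij_betw (e C) {..<card C} C" using e C by simp
      have "bij_betw (e C \<circ> p) {..<card C} C"
        using b p by (meson bij_betw_trans permutes_imp_bij)
      then show "restrict (e C \<circ> p) {..<card C} \<in> {..<card C} \<rightarrow>\<^sub>E K \<and> inj_on (restrict (e C \<circ> p) {..<card C}) {..<card C}"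
        using C by (auto simp: bij_betw_def inj_on_def)
    qed
  next
    show "?R \<subseteq> ?L"
    proof clarify
      fix f assume f: "f \<in> {..<n} \<rightarrow>\<^sub>E K" and inj: "inj_on f {..<n}"
      define C where "C = f ` {..<n}"
      have C: "C \<subseteq> K" "card C = n" using f inj by (auto simp: C_def card_image)
      have b: "bij_betw (e C) {..<n} C" using e C by simp
      define p where "p = (\<lambda>i. if i < n then the_inv_into {..<n} (e C) (f i) else i)"
      have "bij_betw (the_inv_into {..<n} (e C) \<circ> f) {..<n} {..<n}"
        using b inj by (intro bij_betw_trans[of f _ C]) (auto simp: C_def bij_betw_the_inv_into bij_betw_def[of f])
      then have "bij_betw p {..<n} {..<n}"
        by (subst bij_betw_cong[of _ _ "the_inv_into {..<n} (e C) \<circ> f"]) (auto simp: p_def)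
      then have p: "p permutes {..<n}"
        by (intro bij_imp_permutes) (auto simp: p_def)
      have "restrict (e C \<circ> p) {..<n} = f"
      proof
        fix i show "restrict (e C \<circ> p) {..<n} i = f i"
          using f f_the_inv_into_f_bij_betw[OF b, of "f i"] by (auto simp: p_def C_def PiE_def extensional_def)
      qed
      then show "f \<in> ?L" using C p by (auto intro!: image_eqI[of _ _ "(C, p)"])
    qed
  qed
qed

lemma Cauchy_Binet:
  fixes f g :: "nat \<Rightarrow> nat \<Rightarrow> 'a::comm_ring_1"
  assumes e: "\<And>C. C \<subseteq> K \<Longrightarrow> card C = n \<Longrightarrow> bij_betw (e C) {..<n} C"
    and K: "finite K"
  shows "leibniz_det n (\<lambda>i j. \<Sum>k\<in>K. f i k * g k j) =
    (\<Sum>C | C \<subseteq> K \<and> card C = n. leibniz_det n (\<lambda>i l. f i (e C l)) * leibniz_det n (\<lambda>l j. g (e C l) j))"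
proof -
  let ?F = "{..<n} \<rightarrow>\<^sub>E K"
  let ?P = "{p. p permutes {..<n}}"
  have finF: "finite ?F" using K by (simp add: finite_PiE)
  have "leibniz_det n (\<lambda>i j. \<Sum>k\<in>K. f i k * g k j) = (\<Sum>p\<in>?P. of_int (sign p) * (\<Sum>h\<in>?F. \<Prod>i<n. f i (h i) * g (h i) (p i)))"
    unfolding leibniz_det_def using K by (intro sum.cong refl arg_cong2[where f="(*)"] prod_sum_PiE) auto
  also have "\<dots> = (\<Sum>h\<in>?F. \<Sum>p\<in>?P. of_int (sign p) * (\<Prod>i<n. f i (h i) * g (h i) (p i)))"
    unfolding sum_distrib_left by (rule sum.swap)
  also have "\<dots> = (\<Sum>h\<in>?F. (\<Prod>i<n. f i (h i)) * leibniz_det n (\<lambda>i j. g (h i) j))"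
    unfolding leibniz_det_def sum_distrib_left by (simp add: prod.distrib mult_ac)
  also have "\<dots> = (\<Sum>h\<in>{h\<in>?F. inj_on h {..<n}}. (\<Prod>i<n. f i (h i)) * leibniz_det n (\<lambda>i j. g (h i) j))"
  proof (rule sum.mono_neutral_right[OF finF], blast, rule ballI)
    fix h assume "h \<in> ?F - {h \<in> ?F. inj_on h {..<n}}"
    then obtain i j where "i < n" "j < n" "i \<noteq> j" "h i = h j" by (auto simp: inj_on_def)
    then have "leibniz_det n (\<lambda>i j. g (h i) j) = 0" by (intro leibniz_det_identical_rows[of i j]) auto
    then show "(\<Prod>i<n. f i (h i)) * leibniz_det n (\<lambda>i j. g (h i) j) = 0" by simp
  qed
  also have "\<dots> = (\<Sum>(C, p)\<in>{C. C \<subseteq> K \<and> card C = n} \<times> ?P.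
     (\<Prod>i<n. f i (e C (p i))) * leibniz_det n (\<lambda>i j. g (e C (p i)) j))"
    by (subst sum.reindex_bij_betw[OF bij_betw_subset_permutation_inj[OF e K], symmetric])
      (auto intro!: sum.cong arg_cong2[where f="(*)"] leibniz_det_cong)
  also have "\<dots> = (\<Sum>C | C \<subseteq> K \<and> card C = n. \<Sum>p\<in>?P.
     (\<Prod>i<n. f i (e C (p i))) * leibniz_det n (\<lambda>i j. g (e C (p i)) j))"
    by (rule sum.cartesian_product[symmetric])
  \<comment> \<open>The sign released by reordering the rows of the second factor is the one that
    the Leibniz sum of the first factor needs.\<close>
  also have "\<dots> = (\<Sum>C | C \<subseteq> K \<and> card C = n. \<Sum>p\<in>?P.
     (\<Prod>i<n. f i (e C (p i))) * (of_int (sign p) * leibniz_det n (\<lambda>i j. g (e C i) j)))"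
    by (intro sum.cong refl arg_cong2[where f="(*)"] leibniz_det_permute_rows[where f="\<lambda>i j. g (e _ i) j"]) auto
  also have "\<dots> = (\<Sum>C | C \<subseteq> K \<and> card C = n. leibniz_det n (\<lambda>i l. f i (e C l)) * leibniz_det n (\<lambda>l j. g (e C l) j))"
    by (intro sum.cong refl) (simp add: leibniz_det_def[of n "\<lambda>i l. f i (e _ l)"] sum_distrib_left mult_ac)
  finally show ?thesis .
qed


section \<open>Toeplitz minors indexed by bead sets\<close>

definition lexdec :: "nat \<Rightarrow> nat \<Rightarrow> (nat \<Rightarrow> nat) \<Rightarrow> bool" where
  "lexdec N r b \<longleftrightarrow> (\<forall>i j. i < j \<and> j < r \<longrightarrow>
     b i mod N < b j mod N \<or> (b i mod N = b j mod N \<and> b j < b i))"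

text \<open>For N = 1 this is the decreasing enumeration used in Jacobi-Trudi; for general N it runs
  through the runners from left to right and through each runner from the bottom up. One definition
  serves both orders, and their comparison is the sorting sign.\<close>

definition bead_enum :: "nat \<Rightarrow> nat set \<Rightarrow> nat \<Rightarrow> nat" where
  "bead_enum N B = (SOME b. bij_betw b {..<card B} B \<and> lexdec N (card B) b)"

lemma lexdecD:
  "lexdec N r b \<Longrightarrow> i < j \<Longrightarrow> j < r \<Longrightarrow> b i mod N < b j mod N \<or> (b i mod N = b j mod N \<and> b j < b i)"
  by (auto simp: lexdec_def)

lemma lexdec_mod_mono: "lexdec N r b \<Longrightarrow> i \<le> j \<Longrightarrow> j < r \<Longrightarrow> b i mod N \<le> b j mod N"
  using lexdecD[of N r b i j] by (cases "i = j") auto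

lemma lexdec_antimono: "lexdec N r b \<Longrightarrow> i \<le> j \<Longrightarrow> j < r \<Longrightarrow> b i mod N = b j mod N \<Longrightarrow> b j \<le> b i"
  using lexdecD[of N r b i j] by (cases "i = j") auto

lemma lexdec_inj_on: "lexdec N r b \<Longrightarrow> inj_on b {..<r}"
  by (rule inj_onI, metis lexdecD lessThan_iff less_irrefl linorder_neqE_nat)

text \<open>Turns \<open>lexdec\<close> into strict increase of an integer key for positions below
  K: a larger residue adds at least K, more than any difference of positions can undo. Existence and
  uniqueness of the enumeration thus reduce to sorted lists.\<close>

definition lexkey :: "nat \<Rightarrow> nat \<Rightarrow> nat \<Rightarrow> int" where
  "lexkey N K p = int (p mod N) * int K - int p"

lemma lexkey_less_iff:
  assumes "p < K" "q < K"
  shows "lexkey N K p < lexkey N K q \<longleftrightarrow> p mod N < q mod N \<or> (p mod N = q mod N \<and> q < p)"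
proof -
  have *: "lexkey N K p < lexkey N K q" if "p mod N < q mod N" "p < K" "q < K" for p q
  proof -
    have "(int (p mod N) + 1) * int K \<le> int (q mod N) * int K"
      using that by (intro mult_right_mono) auto
    then show ?thesis using that by (simp add: lexkey_def algebra_simps)
  qed
  show ?thesis
  proof (cases "p mod N" "q mod N" rule: linorder_cases)
    case less
    then show ?thesis using * assms by simp
  next
    case equal
    then show ?thesis by (simp add: lexkey_def)
  next
    case greater
    then have "lexkey N K q < lexkey N K p" using * assms by simp
    then show ?thesis using greater by simp
  qed
qed

lemma lexkey_inj_on: "inj_on (lexkey N K) {..<K}"
proof (rule inj_onI)
  fix p q assume *: "p \<in> {..<K}" "q \<in> {..<K}" and "lexkey N K p = lexkey N K q"
  then have "\<not> lexkey N K p < lexkey N K q" "\<not> lexkey N K q < lexkey N K p" by auto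
  then show "p = q" using * lexkey_less_iff[of p K q N] lexkey_less_iff[of q K p N] by auto
qed

lemma lexdec_unique:
  assumes "lexdec N r b" "lexdec N r c" "b ` {..<r} = c ` {..<r}" "i < r"
  shows "b i = c i"
proof -
  define K where "K = Suc (Max (b ` {..<r}))"
  have K: "b j < K" "c j < K" if "j < r" for j
  proof -
    show "b j < K" using that by (simp add: K_def less_Suc_eq_le)
    have "c j \<in> b ` {..<r}" using that assms(3) by simp
    then show "c j < K" unfolding K_def less_Suc_eq_le by (intro Max_ge) auto
  qed
  let ?k = "lexkey N K"
  have sd: "sorted (map (?k \<circ> d) [0..<r]) \<and> distinct (map (?k \<circ> d) [0..<r])"
    if "lexdec N r d" "\<And>j. j < r \<Longrightarrow> d j < K" for d
  proof -
    have "sorted_wrt (<) (map (?k \<circ> d) [0..<r])"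
      unfolding sorted_wrt_map sorted_wrt_iff_nth_less
      using that by (auto simp: lexkey_less_iff lexdec_def)
    then show ?thesis using strict_sorted_iff by blast
  qed
  have "map (?k \<circ> b) [0..<r] = map (?k \<circ> c) [0..<r]"
  proof (rule sorted_distinct_set_unique)
    show "set (map (?k \<circ> b) [0..<r]) = set (map (?k \<circ> c) [0..<r])"
      using arg_cong[OF assms(3), of "image ?k"] by (simp add: lessThan_atLeast0 image_image)
  qed (use sd[OF assms(1)] sd[OF assms(2)] K in auto)
  then have "?k (b i) = ?k (c i)" using \<open>i < r\<close> by simp
  then show ?thesis using lexkey_inj_on[of N K] K[OF \<open>i < r\<close>] by (auto simp: inj_on_def)
qed

lemma ex_lexdec:
  assumes "finite B"
  shows "\<exists>b. bij_betw b {..<card B} B \<and> lexdec N (card B) b"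
proof -
  define K where "K = Suc (Max B)"
  have K: "p < K" if "p \<in> B" for p using that assms by (simp add: K_def less_Suc_eq_le)
  let ?k = "lexkey N K"
  have inj: "inj_on ?k B" using K by (intro inj_on_subset[OF lexkey_inj_on]) auto
  define xs where "xs = sorted_list_of_set (?k ` B)"
  have xs: "set xs = ?k ` B" "length xs = card B" "sorted_wrt (<) xs" "distinct xs"
    using assms inj by (auto simp: xs_def card_image)
  define b where "b i = the_inv_into B ?k (xs ! i)" for i
  have kb: "?k (b i) = xs ! i" "b i \<in> B" if "i < card B" for i
  proof -
    have "xs ! i \<in> ?k ` B" using that xs by (metis nth_mem)
    then show "?k (b i) = xs ! i" "b i \<in> B"
      unfolding b_def using inj by (auto simp: f_the_inv_into_f the_inv_into_into)
  qed
  have lex: "lexdec N (card B) b"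
    unfolding lexdec_def
  proof (intro allI impI)
    fix i j assume ij: "i < j \<and> j < card B"
    then have "?k (b i) < ?k (b j)" using kb xs(2,3) by (simp add: sorted_wrt_iff_nth_less)
    then show "b i mod N < b j mod N \<or> (b i mod N = b j mod N \<and> b j < b i)"
      using lexkey_less_iff[of "b i" K "b j" N] K kb ij by auto
  qed
  have "bij_betw b {..<card B} B"
    unfolding bij_betw_def
  proof
    show i: "inj_on b {..<card B}" by (rule lexdec_inj_on[OF lex])
    show "b ` {..<card B} = B"
      by (rule card_subset_eq) (use assms kb i in \<open>auto simp: card_image\<close>)
  qed
  with lex show ?thesis by blast
qed

lemma
  assumes "finite B"
  shows bead_enum_bij: "bij_betw (bead_enum N B) {..<card B} B" and bead_enum_lexdec: "lexdec N (card B) (bead_enum N B)"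
  using someI_ex[OF ex_lexdec[OF assms, of N]] by (auto simp: bead_enum_def)

lemma bead_enum_eqI:
  assumes "lexdec N r b" "b ` {..<r} = B" "i < r"
  shows "card B = r" "bead_enum N B i = b i"
proof -
  show c: "card B = r" using assms lexdec_inj_on[OF assms(1)] by (auto simp: card_image)
  have f: "finite B" using assms(2) by auto
  show "bead_enum N B i = b i"
    using lexdec_unique[of N r "bead_enum N B" b i] bead_enum_bij[OF f, of N] bead_enum_lexdec[OF f, of N] assms c
    by (auto simp: bij_betw_def)
qed

section \<open>Toeplitz matrices of power series\<close>

definition toeplitz_entry :: "complex fps \<Rightarrow> nat \<Rightarrow> nat \<Rightarrow> complex" where
  "toeplitz_entry F b a = (if a \<le> b then fps_nth F (b - a) else 0)"

text \<open>The series 1 / (1 - X ^ N). For N = 1 it is the generating series of a single variable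
  equal to 1.\<close>

definition geom :: "nat \<Rightarrow> complex fps" where
  "geom N = Abs_fps (\<lambda>k. if N dvd k then 1 else 0)"

lemma toeplitz_entry_geom: "toeplitz_entry (geom N) b a = (if a \<le> b \<and> b mod N = a mod N then 1 else 0)"
  by (auto simp: toeplitz_entry_def geom_def mod_eq_dvd_iff_nat dvd_def)

text \<open>The entries in row b vanish beyond column b, so cutting the inner index off at any M > b
  still gives the full convolution; this makes the matrices finite for Cauchy-Binet.\<close>

lemma toeplitz_entry_mult:
  assumes "b < M"
  shows "toeplitz_entry (F * G) b a = (\<Sum>k<M. toeplitz_entry F b k * toeplitz_entry G k a)"
proof -
  have "(\<Sum>k<M. toeplitz_entry F b k * toeplitz_entry G k a) = (\<Sum>k\<in>{a..b}. fps_nth F (b - k) * fps_nth G (k - a))"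
    by (rule sum.mono_neutral_cong_right) (use assms in \<open>auto simp: toeplitz_entry_def\<close>)
  also have "\<dots> = toeplitz_entry (F * G) b a"
  proof (cases "a \<le> b")
    case True
    have "(\<Sum>k\<in>{a..b}. fps_nth F (b - k) * fps_nth G (k - a)) = (\<Sum>i\<in>{0..b - a}. fps_nth F i * fps_nth G (b - a - i))"
      by (rule sum.reindex_bij_witness[of _ "\<lambda>i. b - i" "\<lambda>k. b - k"]) (use True in auto)
    then show ?thesis using True by (simp add: toeplitz_entry_def fps_mult_nth)
  qed (simp add: toeplitz_entry_def)
  finally show ?thesis by simp
qed

definition dominated :: "nat \<Rightarrow> nat \<Rightarrow> (nat \<Rightarrow> nat) \<Rightarrow> (nat \<Rightarrow> nat) \<Rightarrow> bool" where
  "dominated N r b a \<longleftrightarrow> (\<forall>i<r. b i mod N = a i mod N \<and> a i \<le> b i)"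

text \<open>On each runner the positions alternate as b (i+1) < a i <= b i, which is the bead form
  of a horizontal strip.\<close>

definition interlacing :: "nat \<Rightarrow> nat \<Rightarrow> (nat \<Rightarrow> nat) \<Rightarrow> (nat \<Rightarrow> nat) \<Rightarrow> bool" where
  "interlacing N r b a \<longleftrightarrow> dominated N r b a \<and>
     (\<forall>i. Suc i < r \<and> b i mod N = b (Suc i) mod N \<longrightarrow> b (Suc i) < a i)"

text \<open>At an index k where domination fails, monotonicity of both orders spreads the failure:
  either to rows up to k against columns from k on, or to rows from k on against columns up to k.
  Both are zero blocks for \<open>leibniz_det_zero_block\<close>. The entry function f is arbitrary,
  so that with N = 1 the lemma also covers general power series.\<close>

lemma leibniz_det_zero_of_not_dominated:
  assumes b: "lexdec N r b" and a: "lexdec N r a"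
    and nd: "\<not> (\<forall>i<r. b i mod N = a i mod N \<and> a i \<le> b i)"
    and z: "\<And>x y. \<not> (x mod N = y mod N \<and> y \<le> x) \<Longrightarrow> f x y = 0"
  shows "leibniz_det r (\<lambda>i j. f (b i) (a j)) = 0"
proof -
  from nd obtain k where k: "k < r" "b k mod N \<noteq> a k mod N \<or> b k < a k" by (auto simp: not_le)
  show ?thesis
  proof (cases "b k mod N < a k mod N")
    case True
    have "leibniz_det r (\<lambda>j i. f (b i) (a j)) = 0"
    proof (rule leibniz_det_zero_block[OF k(1)])
      fix j i assume ij: "k \<le> j" "j < r" "i \<le> k"
      have "b i mod N \<le> b k mod N" "a k mod N \<le> a j mod N"
        using lexdec_mod_mono[OF b, of i k] lexdec_mod_mono[OF a, of k j] ij k by auto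
      then show "f (b i) (a j) = 0" using True by (intro z) auto
    qed
    then show ?thesis using leibniz_det_transpose[of r "\<lambda>i j. f (b i) (a j)"] by simp
  next
    case False
    show ?thesis
    proof (rule leibniz_det_zero_block[OF k(1)])
      fix i j assume ij: "k \<le> i" "i < r" "j \<le> k"
      have 1: "b k mod N \<le> b i mod N" "a j mod N \<le> a k mod N"
        using lexdec_mod_mono[OF b, of k i] lexdec_mod_mono[OF a, of j k] ij k by auto
      show "f (b i) (a j) = 0"
      proof (rule z, rule notI)
        assume e: "b i mod N = a j mod N \<and> a j \<le> b i"
        with 1 False k(2) have "b k mod N = b i mod N" "a j mod N = a k mod N" "b k < a k" by auto
        then have "b i \<le> b k" "a k \<le> a j"
          using lexdec_antimono[OF b, of k i] lexdec_antimono[OF a, of j k] ij k by auto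
        with e \<open>b k < a k\<close> show False by auto
      qed
    qed
  qed
qed

text \<open>With interlacing the matrix is upper triangular with ones on the diagonal. If domination
  holds but a i <= b (i+1) for two beads of one runner, the least such i gives two equal
  rows.\<close>

lemma leibniz_det_geom:
  assumes b: "lexdec N r b" and a: "lexdec N r a"
  shows "leibniz_det r (\<lambda>i j. toeplitz_entry (geom N) (b i) (a j)) = (if interlacing N r b a then 1 else 0)"
proof (cases "dominated N r b a")
  case False
  then have "leibniz_det r (\<lambda>i j. toeplitz_entry (geom N) (b i) (a j)) = 0"
    by (intro leibniz_det_zero_of_not_dominated[OF b a]) (auto simp: dominated_def toeplitz_entry_geom)
  then show ?thesis using False by (simp add: interlacing_def)
next
  case True
  then have d: "b i mod N = a i mod N" "a i \<le> b i" if "i < r" for i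
    using that by (auto simp: dominated_def)
  have same: "b (Suc j) mod N = b j mod N" if "j < i" "i < r" "b j mod N = b i mod N" for i j
    using lexdec_mod_mono[OF b, of j "Suc j"] lexdec_mod_mono[OF b, of "Suc j" i] that by auto
  have z: "a j > b i"
    if "j < i" "i < r" "b i mod N = a j mod N"
      "Suc j < r \<and> b j mod N = b (Suc j) mod N \<longrightarrow> b (Suc j) < a j" for i j
  proof -
    have 1: "b j mod N = b i mod N" using that d[of j] by simp
    have 2: "b (Suc j) mod N = b j mod N" using same[of j i] that 1 by simp
    have "b i \<le> b (Suc j)" using lexdec_antimono[OF b, of "Suc j" i] that 1 2 by simp
    then show ?thesis using that 1 2 by simp
  qed
  show ?thesis
  proof (cases "interlacing N r b a")
    case True
    have "leibniz_det r (\<lambda>i j. toeplitz_entry (geom N) (b i) (a j)) = (\<Prod>i<r. toeplitz_entry (geom N) (b i) (a i))"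
    proof (rule leibniz_det_upper_triangular)
      fix i j assume ij: "j < i" "i < r"
      show "toeplitz_entry (geom N) (b i) (a j) = 0"
        using z[OF ij] True by (auto simp: toeplitz_entry_geom interlacing_def)
    qed
    also have "\<dots> = 1" using d by (intro prod.neutral) (auto simp: toeplitz_entry_geom)
    finally show ?thesis using True by simp
  next
    case False
    define P where "P i \<longleftrightarrow> Suc i < r \<and> b i mod N = b (Suc i) mod N \<and> a i \<le> b (Suc i)" for i
    have "\<exists>i. P i" using False \<open>dominated N r b a\<close> by (auto simp: interlacing_def P_def not_less)
    \<comment> \<open>Minimality of i provides interlacing at every earlier j, so by
      \<open>z\<close> the columns j < i of this runner are zero in rows i and i + 1; the columns of
      this runner from i on are one in both.\<close>
    define i where "i = (LEAST i. P i)"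
    have Pi: "P i" unfolding i_def using \<open>\<exists>i. P i\<close> by (rule LeastI_ex)
    have min: "\<not> P j" if "j < i" for j using that not_less_Least unfolding i_def by blast
    have "leibniz_det r (\<lambda>i j. toeplitz_entry (geom N) (b i) (a j)) = 0"
    proof (rule leibniz_det_identical_rows[of i "Suc i"])
      show "i < r" "Suc i < r" using Pi by (auto simp: P_def)
      fix j assume j: "j < r"
      have "b (Suc i) < b i" using lexdecD[OF b, of i "Suc i"] Pi by (auto simp: P_def)
      show "toeplitz_entry (geom N) (b i) (a j) = toeplitz_entry (geom N) (b (Suc i)) (a j)"
      proof (cases "b i mod N = a j mod N")
        case False
        then show ?thesis using Pi by (auto simp: P_def toeplitz_entry_geom)
      next
        case True
        show ?thesis
        proof (cases "j < i")
          case True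
          have "b i < a j" by (rule z) (use True min[OF True] Pi \<open>b i mod N = a j mod N\<close> in \<open>auto simp: P_def\<close>)
          then show ?thesis using \<open>b (Suc i) < b i\<close> by (auto simp: toeplitz_entry_geom)
        next
          case False
          have "a j \<le> a i"
            using lexdec_antimono[OF a, of i j] False j True d[of i] by auto
          then show ?thesis using True Pi \<open>b (Suc i) < b i\<close> by (auto simp: P_def toeplitz_entry_geom)
        qed
      qed
    qed simp
    then show ?thesis using False by simp
  qed
qed

text \<open>For sets of equal size, N selects the order of rows and columns and hence affects the
  minor only by a sign.\<close>

definition toeplitz_minor :: "nat \<Rightarrow> complex fps \<Rightarrow> nat set \<Rightarrow> nat set \<Rightarrow> complex" where
  "toeplitz_minor N F B A = leibniz_det (card B) (\<lambda>i j. toeplitz_entry F (bead_enum N B i) (bead_enum N A j))"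

lemma toeplitz_minor_mult:
  assumes "B \<subseteq> {..<M}" "A \<subseteq> {..<M}" "card A = card B"
  shows "toeplitz_minor N (F * G) B A = (\<Sum>C | C \<subseteq> {..<M} \<and> card C = card B. toeplitz_minor N F B C * toeplitz_minor N G C A)"
proof -
  have fB: "finite B" using assms(1) finite_subset by blast
  have "toeplitz_minor N (F * G) B A = leibniz_det (card B) (\<lambda>i j. \<Sum>k<M. toeplitz_entry F (bead_enum N B i) k * toeplitz_entry G k (bead_enum N A j))"
    unfolding toeplitz_minor_def using bead_enum_bij[OF fB, of N] assms(1)
    by (intro leibniz_det_cong toeplitz_entry_mult) (auto simp: bij_betw_def)
  also have "\<dots> = (\<Sum>C | C \<subseteq> {..<M} \<and> card C = card B.
      leibniz_det (card B) (\<lambda>i l. toeplitz_entry F (bead_enum N B i) (bead_enum N C l)) * leibniz_det (card B) (\<lambda>l j. toeplitz_entry G (bead_enum N C l) (bead_enum N A j)))"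
  proof (rule Cauchy_Binet)
    fix C assume C: "C \<subseteq> {..<M}" "card C = card B"
    then show "bij_betw (bead_enum N C) {..<card B} C" using bead_enum_bij[of C N] finite_subset[of C] by auto
  qed simp
  also have "\<dots> = (\<Sum>C | C \<subseteq> {..<M} \<and> card C = card B. toeplitz_minor N F B C * toeplitz_minor N G C A)"
    by (intro sum.cong refl) (auto simp: toeplitz_minor_def)
  finally show ?thesis .
qed

text \<open>Two distinct sets of equal size leave some x in B outside A, and the row of x is
  zero.\<close>

lemma toeplitz_minor_one:
  assumes "finite B" "finite A" "card A = card B"
  shows "toeplitz_minor N 1 B A = (if B = A then 1 else 0)"
proof (cases "B = A")
  case True
  have "toeplitz_minor N 1 B B = (\<Prod>i<card B. toeplitz_entry 1 (bead_enum N B i) (bead_enum N B i))"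
    unfolding toeplitz_minor_def
  proof (rule leibniz_det_upper_triangular)
    fix i j assume "j < i" "i < card B"
    then have "bead_enum N B i \<noteq> bead_enum N B j"
      using inj_onD[OF lexdec_inj_on[OF bead_enum_lexdec[OF assms(1), of N]], of i j] by auto
    then show "toeplitz_entry 1 (bead_enum N B i) (bead_enum N B j) = 0" by (auto simp: toeplitz_entry_def)
  qed
  then show ?thesis using True by (simp add: toeplitz_entry_def)
next
  case False
  then obtain x where x: "x \<in> B" "x \<notin> A"
    using assms by (metis card_subset_eq subsetI)
  then have "x \<in> bead_enum N B ` {..<card B}"
    using bead_enum_bij[OF assms(1), of N] by (simp add: bij_betw_def)
  then obtain k where k: "k < card B" "bead_enum N B k = x" by auto
  have "toeplitz_minor N 1 B A = 0"
    unfolding toeplitz_minor_def leibniz_det_def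
  proof (intro sum.neutral ballI, goal_cases)
    case (1 p)
    have "p k < card A" using 1 k assms by (auto simp: permutes_lessThan_less)
    then have "bead_enum N A (p k) \<in> A" using bead_enum_bij[OF assms(2), of N] by (auto simp: bij_betw_def)
    then have "toeplitz_entry 1 (bead_enum N B k) (bead_enum N A (p k)) = 0" using x k by (auto simp: toeplitz_entry_def)
    then have "(\<Prod>i<card B. toeplitz_entry 1 (bead_enum N B i) (bead_enum N A (p i))) = 0"
      using k by (intro prod_zero) auto
    then show ?case by simp
  qed
  then show ?thesis using False by simp
qed

text \<open>Compares the decreasing order of the beads with the runner order. The product of these
  signs for lambda and mu will turn out to be the sign of the character value.\<close>

definition sort_sign :: "nat \<Rightarrow> nat set \<Rightarrow> int" where
  "sort_sign N B = sign (SOME p. p permutes {..<card B} \<and> (\<forall>i<card B. bead_enum 1 B i = bead_enum N B (p i)))"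

lemma sort_sign_cases: "sort_sign N B = 1 \<or> sort_sign N B = -1"
  unfolding sort_sign_def using sign_cases by blast

lemma sort_sign_square: "sort_sign N B * sort_sign N B = 1"
  using sort_sign_cases[of N B] by auto

lemma ex_permutation_between_enumerations:
  fixes f g :: "nat \<Rightarrow> nat"
  assumes f: "bij_betw f {..<n} B" and g: "bij_betw g {..<n} B"
  shows "\<exists>p. p permutes {..<n} \<and> (\<forall>i<n. f i = g (p i))"
proof -
  define p where "p = (\<lambda>i. if i < n then the_inv_into {..<n} g (f i) else i)"
  have "bij_betw (the_inv_into {..<n} g \<circ> f) {..<n} {..<n}"
    by (rule bij_betw_trans[OF f bij_betw_the_inv_into[OF g]])
  then have "bij_betw p {..<n} {..<n}"
    by (subst bij_betw_cong[of _ _ "the_inv_into {..<n} g \<circ> f"]) (auto simp: p_def)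
  then have "p permutes {..<n}"
    by (intro bij_imp_permutes) (auto simp: p_def)
  moreover have "f i = g (p i)" if "i < n" for i
  proof -
    have "f i \<in> B" using f that by (auto simp: bij_betw_def)
    then show ?thesis using f_the_inv_into_f_bij_betw[OF g] that by (simp add: p_def)
  qed
  ultimately show ?thesis by blast
qed

lemma ex_bead_enum_permutation:
  assumes "finite B"
  shows "\<exists>p. p permutes {..<card B} \<and> (\<forall>i<card B. bead_enum 1 B i = bead_enum N B (p i))"
  by (rule ex_permutation_between_enumerations[OF bead_enum_bij[OF assms] bead_enum_bij[OF assms]])

lemma toeplitz_minor_eps:
  assumes "finite B" "finite A" "card A = card B"
  shows "toeplitz_minor 1 F B A = of_int (sort_sign N B * sort_sign N A) * toeplitz_minor N F B A"
proof -
  define p where "p = (SOME p. p permutes {..<card B} \<and> (\<forall>i<card B. bead_enum 1 B i = bead_enum N B (p i)))"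
  define q where "q = (SOME p. p permutes {..<card A} \<and> (\<forall>i<card A. bead_enum 1 A i = bead_enum N A (p i)))"
  have p: "p permutes {..<card B}" "\<And>i. i < card B \<Longrightarrow> bead_enum 1 B i = bead_enum N B (p i)"
    using someI_ex[OF ex_bead_enum_permutation[OF assms(1), of N]] unfolding p_def by auto
  have q: "q permutes {..<card A}" "\<And>i. i < card A \<Longrightarrow> bead_enum 1 A i = bead_enum N A (q i)"
    using someI_ex[OF ex_bead_enum_permutation[OF assms(2), of N]] unfolding q_def by auto
  have "toeplitz_minor 1 F B A = leibniz_det (card B) (\<lambda>i j. toeplitz_entry F (bead_enum N B (p i)) (bead_enum N A (q j)))"
    unfolding toeplitz_minor_def by (rule leibniz_det_cong) (use p q assms in auto)
  also have "\<dots> = of_int (sign p) * leibniz_det (card B) (\<lambda>i j. toeplitz_entry F (bead_enum N B i) (bead_enum N A (q j)))"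
    by (rule leibniz_det_permute_rows[OF p(1), where f="\<lambda>i j. toeplitz_entry F (bead_enum N B i) (bead_enum N A (q j))"])
  also have "leibniz_det (card B) (\<lambda>i j. toeplitz_entry F (bead_enum N B i) (bead_enum N A (q j)))
     = of_int (sign q) * leibniz_det (card B) (\<lambda>i j. toeplitz_entry F (bead_enum N B i) (bead_enum N A j))"
    by (rule leibniz_det_permute_cols[where f="\<lambda>i j. toeplitz_entry F (bead_enum N B i) (bead_enum N A j)"]) (use q assms in auto)
  finally show ?thesis by (simp add: toeplitz_minor_def sort_sign_def p_def q_def)
qed

definition interlaced :: "nat \<Rightarrow> nat set \<Rightarrow> nat set \<Rightarrow> bool" where
  "interlaced N B A \<longleftrightarrow> interlacing N (card B) (bead_enum N B) (bead_enum N A)"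

lemma toeplitz_minor_geom:
  assumes "finite B" "finite A" "card A = card B"
  shows "toeplitz_minor N (geom N) B A = (if interlaced N B A then 1 else 0)"
  unfolding toeplitz_minor_def interlaced_def
  using leibniz_det_geom[OF bead_enum_lexdec[OF assms(1)], of N "bead_enum N A"] bead_enum_lexdec[OF assms(2), of N] assms(3) by simp

text \<open>Each link of a chain is a horizontal strip on every runner. The bound M on positions
  makes the sum over C finite; it is taken above all beads of B and A.\<close>

fun num_chains :: "nat \<Rightarrow> nat \<Rightarrow> nat \<Rightarrow> nat set \<Rightarrow> nat set \<Rightarrow> nat" where
  "num_chains N M 0 B A = (if B = A then 1 else 0)"
| "num_chains N M (Suc j) B A =
     (\<Sum>C | C \<subseteq> {..<M} \<and> card C = card B. if interlaced N B C then num_chains N M j C A else 0)"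

lemma toeplitz_minor_geom_power:
  assumes "B \<subseteq> {..<M}" "A \<subseteq> {..<M}" "card A = card B"
  shows "toeplitz_minor N (geom N ^ j) B A = of_nat (num_chains N M j B A)"
  using assms
proof (induction j arbitrary: B)
  case 0
  then show ?case using finite_subset[of _ "{..<M}"] by (auto simp: toeplitz_minor_one)
next
  case (Suc j)
  have "toeplitz_minor N (geom N ^ Suc j) B A = (\<Sum>C | C \<subseteq> {..<M} \<and> card C = card B. toeplitz_minor N (geom N) B C * toeplitz_minor N (geom N ^ j) C A)"
    using toeplitz_minor_mult[OF Suc.prems, of N "geom N" "geom N ^ j"] by simp
  also have "\<dots> = (\<Sum>C | C \<subseteq> {..<M} \<and> card C = card B. of_nat (if interlaced N B C then num_chains N M j C A else 0))"
  proof (intro sum.cong refl)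
    fix C assume C: "C \<in> {C. C \<subseteq> {..<M} \<and> card C = card B}"
    have "finite B" "finite C" using C Suc.prems finite_subset[of _ "{..<M}"] by auto
    then show "toeplitz_minor N (geom N) B C * toeplitz_minor N (geom N ^ j) C A = of_nat (if interlaced N B C then num_chains N M j C A else 0)"
      using toeplitz_minor_geom[of B C N] Suc.IH[of C] C Suc.prems by auto
  qed
  finally show ?case by simp
qed

text \<open>An idle link: chains may pause, which supplies one of the two terms of Pascal's rule in
  \<open>num_chains_ge_binomial\<close>.\<close>

lemma interlaced_refl:
  assumes "finite B" shows "interlaced N B B"
  using lexdecD[OF bead_enum_lexdec[OF assms, of N]]
  by (fastforce simp: interlaced_def interlacing_def dominated_def)

text \<open>Moving a last bead that is not yet in its final position up by one row.\<close>

lemma ex_bead_step: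
  assumes N: "N > 0" and fin: "finite B" "finite A" and card: "card A = card B"
    and dom: "dominated N (card B) (bead_enum N B) (bead_enum N A)"
    and sum: "(\<Sum>i<card B. bead_enum N B i - bead_enum N A i) = N * Suc m"
  obtains C where "C \<noteq> B" "card C = card B" "\<And>x. x \<in> C \<Longrightarrow> \<exists>y\<in>B. x \<le> y" "interlaced N B C"
    "dominated N (card B) (bead_enum N C) (bead_enum N A)" "(\<Sum>i<card B. bead_enum N C i - bead_enum N A i) = N * m"
proof -
  let ?r = "card B"
  let ?b = "bead_enum N B" and ?a = "bead_enum N A"
  have lb: "lexdec N ?r ?b" using bead_enum_lexdec[OF fin(1)] .
  have la: "lexdec N ?r ?a" using bead_enum_lexdec[OF fin(2), of N] card by simp
  have d: "?b i mod N = ?a i mod N" "?a i \<le> ?b i" if "i < ?r" for i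
    using dom that by (auto simp: dominated_def)
  define S where "S = {i. i < ?r \<and> ?a i < ?b i}"
  have "S \<noteq> {}"
  proof
    assume "S = {}"
    then have "(\<Sum>i<?r. ?b i - ?a i) = 0" by (intro sum.neutral) (auto simp: S_def)
    with sum N show False by simp
  qed
  \<comment> \<open>Every bead after the last unfinished one is already final. On the same runner it
    has a position smaller than \<open>?a k\<close>, so it cannot obstruct the move to
    \<open>?b k - N\<close>.\<close>
  define k where "k = Max S"
  have fS: "finite S" by (auto simp: S_def)
  have kS: "k < ?r" "?a k < ?b k" using Max_in[OF fS \<open>S \<noteq> {}\<close>] by (auto simp: k_def S_def)
  have later: "?a j = ?b j" if "k < j" "j < ?r" for j
  proof (rule ccontr)
    assume "?a j \<noteq> ?b j"
    then have "j \<in> S" using d(2)[of j] that by (auto simp: S_def)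
    then show False using that Max_ge[OF fS, of j] by (simp add: k_def)
  qed
  have "N dvd ?b k - ?a k" using d[OF kS(1)] mod_eq_dvd_iff_nat by blast
  then have ge: "?a k + N \<le> ?b k" using kS(2) dvd_imp_le[of N "?b k - ?a k"] by simp
  define c where "c = ?b(k := ?b k - N)"
  have cm: "c i mod N = ?b i mod N" for i
    using ge by (auto simp: c_def le_mod_geq)
  have cle: "c i \<le> ?b i" for i by (simp add: c_def)
  have lc: "lexdec N ?r c"
    unfolding lexdec_def
  proof (intro allI impI)
    fix i j assume ij: "i < j \<and> j < ?r"
    have "c j < c i" if e: "?b i mod N = ?b j mod N"
    proof (cases "i = k")
      case True
      have "?b j = ?a j" using later ij True by simp
      also have "\<dots> < ?a i" using lexdecD[OF la, of i j] ij e d(1)[of i] d(1)[of j] by auto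
      also have "\<dots> \<le> c i" using True ge by (simp add: c_def)
      finally show ?thesis using cle[of j] by simp
    next
      case False
      have "c j \<le> ?b j" by (rule cle)
      also have "\<dots> < ?b i" using lexdecD[OF lb, of i j] ij e by auto
      finally show ?thesis using False by (simp add: c_def)
    qed
    then show "c i mod N < c j mod N \<or> (c i mod N = c j mod N \<and> c j < c i)"
      using lexdecD[OF lb, of i j] ij unfolding cm by auto
  qed
  define C where "C = c ` {..<?r}"
  have enC: "card C = ?r" "\<And>i. i < ?r \<Longrightarrow> bead_enum N C i = c i"
    using bead_enum_eqI[OF lc C_def[symmetric]] kS(1) by auto
  have ck: "c k < ?b k" using ge N by (simp add: c_def)
  show ?thesis
  proof
    show "C \<noteq> B" using enC(2)[OF kS(1)] ck by auto
    show "card C = ?r" by (rule enC)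
    show "\<exists>y\<in>B. x \<le> y" if "x \<in> C" for x
      using that cle bead_enum_bij[OF fin(1), of N] by (auto simp: C_def bij_betw_def)
    have "interlacing N ?r ?b c"
      unfolding interlacing_def dominated_def
    proof (intro conjI allI impI)
      fix i assume "i < ?r"
      show "?b i mod N = c i mod N" "c i \<le> ?b i" using cm cle by auto
    next
      fix i assume i: "Suc i < ?r \<and> ?b i mod N = ?b (Suc i) mod N"
      show "?b (Suc i) < c i"
      proof (cases "i = k")
        case True
        have "?b (Suc i) = ?a (Suc i)" using later[of "Suc i"] i True by simp
        also have "\<dots> < ?a i" using lexdecD[OF la, of i "Suc i"] i d(1)[of i] d(1)[of "Suc i"] by auto
        also have "\<dots> \<le> c i" using True ge by (simp add: c_def)
        finally show ?thesis .
      next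
        case False
        then show ?thesis using lexdecD[OF lb, of i "Suc i"] i by (auto simp: c_def)
      qed
    qed
    then show "interlaced N B C"
      unfolding interlaced_def interlacing_def dominated_def using enC by simp
    show "dominated N ?r (bead_enum N C) ?a"
      unfolding dominated_def
    proof (intro allI impI)
      fix i assume i: "i < ?r"
      show "bead_enum N C i mod N = ?a i mod N \<and> ?a i \<le> bead_enum N C i"
        using d[OF i] enC(2)[OF i] cm[of i] ge by (auto simp: c_def)
    qed
    have "(\<Sum>i<?r. bead_enum N C i - ?a i) = (\<Sum>i<?r. c i - ?a i)" using enC by simp
    also have "\<dots> = (c k - ?a k) + (\<Sum>i\<in>{..<?r} - {k}. ?b i - ?a i)"
      by (subst sum.remove[of _ k]) (use kS in \<open>auto simp: c_def\<close>)
    also have "(\<Sum>i\<in>{..<?r} - {k}. ?b i - ?a i) = N * Suc m - (?b k - ?a k)"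
      using sum sum.remove[of "{..<?r}" k "\<lambda>i. ?b i - ?a i"] kS by simp
    also have "(c k - ?a k) + (N * Suc m - (?b k - ?a k)) = N * m"
    proof -
      have "?b k - ?a k \<le> N * Suc m"
        using sum member_le_sum[of k "{..<?r}" "\<lambda>i. ?b i - ?a i"] kS by simp
      then show ?thesis using ge by (simp add: c_def)
    qed
    finally show "(\<Sum>i<?r. bead_enum N C i - ?a i) = N * m" .
  qed
qed

text \<open>Pascal's rule: the first of j + 1 links may stay at B or make the elementary move of
  \<open>ex_bead_step\<close>, which lowers m by one. These are two different terms of the chain
  count, hence the lower bound.\<close>

lemma num_chains_ge_binomial:
  assumes N: "N > 0" and "B \<subseteq> {..<M}" "A \<subseteq> {..<M}" "card A = card B"
    "dominated N (card B) (bead_enum N B) (bead_enum N A)" "(\<Sum>i<card B. bead_enum N B i - bead_enum N A i) = N * m"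
  shows "j choose m \<le> num_chains N M j B A"
  using assms(2-)
proof (induction j arbitrary: B m)
  case j: (0 B m)
  have fin: "finite B" "finite A" using j finite_subset[of _ "{..<M}"] by auto
  show ?case
  proof (cases m)
    case 0
    then have "bead_enum N B i = bead_enum N A i" if "i < card B" for i
      using j that N by (auto simp: dominated_def intro: le_antisym)
    then have "bead_enum N B ` {..<card B} = bead_enum N A ` {..<card A}" using j by auto
    then have "B = A" using bead_enum_bij[OF fin(1), of N] bead_enum_bij[OF fin(2), of N] by (simp add: bij_betw_def)
    then show ?thesis using 0 by simp
  qed simp
next
  case (Suc j B m)
  have fin: "finite B" "finite A" using Suc finite_subset[of _ "{..<M}"] by auto
  let ?S = "{C. C \<subseteq> {..<M} \<and> card C = card B}"
  let ?g = "\<lambda>C. if interlaced N B C then num_chains N M j C A else 0"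
  have fS: "finite ?S" by (rule finite_subset[of _ "Pow {..<M}"]) auto
  have BS: "B \<in> ?S" using Suc by simp
  have gB: "?g B = num_chains N M j B A" using interlaced_refl[OF fin(1)] by simp
  show ?case
  proof (cases m)
    case 0
    have "1 \<le> ?g B" using Suc.IH[of B m] Suc.prems gB 0 by simp
    also have "\<dots> \<le> num_chains N M (Suc j) B A" using member_le_sum[OF BS, of ?g] fS by simp
    finally show ?thesis using 0 by simp
  next
    case (Suc m')
    obtain C where C: "C \<noteq> B" "card C = card B" "\<And>x. x \<in> C \<Longrightarrow> \<exists>y\<in>B. x \<le> y" "interlaced N B C"
      "dominated N (card B) (bead_enum N C) (bead_enum N A)" "(\<Sum>i<card B. bead_enum N C i - bead_enum N A i) = N * m'"
      using ex_bead_step[OF N fin, of m'] Suc.prems Suc by metis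
    have CM: "C \<subseteq> {..<M}" using C(3) \<open>B \<subseteq> {..<M}\<close> by fastforce
    have "Suc j choose m = (j choose m) + (j choose m')" using Suc by simp
    also have "\<dots> \<le> ?g B + ?g C"
      using Suc.IH[of B m] Suc.IH[of C m'] Suc.prems C CM gB by simp
    also have "\<dots> = sum ?g {B, C}" using C(1) by simp
    also have "\<dots> \<le> sum ?g ?S" by (rule sum_mono2[OF fS]) (use BS C CM in auto)
    finally show ?thesis by simp
  qed
qed


section \<open>The Jacobi--Trudi identity\<close>

text \<open>Serves for supports of partitions, rows of tableaux and runners of cores: the
  cardinality marks the boundary of an initial segment.\<close>

lemma lessThan_card_of_downward_closed:
  fixes S :: "nat set"
  assumes fin: "finite S" and dc: "\<And>i j. i \<in> S \<Longrightarrow> j < i \<Longrightarrow> j \<in> S"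
  shows "S = {..<card S}"
proof -
  define k where "k = (LEAST k. k \<notin> S)"
  have "\<exists>k. k \<notin> S" using fin by (meson ex_new_if_finite infinite_UNIV_nat)
  then have "k \<notin> S" unfolding k_def by (rule LeastI_ex)
  moreover have "j \<in> S" if "j < k" for j using that not_less_Least unfolding k_def by blast
  moreover have "\<not> k < j" if "j \<in> S" for j using dc[OF that] \<open>k \<notin> S\<close> by blast
  ultimately have "j \<in> S \<longleftrightarrow> j < k" for j by (metis linorder_neqE_nat)
  then have "S = {..<k}" by auto
  then show ?thesis by simp
qed

lemma is_partition_le: "is_partition p \<Longrightarrow> i \<le> j \<Longrightarrow> p j \<le> p i"
  by (auto simp: is_partition_def antimono_def)

lemma is_partition_support:
  assumes "is_partition p" shows "{i. p i \<noteq> 0} = {..<plength p}"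
  unfolding plength_def
proof (rule lessThan_card_of_downward_closed)
  show "finite {i. p i \<noteq> 0}" using assms by (simp add: is_partition_def)
  fix i j assume "i \<in> {i. p i \<noteq> 0}" "j < i"
  then show "j \<in> {i. p i \<noteq> 0}" using is_partition_le[OF assms, of j i] by auto
qed

lemma is_partition_nonzero_iff: "is_partition p \<Longrightarrow> p i \<noteq> 0 \<longleftrightarrow> i < plength p"
  using is_partition_support[of p] by auto

lemma plength_le_iff: "is_partition p \<Longrightarrow> plength p \<le> r \<longleftrightarrow> (\<forall>i\<ge>r. p i = 0)"
proof -
  assume "is_partition p"
  then have z: "p i = 0 \<longleftrightarrow> plength p \<le> i" for i using is_partition_nonzero_iff[of p i] by linarith
  show ?thesis unfolding z using le_trans by blast
qed

lemma is_partitionI: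
  assumes "\<And>i. p (Suc i) \<le> p i" "\<And>i. i \<ge> r \<Longrightarrow> p i = 0"
  shows "is_partition p"
  unfolding is_partition_def
proof
  show "antimono p" using assms(1) by (simp add: antimono_iff_le_Suc)
  have "i < r" if "p i \<noteq> 0" for i
    by (rule ccontr) (use assms(2)[of i] that in simp)
  then show "finite {i. p i \<noteq> 0}" by (auto intro: finite_subset[OF _ finite_lessThan[of r]])
qed

lemma is_partition_zero_ge: "is_partition p \<Longrightarrow> plength p \<le> r \<Longrightarrow> r \<le> i \<Longrightarrow> p i = 0"
  by (simp add: plength_le_iff)

lemma is_partition_zero [simp]: "is_partition empty_partition"
  by (simp add: is_partition_def antimono_def)

lemma plength_zero [simp]: "plength empty_partition = 0"
  by (simp add: plength_def)

lemma skew_partitionD: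
  assumes "skew_partition lam mu"
  shows "is_partition lam" "is_partition mu" "mu i \<le> lam i" "plength mu \<le> plength lam"
proof -
  have *: "is_partition lam" "is_partition mu" "mu i \<le> lam i" for i using assms by (auto simp: skew_partition_def)
  show "is_partition lam" "is_partition mu" "mu i \<le> lam i" by (rule *)+
  show "plength mu \<le> plength lam"
    unfolding plength_le_iff[OF *(2)]
  proof (intro allI impI)
    fix i assume "plength lam \<le> i"
    then have "lam i = 0" using plength_le_iff[OF *(1), of "plength lam"] by blast
    then show "mu i = 0" using *(3)[of i] by simp
  qed
qed

lemma skew_partition_zero: "is_partition lam \<Longrightarrow> skew_partition lam empty_partition"
  by (simp add: skew_partition_def)

lemma cells_Sigma:
  assumes "\<And>i. i \<ge> r \<Longrightarrow> lam i = 0"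
  shows "cells lam mu = (SIGMA i:{..<r}. {mu i..<lam i})"
  using assms by (auto simp: cells_def) (metis linorder_not_le not_less_zero)

lemma finite_cells: "is_partition lam \<Longrightarrow> finite (cells lam mu)"
  by (subst cells_Sigma[of "plength lam"]) (auto simp: is_partition_zero_ge)

lemma card_cells:
  assumes "\<And>i. i \<ge> r \<Longrightarrow> lam i = 0"
  shows "card (cells lam mu) = (\<Sum>i<r. lam i - mu i)"
  by (subst cells_Sigma[OF assms]) auto

lemma psize_eq:
  assumes "is_partition lam" "plength lam \<le> r"
  shows "psize lam = (\<Sum>i<r. lam i)"
  unfolding psize_def
  by (rule sum.mono_neutral_left) (use assms plength_le_iff[of lam "plength lam"] in auto)

lemma finite_bounded_functions:
  assumes "\<And>i. i \<ge> r \<Longrightarrow> lam i = 0"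
  shows "finite {k :: nat \<Rightarrow> nat. \<forall>i. k i \<le> lam i}"
proof (rule finite_subset)
  show "finite {k :: nat \<Rightarrow> nat. \<forall>i. (i \<in> {..<r} \<longrightarrow> k i \<in> {..Max (lam ` {..<r})}) \<and> (i \<notin> {..<r} \<longrightarrow> k i = 0)}"
    by (rule finite_set_of_finite_funs) auto
  show "{k. \<forall>i. k i \<le> lam i} \<subseteq> {k. \<forall>i. (i \<in> {..<r} \<longrightarrow> k i \<in> {..Max (lam ` {..<r})}) \<and> (i \<notin> {..<r} \<longrightarrow> k i = 0)}"
  proof clarify
    fix k i assume k: "\<forall>i. k i \<le> lam i"
    have "k i \<le> Max (lam ` {..<r})" if "i < r"
    proof -
      have "lam i \<le> Max (lam ` {..<r})" using that by (intro Max_ge) auto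
      then show ?thesis using spec[OF k, of i] by simp
    qed
    moreover have "k i = 0" if "\<not> i < r" using k assms[of i] that by (metis le_zero_eq linorder_not_less)
    ultimately show "(i \<in> {..<r} \<longrightarrow> k i \<in> {..Max (lam ` {..<r})}) \<and> (i \<notin> {..<r} \<longrightarrow> k i = 0)" by simp
  qed
qed

section \<open>The branching rule: removing the largest letter\<close>

definition inner_strips :: "(nat \<Rightarrow> nat) \<Rightarrow> (nat \<Rightarrow> nat) \<Rightarrow> (nat \<Rightarrow> nat) set" where
  "inner_strips lam mu = {k. is_partition k \<and> (\<forall>i. mu i \<le> k i \<and> k i \<le> lam i \<and> lam (Suc i) \<le> k i)}"

lemma finite_inner_strips: "is_partition lam \<Longrightarrow> finite (inner_strips lam mu)"
  by (rule finite_subset[OF _ finite_bounded_functions[of "plength lam" lam]])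
    (auto simp: inner_strips_def is_partition_zero_ge)

lemma inner_strips_plength_le: "is_partition lam \<Longrightarrow> k \<in> inner_strips lam mu \<Longrightarrow> plength k \<le> plength lam"
  by (rule skew_partitionD(4)) (simp add: inner_strips_def skew_partition_def)

lemma finite_ssyt: "is_partition lam \<Longrightarrow> finite (ssyt lam mu n)"
  by (rule finite_subset[of _ "cells lam mu \<rightarrow>\<^sub>E {..<n}"])
    (auto simp: ssyt_def intro!: finite_PiE finite_cells)

text \<open>The shape left after deleting the letter n. The columns before \<open>mu i\<close> are
  counted too, so that the value is a row length of the smaller outer shape.\<close>

definition inner_shape :: "(nat \<Rightarrow> nat) \<Rightarrow> (nat \<Rightarrow> nat) \<Rightarrow> nat \<Rightarrow> (nat \<times> nat \<Rightarrow> nat) \<Rightarrow> nat \<Rightarrow> nat" where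
  "inner_shape lam mu n T i = card {j. j < mu i \<or> (j < lam i \<and> T (i, j) < n)}"

text \<open>Inverse to the deletion of n. The value \<open>undefined\<close> off the shape keeps the
  filling in the extensional function space of \<open>ssyt\<close>.\<close>

definition extend_ssyt :: "(nat \<Rightarrow> nat) \<Rightarrow> (nat \<Rightarrow> nat) \<Rightarrow> nat \<Rightarrow> (nat \<Rightarrow> nat) \<Rightarrow> (nat \<times> nat \<Rightarrow> nat) \<Rightarrow> nat \<times> nat \<Rightarrow> nat" where
  "extend_ssyt lam mu n k T = (\<lambda>c. if c \<in> cells k mu then T c else if c \<in> cells lam mu then n else undefined)"

lemma ssytD:
  assumes "T \<in> ssyt lam mu n"
  shows "T \<in> extensional (cells lam mu)"
    "mu i \<le> j \<Longrightarrow> j < lam i \<Longrightarrow> T (i, j) < n"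
    "mu i \<le> j \<Longrightarrow> j \<le> j' \<Longrightarrow> j' < lam i \<Longrightarrow> T (i, j) \<le> T (i, j')"
    "mu i \<le> j \<Longrightarrow> j < lam i \<Longrightarrow> mu i' \<le> j \<Longrightarrow> j < lam i' \<Longrightarrow> i < i' \<Longrightarrow> T (i, j) < T (i', j)"
proof -
  show "T \<in> extensional (cells lam mu)" using assms by (auto simp: ssyt_def PiE_def)
  show "T (i, j) < n" if "mu i \<le> j" "j < lam i"
    using assms that by (auto simp: ssyt_def cells_def PiE_def Pi_def)
  show "T (i, j) \<le> T (i, j')" if "mu i \<le> j" "j \<le> j'" "j' < lam i"
    using assms that unfolding ssyt_def cells_def by (cases "j = j'") auto
  show "T (i, j) < T (i', j)" if "mu i \<le> j" "j < lam i" "mu i' \<le> j" "j < lam i'" "i < i'"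
    using assms that unfolding ssyt_def cells_def by auto
qed

lemma inner_shape_less_iff:
  assumes "skew_partition lam mu" "T \<in> ssyt lam mu m"
  shows "j < inner_shape lam mu n T i \<longleftrightarrow> j < mu i \<or> (j < lam i \<and> T (i, j) < n)"
proof -
  have "{j. j < mu i \<or> (j < lam i \<and> T (i, j) < n)} = {..<card {j. j < mu i \<or> (j < lam i \<and> T (i, j) < n)}}"
  proof (rule lessThan_card_of_downward_closed)
    show "finite {j. j < mu i \<or> (j < lam i \<and> T (i, j) < n)}"
      by (rule finite_subset[of _ "{..<mu i + lam i}"]) auto
    fix a b assume "a \<in> {j. j < mu i \<or> (j < lam i \<and> T (i, j) < n)}" "b < a"
    then show "b \<in> {j. j < mu i \<or> (j < lam i \<and> T (i, j) < n)}"
      using ssytD(3)[OF assms(2), of i b a] by (auto simp: not_less)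
  qed
  then show ?thesis unfolding inner_shape_def by blast
qed

lemma inner_shape_in_inner_strips:
  assumes sk: "skew_partition lam mu" and T: "T \<in> ssyt lam mu (Suc n)"
  shows "inner_shape lam mu n T \<in> inner_strips lam mu"
proof -
  let ?k = "inner_shape lam mu n T"
  note less = inner_shape_less_iff[OF sk T, of _ n]
  note p = skew_partitionD[OF sk]
  have leI: "a \<le> b" if "\<And>j. j < a \<Longrightarrow> j < b" for a b :: nat using that by (metis linorder_not_less order_less_irrefl)
  have 1: "mu i \<le> ?k i" for i by (rule leI) (simp add: less)
  have 2: "?k i \<le> lam i" for i by (rule leI) (use p(3)[of i] in \<open>auto simp: less\<close>)
  have 3: "?k (Suc i) \<le> ?k i" for i
  proof (rule leI)
    fix j assume "j < ?k (Suc i)"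
    then show "j < ?k i"
      using is_partition_le[OF p(1), of i "Suc i"] is_partition_le[OF p(2), of i "Suc i"]
        ssytD(4)[OF T, of i j "Suc i"] by (auto simp: less not_less)
  qed
  \<comment> \<open>A cell directly above another one holds a smaller entry, hence an entry below n:
    cells carrying n have nothing under them.\<close>
  have 4: "lam (Suc i) \<le> ?k i" for i
  proof (rule leI)
    fix j assume j: "j < lam (Suc i)"
    have "T (i, j) < n" if "mu i \<le> j"
      using is_partition_le[OF p(1), of i "Suc i"] is_partition_le[OF p(2), of i "Suc i"]
        ssytD(4)[OF T, of i j "Suc i"] ssytD(2)[OF T, of "Suc i" j] j that by auto
    then show "j < ?k i"
      using is_partition_le[OF p(1), of i "Suc i"] j by (cases "mu i \<le> j") (auto simp: less)
  qed
  have "is_partition ?k"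
  proof (rule is_partitionI[of _ "plength lam"])
    fix i assume "plength lam \<le> i"
    then show "?k i = 0" using 2[of i] plength_le_iff[OF p(1), of "plength lam"] by simp
  qed (rule 3)
  then show ?thesis using 1 2 4 by (simp add: inner_strips_def)
qed

lemma inner_stripsD:
  assumes "k \<in> inner_strips lam mu"
  shows "is_partition k" "mu i \<le> k i" "k i \<le> lam i" "lam (Suc i) \<le> k i"
  using assms by (auto simp: inner_strips_def)

lemma cells_inner_subset:
  assumes "k \<in> inner_strips lam mu" shows "cells k mu \<subseteq> cells lam mu"
proof
  fix c assume "c \<in> cells k mu"
  then show "c \<in> cells lam mu" using inner_stripsD(3)[OF assms, of "fst c"] by (auto simp: cells_def)
qed

lemma restrict_ssyt:
  assumes sk: "skew_partition lam mu" and T: "T \<in> ssyt lam mu (Suc n)"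
  shows "restrict T (cells (inner_shape lam mu n T) mu) \<in> ssyt (inner_shape lam mu n T) mu n"
proof -
  let ?k = "inner_shape lam mu n T"
  note less = inner_shape_less_iff[OF sk T, of _ n]
  have c: "(i, j) \<in> cells ?k mu \<longleftrightarrow> mu i \<le> j \<and> j < lam i \<and> T (i, j) < n" for i j
    by (auto simp: cells_def less)
  then show ?thesis
    unfolding ssyt_def
  proof (intro CollectI conjI allI impI, goal_cases)
    case 1
    then show ?case by (auto simp: PiE_def Pi_def)
  next
    case (2 i j j')
    then show ?case using ssytD(3)[OF T, of i j j'] by simp
  next
    case (3 i i' j)
    then show ?case using ssytD(4)[OF T, of i j i'] by simp
  qed
qed

lemma extend_in_ssyt:
  assumes sk: "skew_partition lam mu" and k: "k \<in> inner_strips lam mu" and T: "T \<in> ssyt k mu n"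
  shows "extend_ssyt lam mu n k T \<in> ssyt lam mu (Suc n)"
proof -
  note m = inner_stripsD[OF k]
  let ?E = "extend_ssyt lam mu n k T"
  have E: "?E (i, j) = (if j < k i then T (i, j) else n)" if "mu i \<le> j" "j < lam i" for i j
    using that by (auto simp: extend_ssyt_def cells_def)
  show ?thesis
    unfolding ssyt_def
  proof (intro CollectI conjI allI impI, goal_cases)
    case 1
    show ?case
    proof (rule PiE_I)
      fix c assume "c \<in> cells lam mu"
      then obtain i j where c: "c = (i, j)" "mu i \<le> j" "j < lam i" by (auto simp: cells_def)
      then show "?E c \<in> {..<Suc n}" using E[of i j] ssytD(2)[OF T, of i j] by auto
    next
      fix c assume "c \<notin> cells lam mu"
      then show "?E c = undefined" using cells_inner_subset[OF k] by (auto simp: extend_ssyt_def)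
    qed
  next
    case (2 i j j')
    then have "mu i \<le> j" "j < j'" "j' < lam i" by (auto simp: cells_def)
    then show ?case using E[of i j] E[of i j'] ssytD(3)[OF T, of i j j'] ssytD(2)[OF T, of i j] by auto
  next
    case (3 i i' j)
    then have h: "mu i \<le> j" "mu i' \<le> j" "j < lam i'" "j < lam i" "i < i'" by (auto simp: cells_def)
    have "lam i' \<le> lam (Suc i)" using h skew_partitionD(1)[OF sk] by (simp add: is_partition_le)
    then have "j < k i" using m(4)[of i] h by simp
    then show ?case using E[of i j] E[of i' j] ssytD(4)[OF T, of i j i'] ssytD(2)[OF T, of i j] h by auto
  qed
qed

text \<open>Tableaux are grouped by the shape k of their entries below n. The remaining cells all
  carry n and form a horizontal strip.\<close>

lemma skew_schur_Suc:
  assumes sk: "skew_partition lam mu"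
  shows "skew_schur lam mu (Suc n) x = (\<Sum>k\<in>inner_strips lam mu. x n ^ card (cells lam k) * skew_schur k mu n x)"
proof -
  note p = skew_partitionD[OF sk]
  have "skew_schur lam mu (Suc n) x = (\<Sum>(k, T)\<in>(SIGMA k:inner_strips lam mu. ssyt k mu n).
      \<Prod>c\<in>cells lam mu. x (extend_ssyt lam mu n k T c))"
    unfolding skew_schur_def
  proof (rule sum.reindex_bij_witness[of _ "\<lambda>(k, T). extend_ssyt lam mu n k T"
        "\<lambda>T. (inner_shape lam mu n T, restrict T (cells (inner_shape lam mu n T) mu))"])
    fix T assume T: "T \<in> ssyt lam mu (Suc n)"
    let ?k = "inner_shape lam mu n T"
    have "extend_ssyt lam mu n ?k (restrict T (cells ?k mu)) = T"
    proof
      fix c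
      show "extend_ssyt lam mu n ?k (restrict T (cells ?k mu)) c = T c"
      proof (cases "c \<in> cells lam mu - cells ?k mu")
        case True
        then obtain i j where c: "c = (i, j)" "mu i \<le> j" "j < lam i" "\<not> j < ?k i" by (auto simp: cells_def)
        then have "T c = n" using ssytD(2)[OF T, of i j] inner_shape_less_iff[OF sk T, of j n i] by auto
        then show ?thesis using True by (simp add: extend_ssyt_def)
      next
        case False
        then show ?thesis using extensional_arb[of T "cells lam mu" c] ssytD(1)[OF T] by (auto simp: extend_ssyt_def)
      qed
    qed
    then show "(case (?k, restrict T (cells ?k mu)) of (k, T) \<Rightarrow> extend_ssyt lam mu n k T) = T" by simp
    then show "(case (?k, restrict T (cells ?k mu)) of (k, T) \<Rightarrow> \<Prod>c\<in>cells lam mu. x (extend_ssyt lam mu n k T c))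
      = (\<Prod>c\<in>cells lam mu. x (T c))" by simp
    show "(?k, restrict T (cells ?k mu)) \<in> (SIGMA k:inner_strips lam mu. ssyt k mu n)"
      using inner_shape_in_inner_strips[OF sk T] restrict_ssyt[OF sk T] by simp
  next
    fix kT assume "kT \<in> (SIGMA k:inner_strips lam mu. ssyt k mu n)"
    then obtain k T where kT: "kT = (k, T)" and k: "k \<in> inner_strips lam mu" and T: "T \<in> ssyt k mu n" by auto
    let ?E = "extend_ssyt lam mu n k T"
    have E: "?E \<in> ssyt lam mu (Suc n)" by (rule extend_in_ssyt[OF sk k T])
    then show "(case kT of (k, T) \<Rightarrow> extend_ssyt lam mu n k T) \<in> ssyt lam mu (Suc n)" using kT by simp
    have "inner_shape lam mu n ?E = k"
    proof
      fix i
      have "j < inner_shape lam mu n ?E i \<longleftrightarrow> j < k i" for j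
        unfolding inner_shape_less_iff[OF sk E] using inner_stripsD(2,3)[OF k, of i] ssytD(2)[OF T, of i j]
        by (auto simp: extend_ssyt_def cells_def split: if_splits)
      then show "inner_shape lam mu n ?E i = k i" by (metis linorder_neqE_nat order_less_irrefl)
    qed
    moreover have "restrict ?E (cells k mu) = T"
      using ssytD(1)[OF T] by (auto simp: extend_ssyt_def extensional_def restrict_def)
    ultimately show "(\<lambda>T. (inner_shape lam mu n T, restrict T (cells (inner_shape lam mu n T) mu)))
       (case kT of (k, T) \<Rightarrow> extend_ssyt lam mu n k T) = kT"
      using kT by simp
  qed
  also have "\<dots> = (\<Sum>k\<in>inner_strips lam mu. \<Sum>T\<in>ssyt k mu n. \<Prod>c\<in>cells lam mu. x (extend_ssyt lam mu n k T c))"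
    by (rule sum.Sigma[symmetric]) (use p(1) in \<open>auto intro!: finite_inner_strips finite_ssyt dest: inner_stripsD\<close>)
  also have "\<dots> = (\<Sum>k\<in>inner_strips lam mu. x n ^ card (cells lam k) * skew_schur k mu n x)"
  proof (intro sum.cong refl)
    fix k assume k: "k \<in> inner_strips lam mu"
    have "(i, j) \<in> cells lam mu \<longleftrightarrow> (i, j) \<in> cells lam k \<union> cells k mu" for i j
      using inner_stripsD(2,3)[OF k, of i] by (auto simp: cells_def)
    then have un: "cells lam mu = cells lam k \<union> cells k mu" by auto
    have disj: "cells lam k \<inter> cells k mu = {}" by (auto simp: cells_def)
    have "(\<Prod>c\<in>cells lam mu. x (extend_ssyt lam mu n k T c)) = x n ^ card (cells lam k) * (\<Prod>c\<in>cells k mu. x (T c))" for T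
    proof -
      have "(\<Prod>c\<in>cells lam mu. x (extend_ssyt lam mu n k T c)) =
        (\<Prod>c\<in>cells lam k. x (extend_ssyt lam mu n k T c)) * (\<Prod>c\<in>cells k mu. x (extend_ssyt lam mu n k T c))"
        unfolding un using disj p(1) inner_stripsD(1)[OF k] by (intro prod.union_disjoint finite_cells)
      also have "(\<Prod>c\<in>cells lam k. x (extend_ssyt lam mu n k T c)) = (\<Prod>c\<in>cells lam k. x n)"
        by (intro prod.cong refl) (use disj un in \<open>auto simp: extend_ssyt_def\<close>)
      also have "(\<Prod>c\<in>cells k mu. x (extend_ssyt lam mu n k T c)) = (\<Prod>c\<in>cells k mu. x (T c))"
        by (intro prod.cong refl) (auto simp: extend_ssyt_def)
      finally show ?thesis by simp
    qed
    then show "(\<Sum>T\<in>ssyt k mu n. \<Prod>c\<in>cells lam mu. x (extend_ssyt lam mu n k T c)) =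
        x n ^ card (cells lam k) * skew_schur k mu n x"
      by (simp add: skew_schur_def sum_distrib_left)
  qed
  finally show ?thesis .
qed

lemma skew_schur_0:
  assumes sk: "skew_partition lam mu"
  shows "skew_schur lam mu 0 x = (if lam = mu then 1 else 0)"
proof (cases "lam = mu")
  case True
  then have "cells lam mu = {}" by (auto simp: cells_def)
  then show ?thesis using True by (simp add: skew_schur_def ssyt_def)
next
  case False
  then obtain i where "lam i \<noteq> mu i" by auto
  then have "(i, mu i) \<in> cells lam mu" using skew_partitionD(3)[OF sk, of i] by (auto simp: cells_def)
  then have "ssyt lam mu 0 = {}" by (auto simp: ssyt_def)
  then show ?thesis using False by (simp add: skew_schur_def)
qed

section \<open>Bead sets of partitions\<close>

lemma lexdec_1D: "lexdec (Suc 0) r b \<Longrightarrow> i < j \<Longrightarrow> j < r \<Longrightarrow> b j < b i"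
  using lexdecD[of 1 r b i j] by simp

lemma lexdec_beads: "is_partition k \<Longrightarrow> lexdec (Suc 0) r (\<lambda>i. k i + (r - 1 - i))"
  unfolding lexdec_def
proof (intro allI impI disjI2)
  fix i j assume k: "is_partition k" and ij: "i < j \<and> j < r"
  have "k j \<le> k i" using is_partition_le[OF k, of i j] ij by simp
  moreover have "r - 1 - j < r - 1 - i" using ij by arith
  ultimately show "(k i + (r - 1 - i)) mod Suc 0 = (k j + (r - 1 - j)) mod Suc 0 \<and> k j + (r - 1 - j) < k i + (r - 1 - i)"
    by simp
qed

lemma card_beads [simp]: "is_partition k \<Longrightarrow> card (beads r k) = r"
  unfolding beads_def using card_image[OF lexdec_inj_on[OF lexdec_beads[of k r]]] by simp

lemma finite_beads [simp]: "finite (beads r k)"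
  by (simp add: beads_def)

lemma bead_enum_beads: "is_partition k \<Longrightarrow> i < r \<Longrightarrow> bead_enum (Suc 0) (beads r k) i = k i + (r - 1 - i)"
  by (rule bead_enum_eqI(2)[OF lexdec_beads]) (auto simp: beads_def)

lemma beads_inject:
  assumes "is_partition k" "is_partition l" "plength k \<le> r" "plength l \<le> r" "beads r k = beads r l"
  shows "k = l"
proof
  fix i
  show "k i = l i"
  proof (cases "i < r")
    case True
    then show ?thesis using bead_enum_beads[OF assms(1) True] bead_enum_beads[OF assms(2) True] assms(5) by simp
  next
    case False
    then show ?thesis
      using is_partition_zero_ge[OF assms(1,3), of i] is_partition_zero_ge[OF assms(2,4), of i] by simp
  qed
qed

lemma lexdec_1_ge: "lexdec (Suc 0) r c \<Longrightarrow> i < r \<Longrightarrow> r - 1 - i \<le> c i"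
proof (induction "r - 1 - i" arbitrary: i)
  case (Suc m)
  have "r - 1 - Suc i \<le> c (Suc i)" by (rule Suc.hyps(1)) (use Suc.hyps(2) Suc.prems in auto)
  moreover have "c (Suc i) < c i" using lexdec_1D[OF Suc.prems(1), of i "Suc i"] Suc.hyps(2) by simp
  ultimately show ?case by simp
qed simp

text \<open>Inverse of \<open>beads\<close> on sets of r elements. The truncated subtraction is
  exact, because a strictly decreasing sequence of r naturals dominates the staircase
  (\<open>lexdec_1_ge\<close>).\<close>

definition of_beads :: "nat \<Rightarrow> nat set \<Rightarrow> nat \<Rightarrow> nat" where
  "of_beads r C i = (if i < r then bead_enum (Suc 0) C i - (r - 1 - i) else 0)"

lemma
  assumes "finite C" "card C = r"
  shows is_partition_of_beads: "is_partition (of_beads r C)"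
    and plength_of_beads: "plength (of_beads r C) \<le> r"
    and beads_of_beads: "beads r (of_beads r C) = C"
    and of_beads_add: "i < r \<Longrightarrow> of_beads r C i + (r - 1 - i) = bead_enum (Suc 0) C i"
proof -
  let ?c = "bead_enum (Suc 0) C"
  have lex: "lexdec (Suc 0) r ?c" using bead_enum_lexdec[OF assms(1), of 1] assms(2) by simp
  have add: "of_beads r C i + (r - 1 - i) = ?c i" if "i < r" for i
    using lexdec_1_ge[OF lex that] that by (simp add: of_beads_def)
  show "i < r \<Longrightarrow> of_beads r C i + (r - 1 - i) = ?c i" by (rule add)
  show 1: "is_partition (of_beads r C)"
  proof (rule is_partitionI[of _ r])
    fix i
    show "of_beads r C (Suc i) \<le> of_beads r C i"
      using add[of i] add[of "Suc i"] lexdec_1D[OF lex, of i "Suc i"]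
      by (cases "Suc i < r") (auto simp: of_beads_def)
  qed (simp add: of_beads_def)
  then show "plength (of_beads r C) \<le> r" by (simp add: plength_le_iff of_beads_def)
  have "beads r (of_beads r C) = ?c ` {..<r}"
    unfolding beads_def by (intro image_cong refl add) simp
  then show "beads r (of_beads r C) = C"
    using bead_enum_bij[OF assms(1), of 1] assms(2) by (simp add: bij_betw_def)
qed

definition complete_fps :: "nat \<Rightarrow> (nat \<Rightarrow> complex) \<Rightarrow> complex fps" where
  "complete_fps n x = (\<Prod>i<n. Abs_fps (\<lambda>k. x i ^ k))"

text \<open>In every nonvanishing Leibniz term the exponents add up to the difference of the two
  bead sums, whatever the permutation. The power of x therefore factors out and the case x = 1
  remains, whose minors are 0 or 1.\<close>

lemma toeplitz_minor_one_variable: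
  assumes "finite B" "finite A" "card A = card B"
  shows "toeplitz_minor N (Abs_fps (\<lambda>k. x ^ k)) B A = x ^ (\<Sum>B - \<Sum>A) * toeplitz_minor N (geom 1) B A"
proof -
  have sums: "(\<Sum>i<card B. bead_enum N B i) = \<Sum>B" "(\<Sum>i<card B. bead_enum N A i) = \<Sum>A"
    using sum.reindex_bij_betw[OF bead_enum_bij[OF assms(1), of N], of "\<lambda>x. x"]
      sum.reindex_bij_betw[OF bead_enum_bij[OF assms(2), of N], of "\<lambda>x. x"] assms(3) by auto
  have "(\<Prod>i<card B. toeplitz_entry (Abs_fps (\<lambda>k. x ^ k)) (bead_enum N B i) (bead_enum N A (p i)))
      = x ^ (\<Sum>B - \<Sum>A) * (\<Prod>i<card B. toeplitz_entry (geom 1) (bead_enum N B i) (bead_enum N A (p i)))"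
    if p: "p permutes {..<card B}" for p
  proof (cases "\<forall>i<card B. bead_enum N A (p i) \<le> bead_enum N B i")
    case True
    have "(\<Prod>i<card B. toeplitz_entry (Abs_fps (\<lambda>k. x ^ k)) (bead_enum N B i) (bead_enum N A (p i)))
       = x ^ (\<Sum>i<card B. bead_enum N B i - bead_enum N A (p i))"
      unfolding power_sum using True by (intro prod.cong) (auto simp: toeplitz_entry_def)
    also have "(\<Sum>i<card B. bead_enum N B i - bead_enum N A (p i)) = (\<Sum>i<card B. bead_enum N B i) - (\<Sum>i<card B. bead_enum N A (p i))"
      using True by (intro sum_subtractf_nat) auto
    also have "(\<Sum>i<card B. bead_enum N A (p i)) = (\<Sum>i<card B. bead_enum N A i)"
      using sum.permute[OF p, of "bead_enum N A"] by simp
    also have "x ^ ((\<Sum>i<card B. bead_enum N B i) - (\<Sum>i<card B. bead_enum N A i)) =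
       x ^ (\<Sum>B - \<Sum>A) * (\<Prod>i<card B. toeplitz_entry (geom 1) (bead_enum N B i) (bead_enum N A (p i)))"
      using True sums by (simp add: toeplitz_entry_geom)
    finally show ?thesis .
  next
    case False
    then obtain i where "i < card B" "\<not> bead_enum N A (p i) \<le> bead_enum N B i" by auto
    then have "\<exists>i\<in>{..<card B}. toeplitz_entry F (bead_enum N B i) (bead_enum N A (p i)) = 0" for F
      by (auto simp: toeplitz_entry_def)
    then have "(\<Prod>i<card B. toeplitz_entry F (bead_enum N B i) (bead_enum N A (p i))) = 0" for F
      by (intro prod_zero) auto
    then show ?thesis by (simp only: mult_zero_right)
  qed
  then show ?thesis
    unfolding toeplitz_minor_def leibniz_det_def sum_distrib_left by (intro sum.cong refl) (auto simp: mult_ac)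
qed

lemma toeplitz_minor_zero_of_not_le:
  assumes "finite B" "finite A" "card A = card B" "i < card B" "bead_enum (Suc 0) B i < bead_enum (Suc 0) A i"
  shows "toeplitz_minor (Suc 0) F B A = 0"
  unfolding toeplitz_minor_def
  by (rule leibniz_det_zero_of_not_dominated[where N = "Suc 0"])
    (use bead_enum_lexdec[OF assms(1), of "Suc 0"] bead_enum_lexdec[OF assms(2), of "Suc 0"] assms in \<open>auto simp: toeplitz_entry_def not_le\<close>)

lemma sum_beads:
  assumes "is_partition k" "plength k \<le> r"
  shows "\<Sum>(beads r k) = psize k + (\<Sum>i<r. r - 1 - i)"
proof -
  have "\<Sum>(beads r k) = (\<Sum>i<r. k i + (r - 1 - i))"
    unfolding beads_def using sum.reindex[OF lexdec_inj_on[OF lexdec_beads[OF assms(1), of r]], of "\<lambda>x. x"]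
    unfolding o_def .
  then show ?thesis unfolding sum.distrib psize_eq[OF assms] .
qed

lemma skew_size_diff:
  assumes "skew_partition lam mu"
  shows "skew_size lam mu = psize lam - psize mu" "psize mu \<le> psize lam"
proof -
  note p = skew_partitionD[OF assms]
  show "skew_size lam mu = psize lam - psize mu"
    unfolding skew_size_def psize_eq[OF p(2,4)] psize_eq[OF p(1) order_refl]
    using p(3) by (intro sum_subtractf_nat) auto
  show "psize mu \<le> psize lam"
    unfolding psize_eq[OF p(2,4)] psize_eq[OF p(1) order_refl] using p(3) by (intro sum_mono) auto
qed

text \<open>The staircase shift turns the weak inequality between lam (i+1) and k i into a strict
  one between beads. Indices from r on are harmless since both partitions vanish there.\<close>

lemma interlaced_1_beads_iff:
  assumes "is_partition lam" "plength lam \<le> r" "is_partition k" "plength k \<le> r"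
  shows "interlaced (Suc 0) (beads r lam) (beads r k) \<longleftrightarrow> (\<forall>i. k i \<le> lam i \<and> lam (Suc i) \<le> k i)"
proof -
  have z: "lam i = 0" "k i = 0" if "\<not> i < r" for i using assms that by (auto simp: plength_le_iff)
  have "interlaced (Suc 0) (beads r lam) (beads r k) \<longleftrightarrow>
     (\<forall>i<r. k i \<le> lam i) \<and> (\<forall>i. Suc i < r \<longrightarrow> lam (Suc i) + (r - 1 - Suc i) < k i + (r - 1 - i))"
    using assms by (auto simp: interlaced_def interlacing_def dominated_def bead_enum_beads)
  also have "(\<forall>i. Suc i < r \<longrightarrow> lam (Suc i) + (r - 1 - Suc i) < k i + (r - 1 - i)) \<longleftrightarrow> (\<forall>i. Suc i < r \<longrightarrow> lam (Suc i) \<le> k i)"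
    by (intro all_cong1 imp_cong refl) auto
  also have "(\<forall>i<r. k i \<le> lam i) \<and> (\<forall>i. Suc i < r \<longrightarrow> lam (Suc i) \<le> k i) \<longleftrightarrow> (\<forall>i. k i \<le> lam i \<and> lam (Suc i) \<le> k i)"
    using z by (metis le0 le_refl)
  finally show ?thesis .
qed

text \<open>Induction on the number of variables: Cauchy-Binet splits off the factor of the last
  variable, and the intermediate bead sets that survive are those of \<open>inner_strips\<close>, so
  both sides obey the branching rule.\<close>

theorem Jacobi_Trudi:
  assumes "skew_partition lam mu" "plength lam \<le> r"
  shows "skew_schur lam mu n x = toeplitz_minor (Suc 0) (complete_fps n x) (beads r lam) (beads r mu)"
  using assms
proof (induction n arbitrary: lam)
  case 0
  note p = skew_partitionD[OF 0(1)]
  have "beads r lam = beads r mu \<longleftrightarrow> lam = mu"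
    using beads_inject[OF p(1,2), of r] p(4) 0 by auto
  then show ?case using p by (simp add: skew_schur_0[OF 0(1)] complete_fps_def toeplitz_minor_one)
next
  case (Suc n lam)
  note p = skew_partitionD[OF Suc.prems(1)]
  have lr: "plength mu \<le> r" using p(4) Suc.prems(2) by simp
  define M where "M = Suc (Max (beads r lam \<union> beads r mu))"
  have M: "beads r lam \<subseteq> {..<M}" "beads r mu \<subseteq> {..<M}"
    by (auto simp: M_def less_Suc_eq_le)
  let ?g = "Abs_fps (\<lambda>k. x n ^ k)"
  let ?S = "{C. C \<subseteq> {..<M} \<and> card C = r}"
  let ?h = "\<lambda>C. toeplitz_minor (Suc 0) ?g (beads r lam) C * toeplitz_minor (Suc 0) (complete_fps n x) C (beads r mu)"
  have fS: "finite ?S" by (rule finite_subset[of _ "Pow {..<M}"]) auto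
  have fC: "finite C" if "C \<in> ?S" for C using that finite_subset[of C "{..<M}"] by auto
  have kp: "is_partition k" "plength k \<le> r" "skew_partition k mu" "skew_partition lam k" if "k \<in> inner_strips lam mu" for k
  proof -
    show "is_partition k" by (rule inner_stripsD(1)[OF that])
    show "plength k \<le> r" using inner_strips_plength_le[OF p(1) that] Suc.prems(2) by linarith
    show "skew_partition k mu" "skew_partition lam k"
      unfolding skew_partition_def using inner_stripsD(1)[OF that] inner_stripsD(2,3)[OF that] p(1,2) by blast+
  qed
  have "complete_fps (Suc n) x = ?g * complete_fps n x" by (simp add: complete_fps_def mult.commute)
  then have "toeplitz_minor (Suc 0) (complete_fps (Suc n) x) (beads r lam) (beads r mu) = sum ?h ?S"
    using toeplitz_minor_mult[OF M, of "Suc 0" ?g "complete_fps n x"] card_beads[OF p(1), of r] card_beads[OF p(2), of r] by simp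
  also have "\<dots> = sum ?h (beads r ` inner_strips lam mu)"
  proof (rule sum.mono_neutral_right[OF fS])
    show "beads r ` inner_strips lam mu \<subseteq> ?S"
    proof clarify
      fix k assume k: "k \<in> inner_strips lam mu"
      have "b < M" if b: "b \<in> beads r k" for b
      proof -
        obtain i where i: "i < r" "b = k i + (r - 1 - i)" using b by (auto simp: beads_def)
        then have "lam i + (r - 1 - i) \<in> beads r lam" by (auto simp: beads_def)
        then have "lam i + (r - 1 - i) < M" using M by auto
        then show ?thesis unfolding i(2) using inner_stripsD(3)[OF k, of i] by linarith
      qed
      then show "beads r k \<subseteq> {..<M} \<and> card (beads r k) = r" using kp(1)[OF k] by auto
    qed
    \<comment> \<open>A nonzero product constrains C twice: the one-variable minor forces C to
      interlace with the beads of lam, and the minor towards mu forces C to dominate the beads of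
      mu.\<close>
    show "\<forall>C\<in>?S - beads r ` inner_strips lam mu. ?h C = 0"
    proof (rule ballI, rule ccontr)
      fix C assume C: "C \<in> ?S - beads r ` inner_strips lam mu" and nz: "?h C \<noteq> 0"
      define k where "k = of_beads r C"
      have CS: "C \<in> ?S" using C by (rule DiffD1)
      have Cr: "finite C" "card C = r" using fC[OF CS] CS by simp_all
      have k: "is_partition k" "plength k \<le> r" "beads r k = C"
        unfolding k_def by (rule is_partition_of_beads[OF Cr] plength_of_beads[OF Cr] beads_of_beads[OF Cr])+
      have "interlaced (Suc 0) (beads r lam) (beads r k)"
      proof (rule ccontr)
        assume "\<not> ?thesis"
        then have "toeplitz_minor (Suc 0) (geom 1) (beads r lam) C = 0"
          using toeplitz_minor_geom[of "beads r lam" C 1] Cr card_beads[OF p(1), of r] k(3) by simp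
        then have "toeplitz_minor (Suc 0) ?g (beads r lam) C = 0"
          using toeplitz_minor_one_variable[of "beads r lam" C] Cr card_beads[OF p(1), of r] by simp
        then show False using nz by simp
      qed
      then have "k i \<le> lam i \<and> lam (Suc i) \<le> k i" for i
        unfolding interlaced_1_beads_iff[OF p(1) Suc.prems(2) k(1,2)] by (rule spec)
      moreover have "mu i \<le> k i" for i
      proof (cases "i < r")
        case True
        then have "\<not> bead_enum (Suc 0) (beads r k) i < bead_enum (Suc 0) (beads r mu) i"
          using toeplitz_minor_zero_of_not_le[of C "beads r mu" i] nz k(3) card_beads[OF p(2), of r] Cr
          by (metis finite_beads mult_zero_right)
        then show ?thesis using True k(1) p(2) by (simp add: bead_enum_beads)
      next
        case False
        then show ?thesis using lr p(2) by (simp add: plength_le_iff)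
      qed
      ultimately have "k \<in> inner_strips lam mu" using k(1) by (simp add: inner_strips_def)
      then have "C \<in> beads r ` inner_strips lam mu" using k(3) by blast
      then show False using C by blast
    qed
  qed
  also have "\<dots> = (\<Sum>k\<in>inner_strips lam mu. ?h (beads r k))"
    by (rule sum.reindex[unfolded o_def], rule inj_onI, rule beads_inject[of _ _ r]) (use kp(1,2) in blast)+
  also have "\<dots> = (\<Sum>k\<in>inner_strips lam mu. x n ^ card (cells lam k) * skew_schur k mu n x)"
  proof (intro sum.cong refl)
    fix k assume k: "k \<in> inner_strips lam mu"
    have "toeplitz_minor (Suc 0) ?g (beads r lam) (beads r k) = x n ^ (psize lam - psize k)"
    proof -
      have "interlaced (Suc 0) (beads r lam) (beads r k)"
        using interlaced_1_beads_iff[OF p(1) Suc.prems(2) kp(1,2)[OF k]] inner_stripsD[OF k] by simp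
      then show ?thesis
        using p(1) kp(1,2)[OF k] Suc.prems(2) by (simp add: toeplitz_minor_one_variable toeplitz_minor_geom sum_beads)
    qed
    moreover have "card (cells lam k) = psize lam - psize k"
      using card_cells[of "plength lam" lam k] skew_size_diff[OF kp(4)[OF k]] plength_le_iff[OF p(1), of "plength lam"]
      by (simp add: skew_size_def)
    ultimately show "?h (beads r k) = x n ^ card (cells lam k) * skew_schur k mu n x"
      using Suc.IH[OF kp(3)[OF k] kp(2)[OF k]] by simp
  qed
  finally show ?case using skew_schur_Suc[OF Suc.prems(1)] by simp
qed


section \<open>Skew characters\<close>

lemma deriv_geometric_fps:
  fixes x :: complex
  shows "fps_deriv (Abs_fps (\<lambda>k. x ^ k)) = Abs_fps (\<lambda>k. x ^ k) * Abs_fps (\<lambda>k. x ^ Suc k)"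
proof (rule fps_ext)
  fix n
  have "(\<Sum>i = 0..n. x ^ i * x ^ Suc (n - i)) = (\<Sum>i = 0..n. x ^ Suc n)"
    by (intro sum.cong refl) (simp flip: power_add power_Suc add: le_imp_diff_is_add Suc_diff_le)
  then show "fps_nth (fps_deriv (Abs_fps (\<lambda>k. x ^ k))) n = fps_nth (Abs_fps (\<lambda>k. x ^ k) * Abs_fps (\<lambda>k. x ^ Suc k)) n"
    by (simp add: fps_mult_nth)
qed

text \<open>Logarithmic differentiation: each factor 1 / (1 - x X) contributes x / (1 - x X), and
  these add up to the generating series of the power sums.\<close>

lemma deriv_complete_fps: "fps_deriv (complete_fps n x) = complete_fps n x * Abs_fps (\<lambda>k. \<Sum>i<n. x i ^ Suc k)"
proof (induction n)
  case 0
  then show ?case by (simp add: complete_fps_def fps_zero_def[symmetric])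
next
  case (Suc n)
  let ?g = "Abs_fps (\<lambda>k. x n ^ k)" and ?d = "Abs_fps (\<lambda>k. x n ^ Suc k)" and ?S = "Abs_fps (\<lambda>k. \<Sum>i<n. x i ^ Suc k)"
  have "complete_fps (Suc n) x = complete_fps n x * ?g" by (simp add: complete_fps_def)
  then have "fps_deriv (complete_fps (Suc n) x) = complete_fps n x * (?g * ?d) + complete_fps n x * ?S * ?g"
    by (simp only: fps_deriv_mult Suc deriv_geometric_fps)
  also have "\<dots> = complete_fps (Suc n) x * (?S + ?d)" by (simp add: complete_fps_def algebra_simps)
  also have "?S + ?d = Abs_fps (\<lambda>k. \<Sum>i<Suc n. x i ^ Suc k)" by (rule fps_ext) simp
  finally show ?case .
qed

lemma complete_fps_nth_0 [simp]: "fps_nth (complete_fps n x) 0 = 1"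
  by (induction n) (simp_all add: complete_fps_def)

lemma Newton_identity:
  "of_nat (Suc d) * fps_nth (complete_fps n x) (Suc d) = (\<Sum>i\<le>d. (\<Sum>j<n. x j ^ Suc i) * fps_nth (complete_fps n x) (d - i))"
proof -
  have "of_nat (Suc d) * fps_nth (complete_fps n x) (Suc d) = fps_nth (fps_deriv (complete_fps n x)) d" by simp
  also have "\<dots> = fps_nth (Abs_fps (\<lambda>k. \<Sum>i<n. x i ^ Suc k) * complete_fps n x) d" by (simp only: deriv_complete_fps mult.commute)
  also have "\<dots> = (\<Sum>i\<le>d. (\<Sum>j<n. x j ^ Suc i) * fps_nth (complete_fps n x) (d - i))"
    by (simp add: fps_mult_nth atMost_atLeast0)
  finally show ?thesis .
qed

section \<open>Power sum expansion of the complete homogeneous polynomials\<close>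

definition msets_of :: "nat \<Rightarrow> nat multiset set" where
  "msets_of d = {M. 0 \<notin># M \<and> sum_mset M = d}"

text \<open>Partitions appear here as multisets of parts: adding or deleting a part, as Newton's
  recursion does, then needs no re-sorting.\<close>

definition mset_power_sum :: "nat multiset \<Rightarrow> symfun" where
  "mset_power_sum M n x = (\<Prod>k\<in>#M. \<Sum>i<n. x i ^ k)"

definition mset_zee :: "nat multiset \<Rightarrow> nat" where
  "mset_zee M = (\<Prod>j\<in>set_mset M. fact (count M j) * j ^ count M j)"

lemma mset_zee_superset:
  assumes "finite S" "set_mset M \<subseteq> S"
  shows "mset_zee M = (\<Prod>j\<in>S. fact (count M j) * j ^ count M j)"
  unfolding mset_zee_def
  by (rule prod.mono_neutral_left) (use assms in \<open>auto simp: not_in_iff\<close>)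

lemma mset_zee_add_mset: "mset_zee (add_mset k M) = Suc (count M k) * k * mset_zee M"
proof -
  let ?S = "insert k (set_mset M)"
  have "mset_zee (add_mset k M) = (fact (Suc (count M k)) * k ^ Suc (count M k)) *
     (\<Prod>j\<in>?S - {k}. fact (count M j) * j ^ count M j)"
    by (subst mset_zee_superset[of ?S]) (auto simp: prod.remove[of ?S k])
  moreover have "mset_zee M = (fact (count M k) * k ^ count M k) *
     (\<Prod>j\<in>?S - {k}. fact (count M j) * j ^ count M j)"
    by (subst mset_zee_superset[of ?S]) (auto simp: prod.remove[of ?S k])
  ultimately show ?thesis by (simp add: algebra_simps)
qed

lemma mset_zee_pos:
  assumes "0 \<notin># M" shows "mset_zee M > 0"
  unfolding mset_zee_def
proof (rule prod_pos)
  fix j assume "j \<in># M"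
  then have "j \<noteq> 0" using assms by metis
  then show "0 < fact (count M j) * j ^ count M j" by simp
qed

lemma size_le_of_msets: "0 \<notin># M \<Longrightarrow> size M \<le> sum_mset M"
  by (induction M) auto

lemma finite_msets_of: "finite (msets_of d)"
proof (rule finite_subset)
  show "finite (mset ` {xs. set xs \<subseteq> {..d} \<and> length xs \<le> d})"
    by (intro finite_imageI finite_lists_length_le) simp
  show "msets_of d \<subseteq> mset ` {xs. set xs \<subseteq> {..d} \<and> length xs \<le> d}"
  proof
    fix M assume "M \<in> msets_of d"
    then have M: "0 \<notin># M" "sum_mset M = d" by (auto simp: msets_of_def)
    obtain xs where xs: "mset xs = M" using ex_mset by blast
    have "x \<le> d" if "x \<in> set xs" for x
      using that xs M(2) sum_mset.remove[of x M] by auto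
    moreover have "length xs \<le> d" using size_le_of_msets[OF M(1)] M(2) xs by auto
    ultimately show "M \<in> mset ` {xs. set xs \<subseteq> {..d} \<and> length xs \<le> d}" using xs by auto
  qed
qed

lemma sum_mset_eq_sum_count: "sum_mset M = (\<Sum>k\<in>set_mset M. k * count M k)" for M :: "nat multiset"
proof -
  have "sum_mset M = (\<Sum>k\<in>S. k * count M k)" if "finite S" "set_mset M \<subseteq> S" for S
    using that(2)
  proof (induction M)
    case (add x M)
    have "(\<Sum>k\<in>S. k * count (add_mset x M) k) = (\<Sum>k\<in>S. k * count M k + (if x = k then k else 0))"
      by (intro sum.cong) auto
    also have "\<dots> = (\<Sum>k\<in>S. k * count M k) + x"
      unfolding sum.distrib using add.prems \<open>finite S\<close> by simp
    finally show ?case using add by simp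
  qed simp
  then show ?thesis by simp
qed

lemma msets_of_pos: "M \<in> msets_of d \<Longrightarrow> k \<in># M \<Longrightarrow> k > 0"
  by (auto simp: msets_of_def intro: gr0I)

text \<open>Induction through Newton's identity. Writing d as the sum of k * count M k over the
  distinct parts k of M splits d times the term of M into products of a power sum of degree k with
  the term of M without one k, because deleting k divides \<open>mset_zee M\<close> by k * count M
  k.\<close>

lemma complete_fps_eq_sum_mset_power_sum:
  "fps_nth (complete_fps n x) d = (\<Sum>M\<in>msets_of d. mset_power_sum M n x / of_nat (mset_zee M))"
proof (induction d rule: less_induct)
  case (less d)
  let ?t = "\<lambda>M. mset_power_sum M n x / of_nat (mset_zee M)"
  show ?case
  proof (cases d)
    case 0
    have "msets_of 0 = {{#}}"
    proof (intro equalityI subsetI)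
      fix M assume "M \<in> msets_of 0"
      then have "0 \<notin># M" "sum_mset M = 0" by (simp_all add: msets_of_def)
      then have "size M \<le> 0" using size_le_of_msets[of M] by linarith
      then show "M \<in> {{#}}" by (simp only: le_zero_eq size_eq_0_iff_empty singleton_iff)
    qed (simp add: msets_of_def)
    then show ?thesis using 0 by (simp add: mset_power_sum_def mset_zee_def)
  next
    case (Suc e)
    have step: "of_nat (k * count M k) * ?t M = (\<Sum>j<n. x j ^ k) * ?t (M - {#k#})"
      if M: "M \<in> msets_of d" "k \<in># M" for M k
    proof -
      obtain M' where M': "M = add_mset k M'" using M(2) by (metis insert_DiffM)
      define a where "a = k * count M k"
      have a: "a \<noteq> 0" using msets_of_pos[OF M] M(2) by (simp add: a_def)
      have "mset_zee M = a * mset_zee M'" by (simp add: M' mset_zee_add_mset a_def)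
      moreover have "mset_power_sum M n x = (\<Sum>j<n. x j ^ k) * mset_power_sum M' n x"
        by (simp add: M' mset_power_sum_def)
      ultimately show ?thesis unfolding a_def[symmetric] using a by (simp add: M')
    qed
    have "of_nat d * (\<Sum>M\<in>msets_of d. ?t M) = (\<Sum>M\<in>msets_of d. of_nat (\<Sum>k\<in>set_mset M. k * count M k) * ?t M)"
      unfolding sum_distrib_left by (intro sum.cong refl) (simp add: msets_of_def flip: sum_mset_eq_sum_count)
    also have "\<dots> = (\<Sum>M\<in>msets_of d. \<Sum>k\<in>set_mset M. (\<Sum>j<n. x j ^ k) * ?t (M - {#k#}))"
    proof (intro sum.cong refl)
      fix M assume M: "M \<in> msets_of d"
      have "of_nat (\<Sum>k\<in>set_mset M. k * count M k) * ?t M = (\<Sum>k\<in>set_mset M. of_nat (k * count M k) * ?t M)"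
        by (simp only: of_nat_sum sum_distrib_right)
      also have "\<dots> = (\<Sum>k\<in>set_mset M. (\<Sum>j<n. x j ^ k) * ?t (M - {#k#}))"
        by (intro sum.cong refl step[OF M])
      finally show "of_nat (\<Sum>k\<in>set_mset M. k * count M k) * ?t M = (\<Sum>k\<in>set_mset M. (\<Sum>j<n. x j ^ k) * ?t (M - {#k#}))" .
    qed
    also have "\<dots> = (\<Sum>(M, k)\<in>(SIGMA M:msets_of d. set_mset M). (\<Sum>j<n. x j ^ k) * ?t (M - {#k#}))"
      by (rule sum.Sigma) (auto simp: finite_msets_of)
    \<comment> \<open>A multiset with a marked part is the same as a part Suc i together with the
      multiset that remains.\<close>
    also have "\<dots> = (\<Sum>(i, M)\<in>(SIGMA i:{..e}. msets_of (e - i)). (\<Sum>j<n. x j ^ Suc i) * ?t M)"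
    proof (rule sum.reindex_bij_witness[of _ "\<lambda>(i, M). (add_mset (Suc i) M, Suc i)" "\<lambda>(M, k). (k - 1, M - {#k#})"])
      fix a assume a: "a \<in> (SIGMA M:msets_of d. set_mset M)"
      obtain M k where Mk: "a = (M, k)" by (cases a)
      with a have M: "M \<in> msets_of d" "k \<in># M" by auto
      obtain M' where M': "M = add_mset k M'" using M(2) by (metis insert_DiffM)
      obtain i where i: "k = Suc i" using msets_of_pos[OF M] gr0_conv_Suc by auto
      show "(case case a of (M, k) \<Rightarrow> (k - 1, M - {#k#}) of (i, M) \<Rightarrow> (add_mset (Suc i) M, Suc i)) = a"
        by (simp add: Mk M' i)
      show "(case a of (M, k) \<Rightarrow> (k - 1, M - {#k#})) \<in> (SIGMA i:{..e}. msets_of (e - i))"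
        using M Suc by (auto simp: Mk M' i msets_of_def)
      show "(case case a of (M, k) \<Rightarrow> (k - 1, M - {#k#}) of (i, M) \<Rightarrow> (\<Sum>j<n. x j ^ Suc i) * ?t M)
         = (case a of (M, k) \<Rightarrow> (\<Sum>j<n. x j ^ k) * ?t (M - {#k#}))"
        by (simp add: Mk M' i)
    next
      fix b assume b: "b \<in> (SIGMA i:{..e}. msets_of (e - i))"
      then show "(case case b of (i, M) \<Rightarrow> (add_mset (Suc i) M, Suc i) of (M, k) \<Rightarrow> (k - 1, M - {#k#})) = b"
        by auto
      show "(case b of (i, M) \<Rightarrow> (add_mset (Suc i) M, Suc i)) \<in> (SIGMA M:msets_of d. set_mset M)"
        using b Suc by (auto simp: msets_of_def)
    qed
    also have "\<dots> = (\<Sum>i\<le>e. (\<Sum>j<n. x j ^ Suc i) * (\<Sum>M\<in>msets_of (e - i). ?t M))"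
      unfolding sum_distrib_left by (rule sum.Sigma[symmetric]) (auto simp: finite_msets_of)
    also have "\<dots> = (\<Sum>i\<le>e. (\<Sum>j<n. x j ^ Suc i) * fps_nth (complete_fps n x) (e - i))"
      by (intro sum.cong refl arg_cong2[where f="(*)"] less[symmetric]) (use Suc in auto)
    also have "\<dots> = of_nat d * fps_nth (complete_fps n x) d"
      unfolding Suc by (rule Newton_identity[symmetric])
    finally have "of_nat d * fps_nth (complete_fps n x) d = of_nat d * (\<Sum>M\<in>msets_of d. ?t M)" ..
    moreover have "of_nat d \<noteq> (0 :: complex)" using Suc by (simp del: of_nat_Suc)
    ultimately show ?thesis by (simp only: mult_cancel_left simp_thms)
  qed
qed

text \<open>The coefficients are integral with respect to power sums divided by z, not with respect
  to power sums: this is the integrality that \<open>skew_character\<close>, with its values in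
  \<open>int\<close>, demands.\<close>

definition int_power_sum_span :: "nat \<Rightarrow> symfun \<Rightarrow> bool" where
  "int_power_sum_span d f \<longleftrightarrow> (\<exists>c :: nat multiset \<Rightarrow> int. \<forall>n x.
     f n x = (\<Sum>M\<in>msets_of d. of_int (c M) * (mset_power_sum M n x / of_nat (mset_zee M))))"

lemma int_power_sum_span_cmult:
  assumes "int_power_sum_span d f" shows "int_power_sum_span d (\<lambda>n x. of_int a * f n x)"
proof -
  obtain c :: "nat multiset \<Rightarrow> int" where c: "\<And>n x. f n x = (\<Sum>M\<in>msets_of d. of_int (c M) * (mset_power_sum M n x / of_nat (mset_zee M)))"
    using assms by (auto simp: int_power_sum_span_def)
  show ?thesis unfolding int_power_sum_span_def
    by (rule exI[of _ "\<lambda>M. a * c M"]) (simp add: c sum_distrib_left mult.assoc)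
qed

lemma int_power_sum_span_zero: "int_power_sum_span d (\<lambda>n x. 0)"
  unfolding int_power_sum_span_def by (rule exI[of _ "\<lambda>M. 0"]) simp

lemma int_power_sum_span_add:
  assumes "int_power_sum_span d f" "int_power_sum_span d g"
  shows "int_power_sum_span d (\<lambda>n x. f n x + g n x)"
proof -
  obtain c :: "nat multiset \<Rightarrow> int"
    where c: "\<And>n x. f n x = (\<Sum>M\<in>msets_of d. of_int (c M) * (mset_power_sum M n x / of_nat (mset_zee M)))"
    using assms(1) by (auto simp: int_power_sum_span_def)
  obtain c' :: "nat multiset \<Rightarrow> int"
    where c': "\<And>n x. g n x = (\<Sum>M\<in>msets_of d. of_int (c' M) * (mset_power_sum M n x / of_nat (mset_zee M)))"
    using assms(2) by (auto simp: int_power_sum_span_def)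
  show ?thesis unfolding int_power_sum_span_def
    by (rule exI[of _ "\<lambda>M. c M + c' M"]) (simp only: c c' of_int_add distrib_right sum.distrib simp_thms)
qed

lemma int_power_sum_span_sum:
  assumes "\<And>i. i \<in> I \<Longrightarrow> int_power_sum_span d (f i)"
  shows "int_power_sum_span d (\<lambda>n x. \<Sum>i\<in>I. f i n x)"
  using assms
proof (induction I rule: infinite_finite_induct)
  case (insert i I)
  then show ?case using int_power_sum_span_add[of d "f i" "\<lambda>n x. \<Sum>i\<in>I. f i n x"] by simp
qed (simp_all add: int_power_sum_span_zero)

lemma int_power_sum_span_basis:
  assumes "M \<in> msets_of d"
  shows "int_power_sum_span d (\<lambda>n x. mset_power_sum M n x / of_nat (mset_zee M))"
  unfolding int_power_sum_span_def
proof (intro exI[of _ "\<lambda>M'. if M' = M then 1 else 0"] allI)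
  fix n x
  have "(\<Sum>M'\<in>msets_of d. of_int (if M' = M then 1 else 0) * (mset_power_sum M' n x / of_nat (mset_zee M')))
    = (\<Sum>M'\<in>msets_of d. if M = M' then mset_power_sum M' n x / of_nat (mset_zee M') else 0)"
    by (intro sum.cong) auto
  then show "mset_power_sum M n x / of_nat (mset_zee M) =
     (\<Sum>M'\<in>msets_of d. of_int (if M' = M then 1 else 0) * (mset_power_sum M' n x / of_nat (mset_zee M')))"
    using assms finite_msets_of by simp
qed

text \<open>The powers of j multiply exactly, and the factorials leave a product of binomial
  coefficients. That this ratio is an integer makes the integral span closed under products.\<close>

lemma mset_zee_plus: "\<exists>b. mset_zee (M + M') = b * (mset_zee M * mset_zee M')"
proof -
  let ?S = "set_mset M \<union> set_mset M'"
  let ?b = "\<Prod>j\<in>?S. (count M j + count M' j) choose count M j"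
  have "mset_zee (M + M') = (\<Prod>j\<in>?S. fact (count M j + count M' j) * j ^ (count M j + count M' j))"
    by (subst mset_zee_superset[of ?S]) auto
  also have "\<dots> = (\<Prod>j\<in>?S. ((count M j + count M' j) choose count M j) *
       ((fact (count M j) * j ^ count M j) * (fact (count M' j) * j ^ count M' j)))"
  proof (intro prod.cong refl)
    fix j
    have "fact (count M j) * fact (count M' j) * ((count M j + count M' j) choose count M j) = fact (count M j + count M' j)"
      using binomial_fact_lemma[of "count M j" "count M j + count M' j"] by simp
    then show "fact (count M j + count M' j) * j ^ (count M j + count M' j) =
      ((count M j + count M' j) choose count M j) * ((fact (count M j) * j ^ count M j) * (fact (count M' j) * j ^ count M' j))"
      unfolding power_add by (simp only: mult_ac flip: \<open>_ = fact (count M j + count M' j)\<close>)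
  qed
  also have "\<dots> = ?b * (mset_zee M * mset_zee M')"
    by (simp only: prod.distrib mset_zee_superset[of ?S M] mset_zee_superset[of ?S M']
        finite_UnI finite_set_mset Un_upper1 Un_upper2)
  finally show ?thesis by blast
qed

lemma int_power_sum_span_mult:
  assumes "int_power_sum_span d f" "int_power_sum_span e g"
  shows "int_power_sum_span (d + e) (\<lambda>n x. f n x * g n x)"
proof -
  let ?t = "\<lambda>M n x. mset_power_sum M n x / of_nat (mset_zee M)"
  obtain c :: "nat multiset \<Rightarrow> int"
    where c: "\<And>n x. f n x = (\<Sum>M\<in>msets_of d. of_int (c M) * ?t M n x)"
    using assms(1) by (auto simp: int_power_sum_span_def)
  obtain c' :: "nat multiset \<Rightarrow> int"
    where c': "\<And>n x. g n x = (\<Sum>M\<in>msets_of e. of_int (c' M) * ?t M n x)"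
    using assms(2) by (auto simp: int_power_sum_span_def)
  have "int_power_sum_span (d + e) (\<lambda>n x. of_int (c M * c' M') * (?t M n x * ?t M' n x))"
    if M: "M \<in> msets_of d" "M' \<in> msets_of e" for M M'
  proof (rule int_power_sum_span_cmult)
    obtain b where b: "mset_zee (M + M') = b * (mset_zee M * mset_zee M')" using mset_zee_plus by blast
    have MM: "M + M' \<in> msets_of (d + e)" using M by (auto simp: msets_of_def)
    have z: "mset_zee (M + M') > 0" using MM by (intro mset_zee_pos) (auto simp: msets_of_def)
    have b0: "b \<noteq> 0" by (rule notI) (use z b in simp)
    have eq: "?t M n x * ?t M' n x = of_int (int b) * ?t (M + M') n x" for n x
      unfolding b using b0 by (simp add: mset_power_sum_def)
    show "int_power_sum_span (d + e) (\<lambda>n x. ?t M n x * ?t M' n x)"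
      unfolding eq by (rule int_power_sum_span_cmult[OF int_power_sum_span_basis[OF MM]])
  qed
  note t = this
  have "int_power_sum_span (d + e) (\<lambda>n x. \<Sum>M\<in>msets_of d. \<Sum>M'\<in>msets_of e. of_int (c M * c' M') * (?t M n x * ?t M' n x))"
    by (rule int_power_sum_span_sum, rule int_power_sum_span_sum, rule t)
  moreover have "f n x * g n x = (\<Sum>M\<in>msets_of d. \<Sum>M'\<in>msets_of e. of_int (c M * c' M') * (?t M n x * ?t M' n x))" for n x
    unfolding c c' sum_product by (intro sum.cong refl) simp
  ultimately show ?thesis by simp
qed

lemma int_power_sum_span_one: "int_power_sum_span 0 (\<lambda>n x. 1)"
  using int_power_sum_span_basis[of "{#}" 0] by (simp add: msets_of_def mset_power_sum_def mset_zee_def)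

lemma int_power_sum_span_complete_fps: "int_power_sum_span d (\<lambda>n x. fps_nth (complete_fps n x) d)"
  unfolding complete_fps_eq_sum_mset_power_sum by (rule int_power_sum_span_sum, rule int_power_sum_span_basis)

lemma int_power_sum_span_prod_complete_fps:
  "int_power_sum_span (\<Sum>i<(r::nat). e i) (\<lambda>n x. \<Prod>i<r. fps_nth (complete_fps n x) (e i))"
proof (induction r)
  case (Suc r)
  then show ?case using int_power_sum_span_mult[OF Suc int_power_sum_span_complete_fps[of "e r"]] by simp
qed (simp add: int_power_sum_span_one)

text \<open>Every Leibniz term of Jacobi-Trudi is either zero or a signed product of complete
  homogeneous polynomials whose degrees add up to the size of the shape.\<close>

lemma int_power_sum_span_skew_schur:
  assumes sk: "skew_partition lam mu"
  shows "int_power_sum_span (skew_size lam mu) (skew_schur lam mu)"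
proof -
  note p = skew_partitionD[OF sk]
  define r where "r = plength lam"
  define b where "b = bead_enum (Suc 0) (beads r lam)"
  define a where "a = bead_enum (Suc 0) (beads r mu)"
  have sums: "(\<Sum>i<r. b i) = psize lam + (\<Sum>i<r. r - 1 - i)" "(\<Sum>i<r. a i) = psize mu + (\<Sum>i<r. r - 1 - i)"
    using sum.reindex_bij_betw[OF bead_enum_bij[of "beads r lam" "Suc 0"], of "\<lambda>x. x"]
      sum.reindex_bij_betw[OF bead_enum_bij[of "beads r mu" "Suc 0"], of "\<lambda>x. x"]
      card_beads[OF p(1), of r] card_beads[OF p(2), of r]
      sum_beads[OF p(1), of r] sum_beads[OF p(2), of r] p(4)
    unfolding a_def b_def r_def by auto
  have "int_power_sum_span (skew_size lam mu) (\<lambda>n x. of_int (sign q) * (\<Prod>i<r. toeplitz_entry (complete_fps n x) (b i) (a (q i))))"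
    if q: "q permutes {..<r}" for q
  proof (cases "\<forall>i<r. a (q i) \<le> b i")
    case True
    have "(\<Sum>i<r. b i - a (q i)) = (\<Sum>i<r. b i) - (\<Sum>i<r. a (q i))"
      using True by (intro sum_subtractf_nat) auto
    also have "(\<Sum>i<r. a (q i)) = (\<Sum>i<r. a i)" using sum.permute[OF q, of a] by (simp add: o_def)
    finally have "(\<Sum>i<r. b i - a (q i)) = skew_size lam mu" using sums skew_size_diff[OF sk] by simp
    moreover have "(\<Prod>i<r. toeplitz_entry (complete_fps n x) (b i) (a (q i))) = (\<Prod>i<r. fps_nth (complete_fps n x) (b i - a (q i)))" for n x
      using True by (intro prod.cong) (auto simp: toeplitz_entry_def)
    ultimately show ?thesis
      using int_power_sum_span_cmult[OF int_power_sum_span_prod_complete_fps[of "\<lambda>i. b i - a (q i)" r], of "sign q"] by simp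
  next
    case False
    then have "\<exists>i\<in>{..<r}. toeplitz_entry (complete_fps n x) (b i) (a (q i)) = 0" for n x by (auto simp: toeplitz_entry_def)
    then have "(\<Prod>i<r. toeplitz_entry (complete_fps n x) (b i) (a (q i))) = 0" for n x by (intro prod_zero) auto
    then show ?thesis by (simp only: mult_zero_right int_power_sum_span_zero)
  qed
  note t = this
  have "int_power_sum_span (skew_size lam mu) (\<lambda>n x. \<Sum>q | q permutes {..<r}. of_int (sign q) * (\<Prod>i<r. toeplitz_entry (complete_fps n x) (b i) (a (q i))))"
    by (rule int_power_sum_span_sum, rule t) simp
  moreover have "skew_schur lam mu = (\<lambda>n x. \<Sum>q | q permutes {..<r}. of_int (sign q) * (\<Prod>i<r. toeplitz_entry (complete_fps n x) (b i) (a (q i))))"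
    by (intro ext) (unfold Jacobi_Trudi[OF sk order_refl] toeplitz_minor_def leibniz_det_def card_beads[OF p(1)] a_def b_def r_def, rule refl)
  ultimately show ?thesis by (simp only:)
qed

definition mset_partition :: "nat multiset \<Rightarrow> nat \<Rightarrow> nat" where
  "mset_partition M i = (if i < size M then rev (sorted_list_of_multiset M) ! i else 0)"

lemma
  assumes M: "M \<in> msets_of d"
  shows mset_partition_in: "mset_partition M \<in> partitions_of d"
    and power_sum_mset_partition: "power_sum (mset_partition M) n x = mset_power_sum M n x"
    and zee_mset_partition: "zee (mset_partition M) = mset_zee M"
proof -
  define xs where "xs = rev (sorted_list_of_multiset M)"
  have xs: "mset xs = M" "length xs = size M" "sorted (rev xs)"
    by (simp_all add: xs_def flip: size_mset)
  have p: "mset_partition M i = (if i < length xs then xs ! i else 0)" for i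
    by (simp add: mset_partition_def xs_def flip: size_mset)
  have pos: "xs ! i > 0" if "i < length xs" for i
  proof (rule msets_of_pos[OF M])
    have "xs ! i \<in> set xs" using that by simp
    then show "xs ! i \<in># M" using xs(1) by (metis set_mset_mset)
  qed
  have "mset_partition M i \<noteq> 0 \<longleftrightarrow> i < length xs" for i using pos[of i] by (simp add: p)
  then have "{i. mset_partition M i \<noteq> 0} = {..<length xs}" by blast
  then have len: "plength (mset_partition M) = length xs" by (simp add: plength_def)
  have part: "is_partition (mset_partition M)"
  proof (rule is_partitionI[of _ "length xs"])
    fix i
    show "mset_partition M (Suc i) \<le> mset_partition M i"
    proof (cases "Suc i < length xs")
      case True
      then have "xs ! Suc i \<le> xs ! i" using xs(3) by (simp add: sorted_rev_iff_nth_Suc)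
      then show ?thesis using True by (simp add: p)
    qed (simp add: p)
  qed (simp add: p)
  have "psize (mset_partition M) = sum_list xs"
    by (simp add: psize_def len p sum_list_sum_nth lessThan_atLeast0)
  also have "\<dots> = d" using M xs(1) sum_mset_sum_list[of xs] by (simp add: msets_of_def)
  finally have size: "psize (mset_partition M) = d" .
  with part show "mset_partition M \<in> partitions_of d" by (simp add: partitions_of_def)
  have "power_sum (mset_partition M) n x = (\<Prod>k\<leftarrow>xs. \<Sum>i<n. x i ^ k)"
    by (simp add: power_sum_def len p prod.list_conv_set_nth lessThan_atLeast0)
  also have "\<dots> = mset_power_sum M n x"
    unfolding mset_power_sum_def xs(1)[symmetric] mset_map[symmetric] prod_mset_prod_list ..
  finally show "power_sum (mset_partition M) n x = mset_power_sum M n x" .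
  have mult: "part_mult (mset_partition M) j = count M j" if "j > 0" for j
  proof -
    have "{i. mset_partition M i = j} = {i. i < length xs \<and> xs ! i = j}" using that by (auto simp: p)
    moreover have "count M j = card {i. i < length xs \<and> xs ! i = j}"
      unfolding xs(1)[symmetric] count_mset count_list_eq_length_filter length_filter_conv_card
      by (simp add: eq_commute)
    ultimately show ?thesis by (simp add: part_mult_def)
  qed
  have "set_mset M \<subseteq> {1..d}"
  proof
    fix k assume k: "k \<in># M"
    have "k \<le> d" using M k sum_mset.remove[of k M] by (simp add: msets_of_def)
    then show "k \<in> {1..d}" using msets_of_pos[OF M k] by simp
  qed
  then show "zee (mset_partition M) = mset_zee M"
    unfolding zee_def size by (subst mset_zee_superset[of "{1..d}"]) (auto simp: mult intro!: prod.cong)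
qed

lemma partitions_of_bounds:
  assumes "p \<in> partitions_of d"
  shows "is_partition p" "p i \<le> d" "plength p \<le> d" "psize p = d"
proof -
  show p: "is_partition p" and s: "psize p = d" using assms by (auto simp: partitions_of_def)
  have nz: "p i \<noteq> 0" if "i < plength p" for i using is_partition_nonzero_iff[OF p] that by blast
  show "p i \<le> d"
  proof (cases "i < plength p")
    case True
    then have "p i \<le> (\<Sum>i<plength p. p i)" by (intro member_le_sum) auto
    then show ?thesis using s by (simp add: psize_def)
  next
    case False
    then show ?thesis using is_partition_nonzero_iff[OF p] by (metis le0)
  qed
  have "plength p = (\<Sum>i<plength p. 1)" by simp
  also have "\<dots> \<le> (\<Sum>i<plength p. p i)"
  proof (rule sum_mono)
    fix i assume "i \<in> {..<plength p}"
    then show "1 \<le> p i" using nz[of i] by simp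
  qed
  finally show "plength p \<le> d" using s by (simp add: psize_def)
qed

lemma finite_partitions_of: "finite (partitions_of d)"
proof (rule finite_subset)
  show "finite {k :: nat \<Rightarrow> nat. \<forall>i. k i \<le> (if i < d then d else 0)}"
    by (rule finite_bounded_functions[of d]) simp
  show "partitions_of d \<subseteq> {k. \<forall>i. k i \<le> (if i < d then d else 0)}"
  proof clarify
    fix p i assume p: "p \<in> partitions_of d"
    note b = partitions_of_bounds[OF p]
    show "p i \<le> (if i < d then d else 0)"
      using b(2)[of i] is_partition_zero_ge[OF b(1,3), of i] by auto
  qed
qed

lemma skew_character_exists:
  assumes sk: "skew_partition lam mu"
  shows "\<exists>chi :: (nat \<Rightarrow> nat) \<Rightarrow> int. (\<forall>nu. nu \<notin> partitions_of (skew_size lam mu) \<longrightarrow> chi nu = 0) \<and>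
     (\<forall>n x. skew_schur lam mu n x =
        (\<Sum>nu\<in>partitions_of (skew_size lam mu). of_int (chi nu) * power_sum nu n x / of_nat (zee nu)))"
proof -
  let ?d = "skew_size lam mu"
  obtain c :: "nat multiset \<Rightarrow> int" where c: "\<And>n x. skew_schur lam mu n x =
      (\<Sum>M\<in>msets_of ?d. of_int (c M) * (mset_power_sum M n x / of_nat (mset_zee M)))"
    using int_power_sum_span_skew_schur[OF sk] unfolding int_power_sum_span_def by blast
  \<comment> \<open>Summing over the fibre above nu lets \<open>sum.group\<close> regroup the
    expansion over multisets by partitions.\<close>
  define chi where "chi nu = (\<Sum>M\<in>{M \<in> msets_of ?d. mset_partition M = nu}. c M)" for nu
  have "chi nu = 0" if "nu \<notin> partitions_of ?d" for nu
  proof -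
    have "{M \<in> msets_of ?d. mset_partition M = nu} = {}" using that mset_partition_in by blast
    then show ?thesis unfolding chi_def by (simp only: sum.empty)
  qed
  moreover have "skew_schur lam mu n x =
        (\<Sum>nu\<in>partitions_of ?d. of_int (chi nu) * power_sum nu n x / of_nat (zee nu))" for n x
  proof -
    have "skew_schur lam mu n x = (\<Sum>nu\<in>partitions_of ?d. \<Sum>M\<in>{M \<in> msets_of ?d. mset_partition M = nu}.
        of_int (c M) * (mset_power_sum M n x / of_nat (mset_zee M)))"
      unfolding c by (rule sum.group[symmetric]) (use mset_partition_in in \<open>auto simp: finite_msets_of finite_partitions_of\<close>)
    also have "\<dots> = (\<Sum>nu\<in>partitions_of ?d. of_int (chi nu) * power_sum nu n x / of_nat (zee nu))"
    proof (intro sum.cong refl)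
      fix nu
      have "(\<Sum>M\<in>{M \<in> msets_of ?d. mset_partition M = nu}. of_int (c M) * (mset_power_sum M n x / of_nat (mset_zee M)))
        = of_int (chi nu) * (power_sum nu n x / of_nat (zee nu))"
        unfolding chi_def of_int_sum sum_distrib_right
        by (intro sum.cong refl) (auto simp: power_sum_mset_partition zee_mset_partition)
      then show "(\<Sum>M\<in>{M \<in> msets_of ?d. mset_partition M = nu}. of_int (c M) * (mset_power_sum M n x / of_nat (mset_zee M)))
        = of_int (chi nu) * power_sum nu n x / of_nat (zee nu)"
        by (simp only: times_divide_eq_right)
    qed
    finally show ?thesis .
  qed
  ultimately show ?thesis by blast
qed

lemma skew_schur_eq_sum_character:
  assumes "skew_partition lam mu"
  shows "skew_schur lam mu n x = (\<Sum>nu\<in>partitions_of (skew_size lam mu).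
     of_int (skew_character lam mu nu) * power_sum nu n x / of_nat (zee nu))"
  using someI_ex[OF skew_character_exists[OF assms]] unfolding skew_character_def by blast


section \<open>Evaluation at roots of unity\<close>

lemma sum_primitive_root_powers:
  assumes N: "N > 0" and w: "primitive_root_of_unity N w"
  shows "(\<Sum>i<j * N. (w ^ i) ^ k) = (if N dvd k then of_nat (j * N) else 0)"
proof (cases "N dvd k")
  case True
  then obtain l where "k = N * l" by blast
  then have "w ^ (i * k) = 1" for i
    using w by (simp add: primitive_root_of_unity_def power_mult mult.left_commute[of i])
  then show ?thesis using True by (simp flip: power_mult)
next
  case False
  have wN: "w ^ N = 1" using w by (simp add: primitive_root_of_unity_def)
  have "w ^ k = w ^ (k mod N) * (w ^ N) ^ (k div N)"
    by (simp flip: power_mult power_add)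
  then have "w ^ k \<noteq> 1"
    using w False N mod_less_divisor[OF N, of k] by (simp add: wN primitive_root_of_unity_def mod_eq_0_iff_dvd mod_greater_zero_iff_not_dvd)
  moreover have "(w ^ k) ^ (j * N) = 1"
    using wN by (simp flip: power_mult add: mult.commute mult.left_commute) (simp add: power_mult)
  ultimately have "(\<Sum>i<j * N. (w ^ k) ^ i) = 0" using geometric_sum[of "w ^ k" "j * N"] by simp
  then show ?thesis using False by (simp flip: power_mult add: mult.commute)
qed

text \<open>The power sums at the roots are N in degrees divisible by N and 0 otherwise. In Newton's
  recursion they leave, if N divides d, exactly d / N terms equal to N, and nothing otherwise, which
  is the recursion for 1 / (1 - X ^ N).\<close>

lemma complete_fps_primitive_root:
  assumes N: "N > 0" and w: "primitive_root_of_unity N w"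
  shows "complete_fps N ((^) w) = geom N"
proof (rule fps_ext)
  fix d
  show "fps_nth (complete_fps N ((^) w)) d = fps_nth (geom N) d"
  proof (induction d rule: less_induct)
    case (less d)
    show ?case
    proof (cases d)
      case (Suc e)
      have g: "fps_nth (geom N) k = (if N dvd k then 1 else 0)" for k by (simp add: geom_def)
      have pw: "(\<Sum>j<N. (w ^ j) ^ k) = (if N dvd k then of_nat N else 0)" for k
        using sum_primitive_root_powers[OF assms, of k 1] by simp
      have "of_nat d * fps_nth (complete_fps N ((^) w)) d = (\<Sum>i\<le>e. (\<Sum>j<N. (w ^ j) ^ Suc i) * fps_nth (complete_fps N ((^) w)) (e - i))"
        unfolding Suc by (rule Newton_identity)
      also have "\<dots> = (\<Sum>i\<le>e. if N dvd Suc i \<and> N dvd d then of_nat N else 0)"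
      proof (intro sum.cong refl)
        fix i assume i: "i \<in> {..e}"
        then have d: "d = Suc i + (e - i)" using Suc by simp
        have "N dvd Suc i \<Longrightarrow> N dvd d \<longleftrightarrow> N dvd e - i" unfolding d by (rule dvd_add_right_iff)
        moreover have "fps_nth (complete_fps N ((^) w)) (e - i) = (if N dvd e - i then 1 else 0)"
          using less[of "e - i"] Suc by (simp add: g)
        ultimately show "(\<Sum>j<N. (w ^ j) ^ Suc i) * fps_nth (complete_fps N ((^) w)) (e - i) = (if N dvd Suc i \<and> N dvd d then of_nat N else 0)"
          unfolding pw by auto
      qed
      also have "\<dots> = (if N dvd d then of_nat N * of_nat (card {i. i \<le> e \<and> N dvd Suc i}) else 0)"
        by (simp add: sum.If_cases Int_def)
      also have "card {i. i \<le> e \<and> N dvd Suc i} = d div N"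
      proof -
        have "bij_betw (\<lambda>t. N * Suc t - 1) {..<d div N} {i. i \<le> e \<and> N dvd Suc i}"
        proof (rule bij_betwI[where g = "\<lambda>i. Suc i div N - 1"])
          show "(\<lambda>t. N * Suc t - 1) \<in> {..<d div N} \<rightarrow> {i. i \<le> e \<and> N dvd Suc i}"
          proof
            fix t assume "t \<in> {..<d div N}"
            then have "N * Suc t \<le> N * (d div N)" by (intro mult_left_mono) auto
            also have "\<dots> \<le> d" by simp
            finally have "N * Suc t \<le> d" .
            moreover have "N * Suc t > 0" using N by simp
            ultimately have "N * Suc t - 1 \<le> e" "Suc (N * Suc t - 1) = N * Suc t" using Suc by linarith+
            then show "N * Suc t - 1 \<in> {i. i \<le> e \<and> N dvd Suc i}" by (metis dvd_triv_left mem_Collect_eq)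
          qed
          show "(\<lambda>i. Suc i div N - 1) \<in> {i. i \<le> e \<and> N dvd Suc i} \<rightarrow> {..<d div N}"
          proof
            fix i assume "i \<in> {i. i \<le> e \<and> N dvd Suc i}"
            then obtain t where t: "Suc i = N * t" "i \<le> e" by (auto simp: dvd_def)
            then have "t > 0" by (intro gr0I) simp
            have "t = Suc i div N" using t N by simp
            also have "\<dots> \<le> d div N" using t Suc by (intro div_le_mono) simp
            finally show "Suc i div N - 1 \<in> {..<d div N}" using t N \<open>t > 0\<close> by simp
          qed
        next
          fix t assume "t \<in> {..<d div N}"
          have "Suc (N * Suc t - 1) = N * Suc t" using N by simp
          then show "Suc (N * Suc t - 1) div N - 1 = t" using N by (simp only: nonzero_mult_div_cancel_left)
        next
          fix i assume "i \<in> {i. i \<le> e \<and> N dvd Suc i}"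
          then obtain t where t: "Suc i = N * t" by (auto simp: dvd_def)
          then have "t > 0" by (intro gr0I) simp
          then have "Suc (Suc i div N - 1) = t" using t N by simp
          then show "N * Suc (Suc i div N - 1) - 1 = i" using t by simp
        qed
        then show ?thesis using bij_betw_same_card by fastforce
      qed
      also have "(if N dvd d then of_nat N * of_nat (d div N) else 0) = of_nat d * (fps_nth (geom N) d :: complex)"
        by (auto simp: g simp flip: of_nat_mult)
      finally have "of_nat d * fps_nth (complete_fps N ((^) w)) d = of_nat d * fps_nth (geom N) d" .
      moreover have "of_nat d \<noteq> (0 :: complex)" using Suc by (simp del: of_nat_Suc)
      ultimately show ?thesis by (simp only: mult_cancel_left simp_thms)
    qed (simp add: geom_def)
  qed
qed

text \<open>The exponents run through j consecutive periods of w, so the variables are j copies of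
  the N roots of unity.\<close>

lemma complete_fps_primitive_root_blocks:
  assumes N: "N > 0" and w: "primitive_root_of_unity N w"
  shows "complete_fps (j * N) ((^) w) = geom N ^ j"
proof (induction j)
  case (Suc j)
  have "w ^ (j * N + i) = w ^ i" for i
    using w by (simp add: primitive_root_of_unity_def power_add power_mult mult.commute[of j])
  then have "(\<Prod>i<N. Abs_fps (\<lambda>k. (w ^ (j * N + i)) ^ k)) = complete_fps N ((^) w)" by (simp add: complete_fps_def)
  moreover have split: "(\<Prod>i<a + b. f i) = (\<Prod>i<a. f i) * (\<Prod>i<b. f (a + i))" for a b :: nat and f :: "nat \<Rightarrow> complex fps"
    by (induction b) (simp_all add: mult.assoc)
  have "complete_fps (j * N + N) ((^) w) = complete_fps (j * N) ((^) w) * (\<Prod>i<N. Abs_fps (\<lambda>k. (w ^ (j * N + i)) ^ k))"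
    unfolding complete_fps_def by (rule split)
  ultimately show ?case using Suc complete_fps_primitive_root[OF assms] by (simp add: add.commute mult.commute)
qed (simp add: complete_fps_def)

lemma skew_schur_primitive_root:
  assumes N: "N > 0" and w: "primitive_root_of_unity N w" and sk: "skew_partition lam mu" and r: "plength lam \<le> r"
    and M: "beads r lam \<subseteq> {..<M}" "beads r mu \<subseteq> {..<M}"
  shows "skew_schur lam mu (j * N) ((^) w) =
    of_int (sort_sign N (beads r lam) * sort_sign N (beads r mu)) * of_nat (num_chains N M j (beads r lam) (beads r mu))"
proof -
  note p = skew_partitionD[OF sk]
  have "skew_schur lam mu (j * N) ((^) w) = toeplitz_minor 1 (geom N ^ j) (beads r lam) (beads r mu)"
    using Jacobi_Trudi[OF sk r, of "j * N" "(^) w"] complete_fps_primitive_root_blocks[OF N w, of j] by simp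
  also have "\<dots> = of_int (sort_sign N (beads r lam) * sort_sign N (beads r mu)) * toeplitz_minor N (geom N ^ j) (beads r lam) (beads r mu)"
    by (rule toeplitz_minor_eps) (simp_all add: p)
  also have "toeplitz_minor N (geom N ^ j) (beads r lam) (beads r mu) = of_nat (num_chains N M j (beads r lam) (beads r mu))"
    by (rule toeplitz_minor_geom_power[OF M]) (simp add: p)
  finally show ?thesis .
qed

lemma num_chains_1:
  assumes "B \<subseteq> {..<M}" "A \<subseteq> {..<M}" "card A = card B"
  shows "num_chains N M 1 B A = (if interlaced N B A then 1 else 0)"
proof -
  have "finite {C. C \<subseteq> {..<M} \<and> card C = card B}" by (rule finite_subset[of _ "Pow {..<M}"]) auto
  moreover have eq: "num_chains N M 1 B A = (\<Sum>C | C \<subseteq> {..<M} \<and> card C = card B. if C = A then (if interlaced N B A then 1 else 0) else 0)"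
    unfolding One_nat_def num_chains.simps(2) by (rule sum.cong) auto
  ultimately show ?thesis unfolding eq using assms by simp
qed

lemma rect_partition:
  assumes "N > 0"
  shows "rect N m \<in> partitions_of (N * m)" "plength (rect N m) = m" "zee (rect N m) = fact m * N ^ m"
proof -
  have "{i. rect N m i \<noteq> 0} = {..<m}" using assms by (auto simp: rect_def)
  then show len: "plength (rect N m) = m" by (simp add: plength_def)
  have part: "is_partition (rect N m)" by (rule is_partitionI[of _ m]) (auto simp: rect_def)
  have size: "psize (rect N m) = N * m" unfolding psize_def len by (simp add: rect_def)
  with part show "rect N m \<in> partitions_of (N * m)" by (simp add: partitions_of_def)
  have mult: "part_mult (rect N m) j = (if j = N then m else 0)" if "j > 0" for j
  proof -
    have "{i. rect N m i = j} = (if j = N then {..<m} else {})" using that assms by (auto simp: rect_def)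
    then show ?thesis by (simp add: part_mult_def)
  qed
  have "zee (rect N m) = (\<Prod>j\<in>{1..N * m}. if j = N then fact m * N ^ m else 1)"
    unfolding zee_def size by (intro prod.cong refl) (auto simp: mult)
  also have "\<dots> = fact m * N ^ m"
  proof (cases m)
    case (Suc k)
    then have "N \<in> {1..N * m}" using assms by simp
    then show ?thesis by (simp add: prod.delta')
  qed simp
  finally show "zee (rect N m) = fact m * N ^ m" .
qed

text \<open>Nonzero parts divisible by N are at least N, so at most m of them fit into N * m, and m
  of them only if all equal N. This isolates the top power of j in the power sum expansion.\<close>

lemma plength_of_multiple_parts:
  assumes N: "N > 0" and nu: "nu \<in> partitions_of (N * m)" and dvd: "\<forall>i<plength nu. N dvd nu i"
  shows "plength nu \<le> m" "plength nu = m \<Longrightarrow> nu = rect N m"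
proof -
  note b = partitions_of_bounds[OF nu]
  have ge: "N \<le> nu i" if "i < plength nu" for i
    using that dvd is_partition_nonzero_iff[OF b(1), of i] by (auto intro: dvd_imp_le)
  have sum: "(\<Sum>i<plength nu. nu i) = N * m" using b(4) by (simp add: psize_def)
  have "(\<Sum>i<plength nu. N) \<le> (\<Sum>i<plength nu. nu i)" by (intro sum_mono) (simp add: ge)
  then show "plength nu \<le> m" using sum N by (simp add: mult.commute)
  assume eq: "plength nu = m"
  show "nu = rect N m"
  proof
    fix i
    show "nu i = rect N m i"
    proof (cases "i < m")
      case True
      show ?thesis
      proof (rule ccontr)
        assume "nu i \<noteq> rect N m i"
        then have "N < nu i" using ge[of i] True eq by (simp add: rect_def)
        then have "(\<Sum>i<plength nu. N) < (\<Sum>i<plength nu. nu i)"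
          using True eq by (intro sum_strict_mono_ex1) (auto simp: ge)
        then show False using sum eq by simp
      qed
    next
      case False
      then show ?thesis using is_partition_zero_ge[OF b(1), of m i] eq by (simp add: rect_def)
    qed
  qed
qed

lemma power_sum_primitive_root:
  assumes N: "N > 0" and w: "primitive_root_of_unity N w"
  shows "power_sum nu (j * N) ((^) w) = (if \<forall>i<plength nu. N dvd nu i then of_nat (j * N) ^ plength nu else 0)"
proof (cases "\<forall>i<plength nu. N dvd nu i")
  case True
  then show ?thesis by (simp add: power_sum_def sum_primitive_root_powers[OF assms] del: of_nat_mult)
next
  case False
  then have "\<exists>i\<in>{..<plength nu}. (\<Sum>k<j * N. (w ^ k) ^ nu i) = 0"
    by (auto simp: sum_primitive_root_powers[OF assms])
  then have "power_sum nu (j * N) ((^) w) = 0" unfolding power_sum_def by (intro prod_zero) auto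
  then show ?thesis by (simp only: False if_False)
qed

text \<open>Both sides of the expansion in power sums are evaluated at \<open>j\<close> copies of the roots of unity.
  The character is the coefficient of the dominant power of \<open>j\<close>, and its sign is read off from the growth of
  the number of chains.\<close>

lemma sgn_skew_character_rect:
  assumes N: "N > 0" and w: "primitive_root_of_unity N w" and sk: "skew_partition lam mu" and r: "plength lam \<le> r"
    and dom: "dominated N r (bead_enum N (beads r lam)) (bead_enum N (beads r mu))"
    and size: "skew_size lam mu = N * m"
  shows "sgn (skew_character lam mu (rect N m)) = sort_sign N (beads r lam) * sort_sign N (beads r mu)"
proof -
  note p = skew_partitionD[OF sk]
  let ?B = "beads r lam" and ?A = "beads r mu"
  let ?E = "sort_sign N ?B * sort_sign N ?A"
  let ?chi = "skew_character lam mu"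
  define M where "M = Suc (Max (?B \<union> ?A))"
  have M: "?B \<subseteq> {..<M}" "?A \<subseteq> {..<M}" by (auto simp: M_def less_Suc_eq_le)
  define mult where "mult nu \<longleftrightarrow> (\<forall>i<plength nu. N dvd nu i)" for nu
  \<comment> \<open>The coefficient of j ^ \<open>plength nu\<close> after multiplication by the two
    sorting signs, which turns the left side into the nonnegative chain count.\<close>
  define a where "a nu = real_of_int (?E * ?chi nu) / real (zee nu) * (if mult nu then real N ^ plength nu else 0)" for nu
  have E2: "?E * ?E = 1" using sort_sign_square[of N ?B] sort_sign_square[of N ?A] by (simp add: algebra_simps)
  have num_chains: "real (num_chains N M j ?B ?A) = (\<Sum>nu\<in>partitions_of (N * m). a nu * real j ^ plength nu)" for j
  proof -
    have "of_int ?E * skew_schur lam mu (j * N) ((^) w) = of_int (?E * ?E) * (of_nat (num_chains N M j ?B ?A) :: complex)"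
      unfolding skew_schur_primitive_root[OF N w sk r M] by simp
    then have "complex_of_real (real (num_chains N M j ?B ?A)) = of_int ?E * skew_schur lam mu (j * N) ((^) w)"
      unfolding E2 by simp
    also have "\<dots> = (\<Sum>nu\<in>partitions_of (N * m). complex_of_real (a nu * real j ^ plength nu))"
      unfolding skew_schur_eq_sum_character[OF sk] size power_sum_primitive_root[OF N w] sum_distrib_left mult_def[symmetric]
      by (intro sum.cong refl) (simp add: a_def power_mult_distrib)
    finally have "complex_of_real (real (num_chains N M j ?B ?A)) = complex_of_real (\<Sum>nu\<in>partitions_of (N * m). a nu * real j ^ plength nu)"
      by (simp only: of_real_sum)
    then show ?thesis using of_real_eq_iff by blast
  qed
  have sumAB: "(\<Sum>i<card ?B. bead_enum N ?B i - bead_enum N ?A i) = N * m"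
  proof -
    have s: "(\<Sum>i<r. bead_enum N ?B i) = \<Sum>?B" "(\<Sum>i<r. bead_enum N ?A i) = \<Sum>?A"
      using sum.reindex_bij_betw[OF bead_enum_bij[of ?B N], of "\<lambda>x. x"] sum.reindex_bij_betw[OF bead_enum_bij[of ?A N], of "\<lambda>x. x"] p
      by simp_all
    have "(\<Sum>i<r. bead_enum N ?B i - bead_enum N ?A i) = \<Sum>?B - \<Sum>?A"
      unfolding s[symmetric] using dom by (intro sum_subtractf_nat) (auto simp: dominated_def)
    also have "\<dots> = N * m"
      using sum_beads[OF p(1) r] sum_beads[OF p(2), of r] p(4) r skew_size_diff[OF sk] size by simp
    finally show ?thesis using p by simp
  qed
  have ge: "j choose m \<le> num_chains N M j ?B ?A" for j
    by (rule num_chains_ge_binomial[OF N M]) (use dom sumAB p in auto)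
  define L where "L = real_of_int (?E * ?chi (rect N m)) / fact m"
  have lim: "(\<lambda>j. real (num_chains N M j ?B ?A) / real j ^ m) \<longlonglongrightarrow> L"
  proof -
    have t: "(\<lambda>j. a nu * (real j ^ plength nu / real j ^ m)) \<longlonglongrightarrow> (if nu = rect N m then L else 0)"
      if nu: "nu \<in> partitions_of (N * m)" for nu
    proof (cases "mult nu")
      case True
      note len = plength_of_multiple_parts[OF N nu True[unfolded mult_def]]
      show ?thesis
      proof (cases "plength nu = m")
        case eq: True
        then have rect: "nu = rect N m" using len by simp
        have "a nu = L" using True eq rect rect_partition[OF N, of m] N by (simp add: a_def L_def)
        moreover have "(\<lambda>j. a nu * (real j ^ plength nu / real j ^ m)) \<longlonglongrightarrow> a nu"
          by (rule tendsto_eventually, rule eventually_mono[OF eventually_gt_at_top[of 0]]) (simp add: eq)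
        ultimately show ?thesis using rect by simp
      next
        case False
        then have lt: "plength nu < m" using len by simp
        have "(\<lambda>j. inverse (real j ^ (m - plength nu))) \<longlonglongrightarrow> 0"
          using lt by (intro tendsto_inverse_0_at_top filterlim_pow_at_top filterlim_real_sequentially) auto
        moreover have "\<forall>\<^sub>F j in sequentially. inverse (real j ^ (m - plength nu)) = real j ^ plength nu / real j ^ m"
          by (rule eventually_mono[OF eventually_gt_at_top[of 0]]) (use lt in \<open>simp add: power_diff field_simps\<close>)
        ultimately have "(\<lambda>j. real j ^ plength nu / real j ^ m) \<longlonglongrightarrow> 0" by (rule Lim_transform_eventually)
        then have "(\<lambda>j. a nu * (real j ^ plength nu / real j ^ m)) \<longlonglongrightarrow> a nu * 0" by (rule tendsto_mult_left)
        moreover have "nu \<noteq> rect N m" using lt rect_partition[OF N, of m] by auto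
        ultimately show ?thesis by simp
      qed
    next
      case False
      moreover have "nu \<noteq> rect N m" using False rect_partition(2)[OF N, of m] by (auto simp: rect_def mult_def)
      ultimately show ?thesis by (simp add: a_def)
    qed
    have "(\<lambda>j. \<Sum>nu\<in>partitions_of (N * m). a nu * (real j ^ plength nu / real j ^ m)) \<longlonglongrightarrow>
        (\<Sum>nu\<in>partitions_of (N * m). if nu = rect N m then L else 0)"
      by (rule tendsto_sum) (rule t)
    also have "(\<Sum>nu\<in>partitions_of (N * m). if nu = rect N m then L else 0) = L"
      using rect_partition[OF N, of m] finite_partitions_of by simp
    finally show ?thesis unfolding num_chains by (simp add: sum_divide_distrib)
  qed
  \<comment> \<open>From (j / m) ^ m <= j choose m for j > m. For m = 0 the bound reads 1 <= L,
    since 0 ^ 0 = 1.\<close>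
  have "1 / real m ^ m \<le> L"
  proof (rule tendsto_lowerbound[OF lim])
    show "\<forall>\<^sub>F j in sequentially. 1 / real m ^ m \<le> real (num_chains N M j ?B ?A) / real j ^ m"
    proof (rule eventually_mono[OF eventually_gt_at_top[of m]])
      fix j assume j: "m < j"
      have "(real j / real m) ^ m \<le> real (j choose m)"
        using binomial_ge_n_over_k_pow_k[of m j, where 'a = real] j by simp
      also have "\<dots> \<le> real (num_chains N M j ?B ?A)" using ge[of j] by simp
      finally have "real j ^ m / real m ^ m \<le> real (num_chains N M j ?B ?A)" by (simp add: power_divide)
      then have "real j ^ m / real m ^ m / real j ^ m \<le> real (num_chains N M j ?B ?A) / real j ^ m"
        by (rule divide_right_mono) simp
      then show "1 / real m ^ m \<le> real (num_chains N M j ?B ?A) / real j ^ m" using j by simp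
    qed
  qed simp
  moreover have "0 < 1 / real m ^ m" by (cases "m = 0") auto
  ultimately have "0 < L" by linarith
  then have "0 < ?E * ?chi (rect N m)" unfolding L_def by (simp add: zero_less_divide_iff del: of_int_mult)
  then show ?thesis
    using sort_sign_cases[of N ?B] sort_sign_cases[of N ?A] by (auto simp: sgn_if)
qed


section \<open>Schur polynomials as quotients of alternants\<close>

definition alternant :: "nat \<Rightarrow> (nat \<Rightarrow> nat) \<Rightarrow> (nat \<Rightarrow> complex) \<Rightarrow> complex" where
  "alternant n b x = leibniz_det n (\<lambda>l i. x l ^ b i)"

definition staircase :: "nat \<Rightarrow> nat \<Rightarrow> nat" where
  "staircase n i = n - 1 - i"

lemma alternant_sum: "alternant n b x = (\<Sum>p | p permutes {..<n}. of_int (sign p) * (\<Prod>l<n. x l ^ b (p l)))"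
  by (simp add: alternant_def leibniz_det_def)

lemma alternant_cong: "(\<And>i. i < n \<Longrightarrow> b i = c i) \<Longrightarrow> alternant n b x = alternant n c x"
  unfolding alternant_def by (rule leibniz_det_cong) simp

lemma nth_prod_linear_zero:
  fixes x :: "nat \<Rightarrow> complex"
  assumes "finite S" "card S < i"
  shows "fps_nth (\<Prod>m\<in>S. 1 - fps_const (x m) * fps_X) i = 0"
  using assms
proof (induction S arbitrary: i rule: finite_induct)
  case (insert m S)
  let ?Q = "\<Prod>m\<in>S. 1 - fps_const (x m) * fps_X"
  have i: "card S < i" "card S < i - 1" "i \<noteq> 0" using insert by auto
  have "(\<Prod>m\<in>insert m S. 1 - fps_const (x m) * fps_X) = ?Q - fps_const (x m) * (fps_X * ?Q)"
    using insert by (simp add: algebra_simps)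
  then show ?case using insert.IH[OF i(1)] insert.IH[OF i(2)] i(3)
    by (simp only: fps_sub_nth fps_mult_left_const_nth fps_X_mult_nth if_False mult_zero_right diff_self)
qed simp

lemma geometric_fps_inverse:
  fixes z :: complex
  shows "Abs_fps (\<lambda>k. z ^ k) * (1 - fps_const z * fps_X) = 1"
proof (rule fps_ext)
  fix n
  show "fps_nth (Abs_fps (\<lambda>k. z ^ k) * (1 - fps_const z * fps_X)) n = fps_nth 1 n"
    by (cases n) (simp_all add: right_diff_distrib mult.left_commute[of _ "fps_const z"])
qed

text \<open>The series of x l alone is the full product times the factors 1 - x m X of the other
  variables, and these form a polynomial of degree below n. The coefficient of X ^ b expresses the
  power through complete homogeneous polynomials and signed elementary ones.\<close>

lemma power_eq_sum_complete_fps: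
  assumes l: "l < n"
  shows "x l ^ b = (\<Sum>i<n. toeplitz_entry (complete_fps n x) b i * fps_nth (\<Prod>m\<in>{..<n} - {l}. 1 - fps_const (x m) * fps_X) i)"
proof -
  let ?P = "\<Prod>m\<in>{..<n} - {l}. 1 - fps_const (x m) * fps_X"
  have "complete_fps n x * ?P = Abs_fps (\<lambda>k. x l ^ k) * ((\<Prod>m\<in>{..<n} - {l}. Abs_fps (\<lambda>k. x m ^ k)) * ?P)"
    unfolding complete_fps_def using l by (subst prod.remove[of _ l]) (auto simp: mult.assoc)
  also have "(\<Prod>m\<in>{..<n} - {l}. Abs_fps (\<lambda>k. x m ^ k)) * ?P = 1"
    unfolding prod.distrib[symmetric] geometric_fps_inverse by simp
  finally have "x l ^ b = fps_nth (complete_fps n x * ?P) b" by simp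
  also have "\<dots> = (\<Sum>i\<le>b. fps_nth ?P i * fps_nth (complete_fps n x) (b - i))"
    by (simp only: mult.commute[of "complete_fps n x"] fps_mult_nth atMost_atLeast0)
  also have "\<dots> = (\<Sum>i<n. toeplitz_entry (complete_fps n x) b i * fps_nth ?P i)"
  proof (rule sum.mono_neutral_cong)
    fix i assume "i \<in> {..b} - {..<n}"
    then have "fps_nth ?P i = 0" by (intro nth_prod_linear_zero) (use l in auto)
    then show "fps_nth ?P i * fps_nth (complete_fps n x) (b - i) = 0" by simp
  qed (auto simp: toeplitz_entry_def)
  finally show ?thesis .
qed

lemma schur_empty: "schur empty_partition n x = 1"
proof -
  have "cells empty_partition empty_partition = {}" by (auto simp: cells_def)
  then show ?thesis by (simp add: schur_def skew_schur_def ssyt_def)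
qed

text \<open>The matrix of powers factors into the Jacobi-Trudi matrix of g and a matrix E that is
  independent of g. The empty partition, whose Schur polynomial is 1, identifies the determinant of
  E as the Vandermonde determinant.\<close>

theorem schur_bialternant:
  assumes "is_partition g" "plength g \<le> n"
  shows "schur g n x * alternant n (staircase n) x = alternant n (\<lambda>i. g i + (n - 1 - i)) x"
proof -
  define E where "E = (\<lambda>j l. fps_nth (\<Prod>m\<in>{..<n} - {l}. 1 - fps_const (x m) * fps_X) (n - 1 - j))"
  have *: "alternant n (\<lambda>i. g i + (n - 1 - i)) x = schur g n x * leibniz_det n E" if g: "is_partition g" "plength g \<le> n" for g
  proof -
    have "schur g n x = leibniz_det n (\<lambda>i j. toeplitz_entry (complete_fps n x) (g i + (n - 1 - i)) (n - 1 - j))"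
      unfolding schur_def Jacobi_Trudi[OF skew_partition_zero[OF g(1)] g(2)] toeplitz_minor_def card_beads[OF g(1)]
      by (rule leibniz_det_cong) (use g in \<open>simp add: bead_enum_beads\<close>)
    then have "schur g n x * leibniz_det n E = leibniz_det n (\<lambda>i l. \<Sum>j<n. toeplitz_entry (complete_fps n x) (g i + (n - 1 - i)) (n - 1 - j) * E j l)"
      by (simp only: leibniz_det_mult)
    also have "\<dots> = leibniz_det n (\<lambda>i l. x l ^ (g i + (n - 1 - i)))"
    proof (rule leibniz_det_cong)
      fix i l assume "l < n"
      have "(\<Sum>j<n. toeplitz_entry (complete_fps n x) (g i + (n - 1 - i)) (n - 1 - j) * E j l) =
         (\<Sum>j<n. toeplitz_entry (complete_fps n x) (g i + (n - 1 - i)) j * fps_nth (\<Prod>m\<in>{..<n} - {l}. 1 - fps_const (x m) * fps_X) j)"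
        unfolding E_def by (rule sum.reindex_bij_witness[of _ "\<lambda>j. n - 1 - j" "\<lambda>j. n - 1 - j"]) auto
      then show "(\<Sum>j<n. toeplitz_entry (complete_fps n x) (g i + (n - 1 - i)) (n - 1 - j) * E j l) = x l ^ (g i + (n - 1 - i))"
        unfolding power_eq_sum_complete_fps[OF \<open>l < n\<close>, of x "g i + (n - 1 - i)"] .
    qed
    also have "\<dots> = alternant n (\<lambda>i. g i + (n - 1 - i)) x"
      unfolding alternant_def by (rule leibniz_det_transpose)
    finally show ?thesis by (rule sym)
  qed
  have "alternant n (staircase n) x = alternant n (\<lambda>i. empty_partition i + (n - 1 - i)) x"
    by (rule alternant_cong) (simp add: staircase_def)
  also have "\<dots> = leibniz_det n E"
    using *[of empty_partition] by (simp only: schur_empty is_partition_zero plength_zero le0 mult_1)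
  finally have "alternant n (staircase n) x = leibniz_det n E" .
  then show ?thesis using *[OF assms] by simp
qed

text \<open>The monomials \<open>z ^ (n - 1 - i)\<close> may be replaced by monic
  polynomials of the same degrees; choosing these to vanish at the \<open>x j\<close> with \<open>nu j < nu i\<close> makes the
  matrix block triangular.\<close>

definition block_stair :: "nat \<Rightarrow> (nat \<Rightarrow> nat) \<Rightarrow> nat \<Rightarrow> nat" where
  "block_stair n nu i = card {j. i < j \<and> j < n \<and> nu j = nu i}"

definition stab :: "nat \<Rightarrow> (nat \<Rightarrow> nat) \<Rightarrow> (nat \<Rightarrow> nat) set" where
  "stab n nu = {p. p permutes {..<n} \<and> (\<forall>i<n. nu (p i) = nu i)}"

text \<open>For a partition nu this is the product of the Vandermonde determinants of the blocks of
  equal parts, written as one sum over the Young subgroup.\<close>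

definition block_alternant :: "nat \<Rightarrow> (nat \<Rightarrow> nat) \<Rightarrow> (nat \<Rightarrow> complex) \<Rightarrow> complex" where
  "block_alternant n nu x = (\<Sum>p\<in>stab n nu. of_int (sign p) * (\<Prod>l<n. x l ^ block_stair n nu (p l)))"

lemma block_stair_add:
  assumes "antimono nu" "i < n"
  shows "block_stair n nu i + card {j. j < n \<and> nu j < nu i} = n - 1 - i"
proof -
  have "{i<..<n} = {j. i < j \<and> j < n \<and> nu j = nu i} \<union> {j. j < n \<and> nu j < nu i}"
  proof (intro equalityI subsetI)
    fix j assume "j \<in> {i<..<n}"
    then have "nu j \<le> nu i" using antimonoD[OF assms(1), of i j] by simp
    then show "j \<in> {j. i < j \<and> j < n \<and> nu j = nu i} \<union> {j. j < n \<and> nu j < nu i}"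
      using \<open>j \<in> {i<..<n}\<close> by auto
  next
    fix j assume j: "j \<in> {j. i < j \<and> j < n \<and> nu j = nu i} \<union> {j. j < n \<and> nu j < nu i}"
    have "i < j" if "nu j < nu i" using antimonoD[OF assms(1), of j i] that by (meson leI leD)
    then show "j \<in> {i<..<n}" using j by auto
  qed
  then have "card {i<..<n} = block_stair n nu i + card {j. j < n \<and> nu j < nu i}"
    unfolding block_stair_def by (simp add: card_Un_disjoint disjoint_iff)
  then show ?thesis by simp
qed

lemma block_Vandermonde:
  assumes nu: "antimono nu"
  shows "alternant n (staircase n) x = block_alternant n nu x * (\<Prod>l<n. \<Prod>j\<in>{j. j < n \<and> nu j < nu l}. x l - x j)"
proof -
  let ?S = "\<lambda>i. {j. j < n \<and> nu j < nu i}"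
  \<comment> \<open>Monic of degree n - 1 - i by \<open>block_stair_add\<close>, so passing from the
    monomials to these polynomials is unitriangular and preserves the determinant.\<close>
  define f where "f = (\<lambda>i. monom 1 (block_stair n nu i) * (\<Prod>j\<in>?S i. [:- x j, 1:]))"
  have deg: "degree (f i) = n - 1 - i" and lc: "lead_coeff (f i) = 1" if "i < n" for i
  proof -
    have "degree (\<Prod>j\<in>?S i. [:- x j, 1:]) = card (?S i)"
      by (subst degree_prod_eq_sum_degree) auto
    moreover have "(\<Prod>j\<in>?S i. [:- x j, 1:]) \<noteq> 0" by auto
    ultimately show "degree (f i) = n - 1 - i"
      unfolding f_def block_stair_add[OF nu that, symmetric]
      by (simp add: degree_mult_eq degree_monom_eq)
    show "lead_coeff (f i) = 1"
      unfolding f_def by (simp only: lead_coeff_mult lead_coeff_prod lead_coeff_monom) simp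
  qed
  have "leibniz_det n (\<lambda>l i. poly (f i) (x l)) = leibniz_det n (\<lambda>l i. \<Sum>k<n. x l ^ (n - 1 - k) * coeff (f i) (n - 1 - k))"
  proof (rule leibniz_det_cong)
    fix l i assume "i < n"
    have "poly (f i) (x l) = (\<Sum>k\<le>degree (f i). coeff (f i) k * x l ^ k)"
      by (rule poly_altdef)
    also have "\<dots> = (\<Sum>k<n. coeff (f i) k * x l ^ k)"
      by (rule sum.mono_neutral_left) (use deg[OF \<open>i < n\<close>] \<open>i < n\<close> in \<open>auto intro: coeff_eq_0\<close>)
    also have "(\<Sum>k<n. coeff (f i) k * x l ^ k) = (\<Sum>k<n. x l ^ (n - 1 - k) * coeff (f i) (n - 1 - k))"
      by (rule sum.reindex_bij_witness[of _ "\<lambda>j. n - 1 - j" "\<lambda>j. n - 1 - j"]) auto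
    finally show "poly (f i) (x l) = (\<Sum>k<n. x l ^ (n - 1 - k) * coeff (f i) (n - 1 - k))" .
  qed
  also have "\<dots> = alternant n (staircase n) x * leibniz_det n (\<lambda>k i. coeff (f i) (n - 1 - k))"
    unfolding leibniz_det_mult alternant_def staircase_def ..
  also have "leibniz_det n (\<lambda>k i. coeff (f i) (n - 1 - k)) = leibniz_det n (\<lambda>i k. coeff (f i) (n - 1 - k))"
    by (rule leibniz_det_transpose)
  also have "\<dots> = (\<Prod>i<n. coeff (f i) (n - 1 - i))"
  proof (rule leibniz_det_upper_triangular)
    fix i j :: nat assume "j < i" "i < n"
    then have "degree (f i) < n - 1 - j" using deg[of i] by linarith
    then show "coeff (f i) (n - 1 - j) = 0" by (rule coeff_eq_0)
  qed
  also have "\<dots> = 1"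
  proof (intro prod.neutral ballI)
    fix i assume "i \<in> {..<n}"
    then show "coeff (f i) (n - 1 - i) = 1" using deg[of i] lc[of i] by simp
  qed
  finally have "alternant n (staircase n) x = leibniz_det n (\<lambda>l i. poly (f i) (x l))" by simp
  also have "\<dots> = (\<Sum>p\<in>stab n nu. of_int (sign p) * (\<Prod>l<n. poly (f (p l)) (x l)))"
    unfolding leibniz_det_def
  proof (rule sum.mono_neutral_right)
    show "stab n nu \<subseteq> {p. p permutes {..<n}}" by (auto simp: stab_def)
    show "\<forall>p\<in>{p. p permutes {..<n}} - stab n nu. of_int (sign p) * (\<Prod>l<n. poly (f (p l)) (x l)) = 0"
    proof
      fix p assume p: "p \<in> {p. p permutes {..<n}} - stab n nu"
      then have perm: "p permutes {..<n}" by simp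
      \<comment> \<open>A permutation outside the stabiliser increases some part, because the total
        is preserved; at such an l the polynomial \<open>f (p l)\<close> has the root x l.\<close>
      have "\<exists>l<n. nu l < nu (p l)"
      proof (rule ccontr)
        assume "\<not> ?thesis"
        then have le: "nu (p l) \<le> nu l" if "l < n" for l using that by (meson not_less)
        obtain l where "l < n" "nu (p l) \<noteq> nu l" using p by (auto simp: stab_def)
        then have "(\<Sum>l<n. nu (p l)) < (\<Sum>l<n. nu l)"
          using le by (intro sum_strict_mono_ex1) (auto intro: le_neq_trans)
        moreover have "(\<Sum>l<n. nu (p l)) = (\<Sum>l<n. nu l)"
          using sum.permute[OF perm, of nu] by (simp add: o_def)
        ultimately show False by simp
      qed
      then obtain l where l: "l < n" "nu l < nu (p l)" by blast
      then have "(\<Prod>j\<in>?S (p l). x l - x j) = 0" by (intro prod_zero) auto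
      then have "poly (f (p l)) (x l) = 0" by (simp add: f_def poly_prod)
      then have "(\<Prod>l<n. poly (f (p l)) (x l)) = 0" using l(1) by (intro prod_zero) auto
      then show "of_int (sign p) * (\<Prod>l<n. poly (f (p l)) (x l)) = 0" by simp
    qed
  qed (simp add: finite_permutations)
  also have "\<dots> = block_alternant n nu x * (\<Prod>l<n. \<Prod>j\<in>?S l. x l - x j)"
    unfolding block_alternant_def sum_distrib_right
  proof (intro sum.cong refl)
    fix p assume "p \<in> stab n nu"
    then have "nu (p l) = nu l" if "l < n" for l using that by (simp add: stab_def)
    then have "(\<Prod>l<n. poly (f (p l)) (x l)) = (\<Prod>l<n. x l ^ block_stair n nu (p l) * (\<Prod>j\<in>?S l. x l - x j))"
      by (intro prod.cong refl) (simp add: f_def poly_prod poly_monom)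
    then show "of_int (sign p) * (\<Prod>l<n. poly (f (p l)) (x l)) =
       of_int (sign p) * (\<Prod>l<n. x l ^ block_stair n nu (p l)) * (\<Prod>l<n. \<Prod>j\<in>?S l. x l - x j)"
      by (simp add: prod.distrib mult.assoc)
  qed
  finally show ?thesis .
qed

text \<open>The staircase has distinct parts, so all blocks are singletons and
  \<open>block_Vandermonde\<close> becomes the usual product of differences.\<close>

lemma alternant_staircase_nonzero:
  assumes "inj_on x {..<n}"
  shows "alternant n (staircase n) x \<noteq> 0"
proof -
  have stab: "stab n (staircase n) = {id}"
  proof
    show "stab n (staircase n) \<subseteq> {id}"
    proof
      fix p assume p: "p \<in> stab n (staircase n)"
      have "p i = i" for i
      proof (cases "i < n")
        case True
        then have "n - 1 - p i = n - 1 - i" "p i < n"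
          using p permutes_lessThan_less[of p n i] by (auto simp: stab_def staircase_def)
        then show ?thesis using True by linarith
      next
        case False
        then show ?thesis using p by (auto simp: stab_def permutes_def)
      qed
      then show "p \<in> {id}" by auto
    qed
  qed (simp add: stab_def permutes_id)
  have "block_stair n (staircase n) l = 0" if "l < n" for l
  proof -
    have "{j. l < j \<and> j < n \<and> staircase n j = staircase n l} = {}" using that by (auto simp: staircase_def)
    then show ?thesis by (simp only: block_stair_def card.empty)
  qed
  note bs = this
  have "(\<Prod>l<n. x l ^ block_stair n (staircase n) (id l)) = 1"
  proof (intro prod.neutral ballI)
    fix l assume "l \<in> {..<n}"
    then show "x l ^ block_stair n (staircase n) (id l) = 1"
      using bs[of l] by (simp only: lessThan_iff id_apply power_0)
  qed
  then have "block_alternant n (staircase n) x = 1"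
    unfolding block_alternant_def stab by simp
  moreover have "(\<Prod>l<n. \<Prod>j\<in>{j. j < n \<and> staircase n j < staircase n l}. x l - x j) \<noteq> 0"
    using assms by (auto simp: inj_on_def)
  moreover have "antimono (staircase n)" by (auto simp: antimono_def staircase_def)
  ultimately show ?thesis using block_Vandermonde[of "staircase n" n x] by simp
qed

section \<open>Linear independence of Schur polynomials\<close>

definition generic :: "nat \<Rightarrow> (nat \<Rightarrow> complex) \<Rightarrow> bool" where
  "generic n x \<longleftrightarrow> inj_on x {..<n} \<and> (\<forall>i<n. x i \<noteq> 0)"

text \<open>Vanishing is tested at generic points only; their coordinates are nonzero so that a
  further coordinate 0 stays distinct from them. With the first n variables fixed, the sum is a
  polynomial in the last one with infinitely many zeros.\<close>

lemma monomials_independent: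
  assumes "finite I" "\<And>a b. a \<in> I \<Longrightarrow> b \<in> I \<Longrightarrow> (\<And>l. l < n \<Longrightarrow> e a l = e b l) \<Longrightarrow> a = b"
    and "\<And>x. generic n x \<Longrightarrow> (\<Sum>a\<in>I. c a * (\<Prod>l<n. x l ^ e a l)) = 0"
    and "a \<in> I"
  shows "c a = (0 :: complex)"
  using assms
proof (induction n arbitrary: I a)
  case 0
  then have "I = {a}" by auto
  then show ?case using 0(3)[of "\<lambda>_. 0"] by (simp add: generic_def)
next
  case (Suc n)
  let ?J = "{b \<in> I. e b n = e a n}"
  show ?case
  proof (rule Suc.IH[of ?J])
    fix x assume x: "generic n x"
    define p where "p = (\<Sum>b\<in>I. monom (c b * (\<Prod>l<n. x l ^ e b l)) (e b n))"
    have "poly p z = 0" if z: "z \<notin> insert 0 (x ` {..<n})" for z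
    proof -
      have "generic (Suc n) (x(n := z))" using x z by (auto simp: generic_def inj_on_def less_Suc_eq)
      then have "(\<Sum>b\<in>I. c b * (\<Prod>l<Suc n. (x(n := z)) l ^ e b l)) = 0" by (rule Suc.prems(3))
      moreover have "(\<Prod>l<n. (x(n := z)) l ^ e b l) = (\<Prod>l<n. x l ^ e b l)" for b
        by (intro prod.cong) auto
      ultimately show ?thesis by (simp add: p_def poly_sum poly_monom mult.assoc)
    qed
    then have "UNIV - insert 0 (x ` {..<n}) \<subseteq> {z. poly p z = 0}" by blast
    moreover have "infinite (UNIV - insert 0 (x ` {..<n}) :: complex set)"
      by (intro Diff_infinite_finite infinite_UNIV_char_0) auto
    ultimately have "p = 0" using poly_roots_finite[of p] finite_subset by blast
    then have "coeff p (e a n) = 0" by simp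
    then have "(\<Sum>b\<in>I. if e b n = e a n then c b * (\<Prod>l<n. x l ^ e b l) else 0) = 0"
      by (simp add: p_def coeff_sum)
    then show "(\<Sum>b\<in>?J. c b * (\<Prod>l<n. x l ^ e b l)) = 0"
      using Suc.prems(1) by (simp add: sum.inter_filter)
  next
    fix u v assume u: "u \<in> ?J" and v: "v \<in> ?J" and eq: "\<And>l. l < n \<Longrightarrow> e u l = e v l"
    show "u = v"
    proof (rule Suc.prems(2))
      fix l assume "l < Suc n"
      then show "e u l = e v l" using eq[of l] u v by (cases "l = n") auto
    qed (use u v in auto)
  qed (use Suc.prems in auto)
qed

text \<open>Multiplication by the Vandermonde determinant turns the sum into monomials indexed by a
  shape and a permutation, and these have pairwise different exponent vectors.\<close>

lemma schur_independent:
  assumes fin: "finite G" and G: "\<And>g. g \<in> G \<Longrightarrow> is_partition g \<and> plength g \<le> n"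
    and z: "\<And>x. generic n x \<Longrightarrow> (\<Sum>g\<in>G. c g * schur g n x) = 0"
    and g: "g \<in> G"
  shows "c g = 0"
proof -
  let ?P = "{p. p permutes {..<n}}"
  let ?b = "\<lambda>g i. g i + (n - 1 - i) :: nat"
  have "(\<lambda>(g, p). c g * of_int (sign p)) (g, id :: nat \<Rightarrow> nat) = 0"
  proof (rule monomials_independent[where I = "G \<times> ?P" and n = n and e = "\<lambda>(g, p) l. ?b g (p l)"
        and c = "\<lambda>(g, p). c g * of_int (sign p)" and a = "(g, id)"])
    show "finite (G \<times> ?P)" using fin by (simp add: finite_permutations)
    show "(g, id) \<in> G \<times> ?P" using g by (simp add: permutes_id)
  next
    fix x assume x: "generic n x"
    have "(\<Sum>(g, p)\<in>G \<times> ?P. c g * of_int (sign p) * (\<Prod>l<n. x l ^ ?b g (p l)))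
        = (\<Sum>g\<in>G. \<Sum>p\<in>?P. c g * of_int (sign p) * (\<Prod>l<n. x l ^ ?b g (p l)))"
      by (rule sum.cartesian_product[symmetric])
    also have "\<dots> = (\<Sum>g\<in>G. c g * alternant n (?b g) x)"
      unfolding alternant_sum sum_distrib_left by (simp only: mult.assoc)
    also have "\<dots> = (\<Sum>g\<in>G. c g * schur g n x) * alternant n (staircase n) x"
      unfolding sum_distrib_right
    proof (intro sum.cong refl)
      fix g assume "g \<in> G"
      then show "c g * alternant n (?b g) x = c g * schur g n x * alternant n (staircase n) x"
        unfolding mult.assoc using schur_bialternant[of g n x] G[of g] by simp
    qed
    also have "\<dots> = 0" using z[OF x] by simp
    finally show "(\<Sum>a\<in>G \<times> ?P. (case a of (g, p) \<Rightarrow> c g * of_int (sign p)) *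
        (\<Prod>l<n. x l ^ (case a of (g, p) \<Rightarrow> \<lambda>l. ?b g (p l)) l)) = 0"
      unfolding case_prod_unfold .
  next
    fix a b assume a: "a \<in> G \<times> ?P" and b: "b \<in> G \<times> ?P"
      and eq: "\<And>l. l < n \<Longrightarrow> (case a of (g, p) \<Rightarrow> \<lambda>l. ?b g (p l)) l = (case b of (g, p) \<Rightarrow> \<lambda>l. ?b g (p l)) l"
    obtain g1 p1 where a': "a = (g1, p1)" by (cases a)
    obtain g2 p2 where b': "b = (g2, p2)" by (cases b)
    have p: "p1 permutes {..<n}" "p2 permutes {..<n}" and gs: "is_partition g1" "plength g1 \<le> n" "is_partition g2" "plength g2 \<le> n"
      using a b G[of g1] G[of g2] by (auto simp: a' b')
    have eq': "?b g1 (p1 l) = ?b g2 (p2 l)" if "l < n" for l using eq[OF that] by (simp add: a' b')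
    note lx = lexdec_beads[OF gs(1), of n] lexdec_beads[OF gs(3), of n]
    have im: "?b g ` {..<n} = (\<lambda>l. ?b g (p l)) ` {..<n}" if "p permutes {..<n}" for g p
    proof -
      have "(\<lambda>l. ?b g (p l)) ` {..<n} = ?b g ` (p ` {..<n})" by (simp only: image_image)
      then show ?thesis unfolding permutes_image[OF that] by (rule sym)
    qed
    have "?b g1 ` {..<n} = ?b g2 ` {..<n}"
      unfolding im[OF p(1), of g1] im[OF p(2), of g2] by (rule image_cong) (simp_all only: eq' lessThan_iff)
    then have bb: "?b g1 i = ?b g2 i" if "i < n" for i
      using lexdec_unique[OF lx] that by blast
    have "g1 = g2"
    proof
      fix i
      show "g1 i = g2 i"
      proof (cases "i < n")
        case True
        then show ?thesis using bb[OF True] by simp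
      next
        case False
        then show ?thesis
          using is_partition_zero_ge[OF gs(1,2), of i] is_partition_zero_ge[OF gs(3,4), of i] by simp
      qed
    qed
    moreover have "p1 = p2"
    proof
      fix l
      show "p1 l = p2 l"
      proof (cases "l < n")
        case True
        then have l: "p1 l < n" "p2 l < n" using p by (auto simp: permutes_lessThan_less)
        have "?b g1 (p1 l) = ?b g1 (p2 l)" using eq'[OF True] bb[OF l(2)] by simp
        then show ?thesis using inj_onD[OF lexdec_inj_on[OF lx(1)], of "p1 l" "p2 l"] l by simp
      next
        case False
        then show ?thesis using p by (simp add: permutes_def)
      qed
    qed
    ultimately show "a = b" by (simp add: a' b')
  qed
  then show ?thesis by simp
qed

text \<open>Inside the term of a permutation p, raising the exponent of the variable x j by k means
  raising the entry of b at index p j; summing over all j removes the dependence on p.\<close>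

lemma alternant_mult_power_sum:
  "(\<Sum>l<n. x l ^ k) * alternant n b x = (\<Sum>i<n. alternant n (b(i := b i + k)) x)"
proof -
  have "(\<Sum>i<n. alternant n (b(i := b i + k)) x) =
     (\<Sum>p | p permutes {..<n}. \<Sum>i<n. of_int (sign p) * (\<Prod>l<n. x l ^ (b(i := b i + k)) (p l)))"
    unfolding alternant_sum by (rule sum.swap)
  also have "\<dots> = (\<Sum>p | p permutes {..<n}. (\<Sum>l<n. x l ^ k) * (of_int (sign p) * (\<Prod>l<n. x l ^ b (p l))))"
  proof (intro sum.cong refl)
    fix p assume "p \<in> {p. p permutes {..<n}}"
    then have p: "p permutes {..<n}" by simp
    have "(\<Sum>i<n. of_int (sign p) * (\<Prod>l<n. x l ^ (b(i := b i + k)) (p l)))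
        = (\<Sum>j<n. of_int (sign p) * (\<Prod>l<n. x l ^ (b(p j := b (p j) + k)) (p l)))"
      by (rule trans[OF sum.permute[OF p]]) (simp only: o_def)
    also have "\<dots> = (\<Sum>j<n. x j ^ k * (of_int (sign p) * (\<Prod>l<n. x l ^ b (p l))))"
    proof (intro sum.cong refl)
      fix j assume j: "j \<in> {..<n}"
      have "(\<Prod>l<n. x l ^ (b(p j := b (p j) + k)) (p l)) = (\<Prod>l<n. (if l = j then x j ^ k else 1) * x l ^ b (p l))"
      proof (intro prod.cong refl)
        fix l
        show "x l ^ (b(p j := b (p j) + k)) (p l) = (if l = j then x j ^ k else 1) * x l ^ b (p l)"
          by (cases "l = j") (simp_all add: power_add inj_eq[OF permutes_inj[OF p]])
      qed
      also have "\<dots> = x j ^ k * (\<Prod>l<n. x l ^ b (p l))"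
        using j by (simp add: prod.distrib)
      finally show "of_int (sign p) * (\<Prod>l<n. x l ^ (b(p j := b (p j) + k)) (p l)) =
          x j ^ k * (of_int (sign p) * (\<Prod>l<n. x l ^ b (p l)))" by simp
    qed
    also have "\<dots> = (\<Sum>l<n. x l ^ k) * (of_int (sign p) * (\<Prod>l<n. x l ^ b (p l)))"
      by (rule sum_distrib_right[symmetric])
    finally show "(\<Sum>i<n. of_int (sign p) * (\<Prod>l<n. x l ^ (b(i := b i + k)) (p l))) =
       (\<Sum>l<n. x l ^ k) * (of_int (sign p) * (\<Prod>l<n. x l ^ b (p l)))" .
  qed
  also have "\<dots> = (\<Sum>l<n. x l ^ k) * alternant n b x"
    unfolding alternant_sum sum_distrib_left ..
  finally show ?thesis by (rule sym)
qed

text \<open>The shape to which an alternant straightens; irrelevant if \<open>b\<close> is not injective.\<close>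

definition straight :: "nat \<Rightarrow> (nat \<Rightarrow> nat) \<Rightarrow> nat \<Rightarrow> nat" where
  "straight n b = of_beads n (b ` {..<n})"

definition straight_sign :: "nat \<Rightarrow> (nat \<Rightarrow> nat) \<Rightarrow> complex" where
  "straight_sign n b = (if inj_on b {..<n} then
     of_int (sign (SOME p. p permutes {..<n} \<and> (\<forall>i<n. b i = bead_enum (Suc 0) (b ` {..<n}) (p i)))) else 0)"

lemma alternant_permute_index:
  assumes "p permutes {..<n}" shows "alternant n (b \<circ> p) x = of_int (sign p) * alternant n b x"
  unfolding alternant_def o_def by (rule leibniz_det_permute_cols[OF assms, where f = "\<lambda>l i. x l ^ b i"])

lemma alternant_permute_variables:
  assumes "p permutes {..<n}" shows "alternant n b (x \<circ> p) = of_int (sign p) * alternant n b x"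
  unfolding alternant_def o_def by (rule leibniz_det_permute_rows[OF assms, where f = "\<lambda>l i. x l ^ b i"])

lemma sorting_permutation:
  assumes "inj_on b {..<n}"
  shows "\<exists>p. p permutes {..<n} \<and> (\<forall>i<n. b i = bead_enum (Suc 0) (b ` {..<n}) (p i))"
proof -
  have "bij_betw (bead_enum (Suc 0) (b ` {..<n})) {..<n} (b ` {..<n})"
    using bead_enum_bij[of "b ` {..<n}" "Suc 0"] card_image[OF assms] by simp
  then show ?thesis by (rule ex_permutation_between_enumerations[OF inj_on_imp_bij_betw[OF assms]])
qed

lemma
  assumes "inj_on b {..<n}"
  shows is_partition_straight: "is_partition (straight n b)"
    and psize_straight: "psize (straight n b) + (\<Sum>i<n. n - 1 - i) = (\<Sum>i<n. b i)"
    and straight_bead_enum: "i < n \<Longrightarrow> straight n b i + (n - 1 - i) = bead_enum (Suc 0) (b ` {..<n}) i"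
proof -
  have C: "finite (b ` {..<n})" "card (b ` {..<n}) = n" using card_image[OF assms] by auto
  show 1: "is_partition (straight n b)"
    unfolding straight_def by (rule is_partition_of_beads[OF C])
  have 2: "plength (straight n b) \<le> n"
    unfolding straight_def by (rule plength_of_beads[OF C])
  show "psize (straight n b) + (\<Sum>i<n. n - 1 - i) = (\<Sum>i<n. b i)"
    unfolding sum_beads[OF 1 2, symmetric] unfolding straight_def beads_of_beads[OF C]
    by (rule trans[OF sum.reindex[OF assms]]) (simp only: o_def)
  show "i < n \<Longrightarrow> straight n b i + (n - 1 - i) = bead_enum (Suc 0) (b ` {..<n}) i"
    unfolding straight_def by (rule of_beads_add[OF C])
qed

lemma alternant_straight: "alternant n b x = straight_sign n b * alternant n (\<lambda>i. straight n b i + (n - 1 - i)) x"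
proof (cases "inj_on b {..<n}")
  case True
  define p where "p = (SOME p. p permutes {..<n} \<and> (\<forall>i<n. b i = bead_enum (Suc 0) (b ` {..<n}) (p i)))"
  have p: "p permutes {..<n}" "\<And>i. i < n \<Longrightarrow> b i = bead_enum (Suc 0) (b ` {..<n}) (p i)"
    using someI_ex[OF sorting_permutation[OF True]] unfolding p_def by blast+
  have "alternant n b x = alternant n ((\<lambda>i. straight n b i + (n - 1 - i)) \<circ> p) x"
  proof (rule alternant_cong)
    fix i assume i: "i < n"
    show "b i = ((\<lambda>i. straight n b i + (n - 1 - i)) \<circ> p) i"
      unfolding o_def straight_bead_enum[OF True permutes_lessThan_less[OF p(1) i]] by (rule p(2)[OF i])
  qed
  also have "\<dots> = of_int (sign p) * alternant n (\<lambda>i. straight n b i + (n - 1 - i)) x"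
    by (rule alternant_permute_index[OF p(1)])
  finally show ?thesis using True by (simp add: straight_sign_def p_def)
next
  case False
  then obtain i j where ij: "i < n" "j < n" "i \<noteq> j" "b i = b j" by (auto simp: inj_on_def)
  have "leibniz_det n (\<lambda>i l. x l ^ b i) = 0"
    by (rule leibniz_det_identical_rows[OF ij(3,1,2)]) (simp add: ij(4))
  then have "alternant n b x = 0" unfolding alternant_def using leibniz_det_transpose[of n "\<lambda>i l. x l ^ b i"] by simp
  then show ?thesis using False by (simp add: straight_sign_def)
qed

text \<open>A Schur expansion multiplied by the Vandermonde determinant. In this form no division
  occurs, and multiplication by power sums just changes exponents.\<close>

definition schur_span :: "nat \<Rightarrow> nat \<Rightarrow> ((nat \<Rightarrow> complex) \<Rightarrow> complex) \<Rightarrow> bool" where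
  "schur_span n d f \<longleftrightarrow> (\<exists>c. \<forall>x. f x = (\<Sum>g\<in>partitions_of d. c g * alternant n (\<lambda>i. g i + (n - 1 - i)) x))"

lemma schur_span_zero: "schur_span n d (\<lambda>x. 0)"
  unfolding schur_span_def by (rule exI[of _ "\<lambda>_. 0"]) simp

lemma schur_span_cmult:
  assumes "schur_span n d f" shows "schur_span n d (\<lambda>x. a * f x)"
proof -
  obtain c where c: "\<And>x. f x = (\<Sum>g\<in>partitions_of d. c g * alternant n (\<lambda>i. g i + (n - 1 - i)) x)"
    using assms by (auto simp: schur_span_def)
  show ?thesis unfolding schur_span_def
    by (rule exI[of _ "\<lambda>g. a * c g"]) (simp only: c sum_distrib_left mult.assoc simp_thms)
qed

lemma schur_span_add:
  assumes "schur_span n d f" "schur_span n d g" shows "schur_span n d (\<lambda>x. f x + g x)"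
proof -
  obtain c where c: "\<And>x. f x = (\<Sum>g\<in>partitions_of d. c g * alternant n (\<lambda>i. g i + (n - 1 - i)) x)"
    using assms(1) by (auto simp: schur_span_def)
  obtain c' where c': "\<And>x. g x = (\<Sum>g\<in>partitions_of d. c' g * alternant n (\<lambda>i. g i + (n - 1 - i)) x)"
    using assms(2) by (auto simp: schur_span_def)
  show ?thesis unfolding schur_span_def
    by (rule exI[of _ "\<lambda>g. c g + c' g"]) (simp only: c c' sum.distrib distrib_right simp_thms)
qed

lemma schur_span_sum:
  assumes "\<And>i. i \<in> I \<Longrightarrow> schur_span n d (f i)" shows "schur_span n d (\<lambda>x. \<Sum>i\<in>I. f i x)"
  using assms
proof (induction I rule: infinite_finite_induct)
  case (insert i I)
  then show ?case using schur_span_add[of n d "f i" "\<lambda>x. \<Sum>i\<in>I. f i x"] by simp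
qed (simp_all add: schur_span_zero)

lemma schur_span_alternant:
  assumes "(\<Sum>i<n. b i) = d + (\<Sum>i<n. n - 1 - i)"
  shows "schur_span n d (alternant n b)"
proof (cases "inj_on b {..<n}")
  case True
  let ?g = "straight n b"
  have g: "?g \<in> partitions_of d"
    unfolding partitions_of_def using is_partition_straight[OF True] psize_straight[OF True] assms by simp
  have "(\<Sum>h\<in>partitions_of d. (if h = ?g then straight_sign n b else 0) * alternant n (\<lambda>i. h i + (n - 1 - i)) x) = alternant n b x" for x
  proof -
    have "(\<Sum>h\<in>partitions_of d. (if h = ?g then straight_sign n b else 0) * alternant n (\<lambda>i. h i + (n - 1 - i)) x)
      = (\<Sum>h\<in>partitions_of d. if ?g = h then straight_sign n b * alternant n (\<lambda>i. h i + (n - 1 - i)) x else 0)"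
      by (rule sum.cong) auto
    also have "\<dots> = straight_sign n b * alternant n (\<lambda>i. ?g i + (n - 1 - i)) x"
      by (subst sum.delta'[OF finite_partitions_of]) (simp add: g)
    also have "\<dots> = alternant n b x" by (rule alternant_straight[symmetric])
    finally show ?thesis .
  qed
  note eq = this
  show ?thesis unfolding schur_span_def
    by (rule exI[of _ "\<lambda>h. if h = ?g then straight_sign n b else 0"], rule allI, rule eq[symmetric])
next
  case False
  then have "alternant n b = (\<lambda>x. 0)" by (intro ext) (subst alternant_straight, simp add: straight_sign_def)
  then show ?thesis by (simp only: schur_span_zero)
qed

text \<open>Each power sum adds its degree to one exponent at a time. The hypothesis tracks the
  total degree, which decides the size of the resulting shapes.\<close>

lemma schur_span_power_sums:
  fixes k n :: nat and b nu :: "nat \<Rightarrow> nat"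
  assumes "(\<Sum>i<n. b i) + (\<Sum>i<k. nu i) = d + (\<Sum>i<n. n - 1 - i)"
  shows "schur_span n d (\<lambda>x :: nat \<Rightarrow> complex. (\<Prod>i<k. \<Sum>l<n. x l ^ nu i) * alternant n b x)"
  using assms
proof (induction k arbitrary: b)
  case 0
  then show ?case using schur_span_alternant[where n = n and b = b and d = d] by simp
next
  case (Suc k)
  have eq: "(\<Prod>i<Suc k. \<Sum>l<n. x l ^ nu i) * alternant n b x =
      (\<Sum>j<n. (\<Prod>i<k. \<Sum>l<n. x l ^ nu i) * alternant n (b(j := b j + nu k)) x)" for x
    unfolding sum_distrib_left[symmetric] alternant_mult_power_sum[symmetric] by simp
  show ?case unfolding eq
  proof (rule schur_span_sum, rule Suc.IH)
    fix j assume j: "j \<in> {..<n}"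
    have "(\<Sum>i<n. (b(j := b j + nu k)) i) = (\<Sum>i<n. b i + (if i = j then nu k else 0))"
      by (rule sum.cong) auto
    also have "\<dots> = (\<Sum>i<n. b i) + nu k" using j by (simp add: sum.distrib)
    finally show "(\<Sum>i<n. (b(j := b j + nu k)) i) + (\<Sum>i<k. nu i) = d + (\<Sum>i<n. n - 1 - i)"
      using Suc.prems by simp
  qed
qed

lemma schur_span_skew_schur:
  assumes sk: "skew_partition lam mu"
  shows "schur_span n (skew_size lam mu) (\<lambda>x. skew_schur lam mu n x * alternant n (staircase n) x)"
proof -
  let ?d = "skew_size lam mu"
  have eq: "skew_schur lam mu n x * alternant n (staircase n) x = (\<Sum>nu\<in>partitions_of ?d.
     (of_int (skew_character lam mu nu) / of_nat (zee nu)) * (power_sum nu n x * alternant n (staircase n) x))" for x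
    unfolding skew_schur_eq_sum_character[OF sk] sum_distrib_right by (intro sum.cong refl) simp
  show ?thesis
    unfolding eq power_sum_def
  proof (rule schur_span_sum, rule schur_span_cmult, rule schur_span_power_sums)
    fix nu assume "nu \<in> partitions_of ?d"
    then show "(\<Sum>i<n. staircase n i) + (\<Sum>i<plength nu. nu i) = ?d + (\<Sum>i<n. n - 1 - i)"
      by (simp add: partitions_of_def psize_def staircase_def)
  qed
qed

text \<open>The bound d <= n ensures that no partition of d has more than n parts, so every
  alternant of the expansion is a Schur polynomial times the Vandermonde determinant, which cancels
  at distinct points.\<close>

lemma schur_span_imp_schur:
  assumes "schur_span n d (\<lambda>x. f x * alternant n (staircase n) x)" "d \<le> n"
  shows "\<exists>c. \<forall>x :: nat \<Rightarrow> complex. inj_on x {..<n} \<longrightarrow> f x = (\<Sum>g\<in>partitions_of d. c g * schur g n x)"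
proof -
  obtain c where c: "\<And>x. f x * alternant n (staircase n) x = (\<Sum>g\<in>partitions_of d. c g * alternant n (\<lambda>i. g i + (n - 1 - i)) x)"
    using assms(1) by (auto simp: schur_span_def)
  show ?thesis
  proof (intro exI allI impI)
    fix x :: "nat \<Rightarrow> complex" assume x: "inj_on x {..<n}"
    have "f x * alternant n (staircase n) x = (\<Sum>g\<in>partitions_of d. c g * schur g n x) * alternant n (staircase n) x"
      unfolding c sum_distrib_right
    proof (intro sum.cong refl)
      fix g assume g: "g \<in> partitions_of d"
      show "c g * alternant n (\<lambda>i. g i + (n - 1 - i)) x = c g * schur g n x * alternant n (staircase n) x"
        unfolding mult.assoc
        by (subst schur_bialternant) (use partitions_of_bounds(1,3)[OF g] assms(2) in auto)
    qed
    then show "f x = (\<Sum>g\<in>partitions_of d. c g * schur g n x)"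
      using alternant_staircase_nonzero[OF x] by simp
  qed
qed

section \<open>Changing the number of variables and reaching degenerate points\<close>

lemma skew_schur_append_zero:
  assumes sk: "skew_partition lam mu"
  shows "skew_schur lam mu (Suc n) (x(n := 0)) = skew_schur lam mu n x"
proof -
  have "Abs_fps (\<lambda>k. (0::complex) ^ k) = 1" by (rule fps_ext) (simp add: power_0_left)
  then have "complete_fps (Suc n) (x(n := 0)) = complete_fps n x" by (simp add: complete_fps_def)
  then show ?thesis by (simp only: Jacobi_Trudi[OF sk order_refl])
qed

lemma schur_append_zero: "is_partition g \<Longrightarrow> schur g (Suc n) (x(n := 0)) = schur g n x"
  unfolding schur_def by (rule skew_schur_append_zero[OF skew_partition_zero])

text \<open>A line through x in the direction (1, 2, 3, ...). Two coordinates agree for at most one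
  t, and a coordinate vanishes for one t only, so all small nonzero t give generic points.\<close>

definition perturb :: "(nat \<Rightarrow> complex) \<Rightarrow> complex \<Rightarrow> nat \<Rightarrow> complex" where
  "perturb x t i = x i + t * of_nat (Suc i)"

lemma tendsto_perturb: "((\<lambda>t. perturb x t i) \<longlongrightarrow> x i) (at 0)"
proof -
  have "((\<lambda>t. perturb x t i) \<longlongrightarrow> x i + 0 * of_nat (Suc i)) (at 0)"
    unfolding perturb_def by (rule tendsto_add[OF tendsto_const tendsto_mult[OF tendsto_ident_at tendsto_const]])
  then show ?thesis by simp
qed

lemma tendsto_skew_schur: "((\<lambda>t. skew_schur lam mu n (perturb x t)) \<longlongrightarrow> skew_schur lam mu n x) (at 0)"
  unfolding skew_schur_def by (rule tendsto_sum, rule tendsto_prod, rule tendsto_perturb)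

lemma tendsto_sum_schur:
  "((\<lambda>t. \<Sum>g\<in>G. c g * schur g n (perturb x t)) \<longlongrightarrow> (\<Sum>g\<in>G. c g * schur g n x)) (at 0)"
  unfolding schur_def by (rule tendsto_sum, rule tendsto_mult_left, rule tendsto_skew_schur)

lemma eventually_generic_perturb: "\<forall>\<^sub>F t in at 0. generic n (perturb x t)"
proof -
  have *: "\<forall>\<^sub>F t in at 0. a + t * b \<noteq> 0" if "b \<noteq> 0" for a b :: complex
  proof (rule eventually_mono)
    show "\<forall>\<^sub>F t in at 0. t \<noteq> - a / b" by (rule eventually_neq_at_within)
    fix t assume "t \<noteq> - a / b"
    then show "a + t * b \<noteq> 0" using that by (auto simp: field_simps add_eq_0_iff)
  qed
  have "\<forall>\<^sub>F t in at 0. \<forall>i\<in>{..<n}. perturb x t i \<noteq> 0"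
    unfolding perturb_def by (intro eventually_ball_finite ballI *) (simp_all del: of_nat_Suc)
  moreover have "\<forall>\<^sub>F t in at 0. \<forall>i\<in>{..<n}. \<forall>j\<in>{..<n}. i \<noteq> j \<longrightarrow> perturb x t i \<noteq> perturb x t j"
  proof (intro eventually_ball_finite ballI finite_lessThan)
    fix i j :: nat
    show "\<forall>\<^sub>F t in at 0. i \<noteq> j \<longrightarrow> perturb x t i \<noteq> perturb x t j"
    proof (cases "i = j")
      case False
      then have "of_nat (Suc i) - of_nat (Suc j) \<noteq> (0::complex)" by simp
      from *[OF this, of "x i - x j"] show ?thesis
        by (rule eventually_mono) (auto simp: perturb_def algebra_simps)
    qed simp
  qed
  ultimately show ?thesis
    by (rule eventually_elim2) (auto simp: generic_def inj_on_def)
qed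

lemma eq_if_eq_on_generic:
  assumes "((\<lambda>t. f (perturb x t)) \<longlongrightarrow> f x) (at 0)" "((\<lambda>t. g (perturb x t)) \<longlongrightarrow> g x) (at 0)"
    and "\<And>y. generic n y \<Longrightarrow> f y = (g y :: complex)"
  shows "f x = g x"
proof -
  have "\<forall>\<^sub>F t in at 0. f (perturb x t) = g (perturb x t)"
    by (rule eventually_mono[OF eventually_generic_perturb[of n x]]) (rule assms(3))
  then have "((\<lambda>t. g (perturb x t)) \<longlongrightarrow> f x) (at 0)"
    using assms(1) by (rule tendsto_cong[THEN iffD1])
  then show ?thesis using assms(2) by (rule tendsto_unique[OF at_neq_bot])
qed

text \<open>An expansion in Schur polynomials that exists in \<open>n\<close> variables for every large \<open>n\<close> has
  coefficients independent of \<open>n\<close>, provided that setting the last variable to zero is harmless.\<close>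

lemma schur_expansion_stable:
  assumes zero: "\<And>n x. generic n x \<Longrightarrow> f (Suc n) (x(n := 0)) = f n x"
    and expand: "\<And>n. d \<le> n \<Longrightarrow> \<exists>c. \<forall>x. inj_on x {..<n} \<longrightarrow> f n x = (\<Sum>g\<in>partitions_of d. c g * schur g n x)"
    and cont: "\<And>n x. inj_on x {..<n} \<Longrightarrow> ((\<lambda>t. f n (perturb x t)) \<longlongrightarrow> f n x) (at 0)"
    and c: "\<And>x. inj_on x {..<d} \<Longrightarrow> f d x = (\<Sum>g\<in>partitions_of d. c g * schur g d x)"
    and x: "inj_on x {..<n}"
  shows "f n x = (\<Sum>g\<in>partitions_of d. c g * schur g n x)"
proof -
  have inj0: "inj_on (x(n := 0)) {..<Suc n}" if "generic n x" for n and x :: "nat \<Rightarrow> complex"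
    using that by (auto simp: generic_def inj_on_def less_Suc_eq)
  have sz: "(\<Sum>g\<in>partitions_of d. c g * schur g (Suc n) (x(n := 0))) = (\<Sum>g\<in>partitions_of d. c g * schur g n x)" for c n x
    by (intro sum.cong refl) (simp add: schur_append_zero partitions_of_bounds(1))
  \<comment> \<open>Upwards: an expansion in n + 1 variables restricts to n variables when the last
    one is zero, and linear independence identifies its coefficients with c. The bound d <= n keeps
    all shapes within the admissible length.\<close>
  have up: "f n x = (\<Sum>g\<in>partitions_of d. c g * schur g n x)" if "d \<le> n" "inj_on x {..<n}" for n x
    using that
  proof (induction n arbitrary: x rule: dec_induct)
    case base
    then show ?case by (rule c)
  next
    case (step n)
    obtain c' where c': "\<And>x. inj_on x {..<Suc n} \<Longrightarrow> f (Suc n) x = (\<Sum>g\<in>partitions_of d. c' g * schur g (Suc n) x)"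
      using expand[of "Suc n"] step by auto
    have "c' g - c g = 0" if g: "g \<in> partitions_of d" for g
    proof (rule schur_independent[OF finite_partitions_of _ _ g])
      fix y assume y: "generic n y"
      have "inj_on y {..<n}" using y by (simp add: generic_def)
      then have "f n y = (\<Sum>g\<in>partitions_of d. c g * schur g n y)" by (rule step.IH)
      moreover have "f n y = (\<Sum>g\<in>partitions_of d. c' g * schur g n y)"
        unfolding zero[OF y, symmetric] c'[OF inj0[OF y]] by (rule sz)
      ultimately show "(\<Sum>g\<in>partitions_of d. (c' g - c g) * schur g n y) = 0"
        by (simp add: left_diff_distrib sum_subtractf)
    next
      fix h assume "h \<in> partitions_of d"
      then show "is_partition h \<and> plength h \<le> n" using partitions_of_bounds(1,3)[of h d] step by auto
    qed
    then show ?case using c'[OF step.prems] by simp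
  qed
  show ?thesis
  proof (cases "d \<le> n")
    case True
    then show ?thesis using up x by blast
  next
    case False
    \<comment> \<open>Downwards: the values at generic points come from n + 1 variables with the
      last one zero, and a limit reaches the other points with distinct coordinates.\<close>
    then have "n \<le> d" by simp
    then show ?thesis using x
    proof (induction n arbitrary: x rule: inc_induct)
      case base
      then show ?case by (rule c)
    next
      case (step n)
      have "f n y = (\<Sum>g\<in>partitions_of d. c g * schur g n y)" if "generic n y" for y
        using step.IH[OF inj0[OF that]] unfolding zero[OF that] sz .
      then show ?case
        by (rule eq_if_eq_on_generic[OF cont[OF step.prems] tendsto_sum_schur])
    qed
  qed
qed

theorem skew_schur_expansion:
  assumes sk: "skew_partition lam mu"
  shows "\<exists>c. \<forall>n x. skew_schur lam mu n x = (\<Sum>g\<in>partitions_of (skew_size lam mu). c g * schur g n x)"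
proof -
  let ?d = "skew_size lam mu"
  have ex: "\<exists>c. \<forall>x. inj_on x {..<n} \<longrightarrow> skew_schur lam mu n x = (\<Sum>g\<in>partitions_of ?d. c g * schur g n x)" if "?d \<le> n" for n
    by (rule schur_span_imp_schur[OF schur_span_skew_schur[OF sk] that])
  obtain c where c: "\<And>x. inj_on x {..<?d} \<Longrightarrow> skew_schur lam mu ?d x = (\<Sum>g\<in>partitions_of ?d. c g * schur g ?d x)"
    using ex[of ?d] by auto
  show ?thesis
  proof (intro exI allI)
    fix n x
    have "skew_schur lam mu n y = (\<Sum>g\<in>partitions_of ?d. c g * schur g n y)" if "generic n y" for y
    proof (rule schur_expansion_stable[of "skew_schur lam mu" ?d])
      show "inj_on y {..<n}" using that by (simp add: generic_def)
    qed (rule skew_schur_append_zero[OF sk] tendsto_skew_schur ex c; assumption)+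
    then show "skew_schur lam mu n x = (\<Sum>g\<in>partitions_of ?d. c g * schur g n x)"
      by (rule eq_if_eq_on_generic[OF tendsto_skew_schur tendsto_sum_schur])
  qed
qed

text \<open>Two finite expansions are compared in n variables, where n is the largest length that
  occurs, so \<open>schur_independent\<close> applies. This pins down the choice in
  \<open>schur_coeff\<close>.\<close>

theorem schur_coeff_eqI:
  assumes fin: "finite {g. c g \<noteq> 0}" and part: "\<And>g. c g \<noteq> 0 \<Longrightarrow> is_partition g"
    and f: "\<And>n x. f n x = (\<Sum>g | c g \<noteq> 0. c g * schur g n x)"
  shows "schur_coeff f = c"
proof -
  define P where "P c \<longleftrightarrow> finite {g. c g \<noteq> 0} \<and> {g. c g \<noteq> 0} \<subseteq> Collect is_partition \<and>
     (\<forall>n x. f n x = (\<Sum>g | c g \<noteq> 0. c g * schur g n x))" for c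
  have "P c" using assms by (auto simp: P_def)
  moreover have "c' = c" if "P c'" for c'
  proof
    fix g
    let ?S = "{g. c g \<noteq> 0} \<union> {g. c' g \<noteq> 0}"
    have S: "finite ?S" "\<And>g. g \<in> ?S \<Longrightarrow> is_partition g" using \<open>P c\<close> that by (auto simp: P_def)
    define n where "n = Max (plength ` ?S)"
    have f': "f n x = (\<Sum>g\<in>?S. e g * schur g n x)" if "P e" "{g. e g \<noteq> 0} \<subseteq> ?S" for e x
    proof -
      have "f n x = (\<Sum>g | e g \<noteq> 0. e g * schur g n x)" using that by (simp add: P_def)
      also have "\<dots> = (\<Sum>g\<in>?S. e g * schur g n x)"
        by (rule sum.mono_neutral_left) (use S(1) that in auto)
      finally show ?thesis .
    qed
    show "c' g = c g"
    proof (cases "g \<in> ?S")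
      case True
      have "c' g - c g = 0"
      proof (rule schur_independent[OF S(1) _ _ True, of n "\<lambda>g. c' g - c g"])
        fix x
        have "(\<Sum>g\<in>?S. c' g * schur g n x) = (\<Sum>g\<in>?S. c g * schur g n x)"
          using f'[OF that, of x] f'[OF \<open>P c\<close>, of x] by auto
        then show "(\<Sum>g\<in>?S. (c' g - c g) * schur g n x) = 0"
          by (simp add: left_diff_distrib sum_subtractf)
      next
        fix h assume h: "h \<in> ?S"
        then have "plength h \<le> n" unfolding n_def using S(1) by (intro Max_ge finite_imageI imageI)
        then show "is_partition h \<and> plength h \<le> n" using S(2)[OF h] by simp
      qed
      then show ?thesis by simp
    qed simp
  qed
  ultimately show ?thesis unfolding schur_coeff_def P_def[symmetric] by (rule some_equality)
qed


section \<open>Hall--Littlewood polynomials\<close>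

definition desc_pairs :: "nat \<Rightarrow> (nat \<Rightarrow> nat) \<Rightarrow> (nat \<times> nat) set" where
  "desc_pairs n a = {(i, j). i < n \<and> j < n \<and> a i > a j}"

lemma finite_desc_pairs [simp]: "finite (desc_pairs n a)"
  by (rule finite_subset[of _ "{..<n} \<times> {..<n}"]) (auto simp: desc_pairs_def)

lemma sign_permutes_comp:
  "p permutes {..<n} \<Longrightarrow> q permutes {..<n} \<Longrightarrow> sign (p \<circ> q) = sign p * sign (q :: nat \<Rightarrow> nat)"
  by (rule sign_compose; rule permutes_imp_permutation[OF finite_lessThan])

lemma prod_desc_pairs_permute:
  assumes w: "w permutes {..<n}"
  shows "(\<Prod>(i, j)\<in>desc_pairs n (nu \<circ> w). g (w i) (w j)) = (\<Prod>(i, j)\<in>desc_pairs n nu. g i j)"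
proof (rule prod.reindex_bij_witness[of _ "\<lambda>(i, j). (inv_into UNIV w i, inv_into UNIV w j)" "\<lambda>(i, j). (w i, w j)"])
  fix a assume "a \<in> desc_pairs n (nu \<circ> w)"
  then show "(case case a of (i, j) \<Rightarrow> (w i, w j) of (i, j) \<Rightarrow> (inv_into UNIV w i, inv_into UNIV w j)) = a"
    "(case a of (i, j) \<Rightarrow> (w i, w j)) \<in> desc_pairs n nu"
    "(case case a of (i, j) \<Rightarrow> (w i, w j) of (i, j) \<Rightarrow> g i j) = (case a of (i, j) \<Rightarrow> g (w i) (w j))"
    by (auto simp: desc_pairs_def permutes_inverses[OF w] permutes_lessThan_less[OF w])
next
  have iw: "inv_into UNIV w permutes {..<n}" by (rule permutes_inv[OF w])
  fix b assume "b \<in> desc_pairs n nu"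
  then show "(case case b of (i, j) \<Rightarrow> (inv_into UNIV w i, inv_into UNIV w j) of (i, j) \<Rightarrow> (w i, w j)) = b"
    "(case b of (i, j) \<Rightarrow> (inv_into UNIV w i, inv_into UNIV w j)) \<in> desc_pairs n (nu \<circ> w)"
    by (auto simp: desc_pairs_def permutes_inverses[OF w] permutes_lessThan_less[OF iw])
qed

text \<open>The permutations producing one rearrangement form a coset of the stabiliser; this links
  the sum over rearrangements in \<open>hall_littlewood_P\<close> with a sum over the whole
  symmetric group.\<close>

lemma rearrangement_fibre:
  assumes w0: "w0 permutes {..<n}"
  shows "bij_betw (\<lambda>u. u \<circ> w0) (stab n nu) {w \<in> {w. w permutes {..<n}}. nu \<circ> w = nu \<circ> w0}"
proof (rule bij_betwI[where g = "\<lambda>w. w \<circ> inv_into UNIV w0"])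
  have iw: "inv_into UNIV w0 permutes {..<n}" by (rule permutes_inv[OF w0])
  show "(\<lambda>u. u \<circ> w0) \<in> stab n nu \<rightarrow> {w \<in> {w. w permutes {..<n}}. nu \<circ> w = nu \<circ> w0}"
  proof
    fix u assume u: "u \<in> stab n nu"
    then have "u permutes {..<n}" by (simp add: stab_def)
    then have "u \<circ> w0 permutes {..<n}" by (rule permutes_compose[OF w0])
    moreover have "nu (u i) = nu i" for i
      using u by (cases "i < n") (auto simp: stab_def permutes_def)
    ultimately show "u \<circ> w0 \<in> {w \<in> {w. w permutes {..<n}}. nu \<circ> w = nu \<circ> w0}" by (simp add: fun_eq_iff)
  qed
  show "(\<lambda>w. w \<circ> inv_into UNIV w0) \<in> {w \<in> {w. w permutes {..<n}}. nu \<circ> w = nu \<circ> w0} \<rightarrow> stab n nu"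
  proof
    fix w assume w: "w \<in> {w \<in> {w. w permutes {..<n}}. nu \<circ> w = nu \<circ> w0}"
    then have "w \<circ> inv_into UNIV w0 permutes {..<n}" by (auto intro: permutes_compose[OF iw])
    moreover have "nu (w (inv_into UNIV w0 i)) = nu i" for i
    proof -
      have "nu \<circ> w = nu \<circ> w0" using w by blast
      then have "(nu \<circ> w) (inv_into UNIV w0 i) = (nu \<circ> w0) (inv_into UNIV w0 i)" by (rule fun_cong)
      then show ?thesis by (simp only: o_apply permutes_inverses[OF w0])
    qed
    ultimately show "w \<circ> inv_into UNIV w0 \<in> stab n nu" by (simp add: stab_def)
  qed
qed (simp_all add: fun_eq_iff permutes_inverses[OF w0])

lemma finite_rearrangements: "finite (rearrangements n nu)"
proof -
  have "rearrangements n nu = (\<lambda>w. nu \<circ> w) ` {w. w permutes {..<n}}"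
    unfolding rearrangements_def by blast
  then show ?thesis by (simp add: finite_permutations)
qed

lemma hall_littlewood_P_desc_pairs:
  "plength nu \<le> n \<Longrightarrow> hall_littlewood_P nu q n x = (\<Sum>a\<in>rearrangements n nu.
     (\<Prod>i<n. x i ^ a i) * (\<Prod>(i, j)\<in>desc_pairs n a. (x i - q * x j) / (x i - x j)))"
  by (simp add: hall_littlewood_P_def desc_pairs_def)

text \<open>Multiplied by the Vandermonde determinant, the sum over rearrangements becomes an alternating sum over
  the whole symmetric group, because the block Vandermonde determinant absorbs the stabiliser.\<close>

lemma alternant_mult_hall_littlewood:
  assumes nu: "is_partition nu" "plength nu \<le> n" and x: "inj_on x {..<n}"
  shows "alternant n (staircase n) x * hall_littlewood_P nu q n x = (\<Sum>w | w permutes {..<n}.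
     of_int (sign w) * (\<Prod>l<n. x l ^ (nu (w l) + block_stair n nu (w l))) *
     (\<Prod>(l, m)\<in>desc_pairs n (nu \<circ> w). x l - q * x m))"
proof -
  let ?bs = "block_stair n nu"
  let ?P = "{w. w permutes {..<n}}"
  let ?h = "\<lambda>w. of_int (sign w) * (\<Prod>l<n. x l ^ (nu (w l) + ?bs (w l))) * (\<Prod>(l, m)\<in>desc_pairs n (nu \<circ> w). x l - q * x m)"
  have "sum ?h ?P = (\<Sum>a\<in>rearrangements n nu. sum ?h {w \<in> ?P. nu \<circ> w = a})"
    by (rule sum.group[symmetric]) (auto simp: finite_permutations finite_rearrangements rearrangements_def)
  also have "\<dots> = (\<Sum>a\<in>rearrangements n nu. alternant n (staircase n) x *
     ((\<Prod>i<n. x i ^ a i) * (\<Prod>(i, j)\<in>desc_pairs n a. (x i - q * x j) / (x i - x j))))"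
  proof (intro sum.cong refl)
    fix a assume "a \<in> rearrangements n nu"
    then obtain w0 where w0: "w0 permutes {..<n}" and a: "a = nu \<circ> w0" by (auto simp: rearrangements_def)
    \<comment> \<open>In the variables y the rearrangement becomes nu itself, so the block
      Vandermonde factorisation applies; the sign of \<open>w0\<close> accounts for the
      relabelling.\<close>
    define y where "y = x \<circ> inv_into UNIV w0"
    have iw: "inv_into UNIV w0 permutes {..<n}" by (rule permutes_inv[OF w0])
    have yw: "y (w0 l) = x l" for l by (simp add: y_def permutes_inverses[OF w0])
    let ?Q = "\<Prod>(l, m)\<in>desc_pairs n a. x l - q * x m"
    let ?R = "\<Prod>(l, m)\<in>desc_pairs n a. x l - x m"
    have "x i - x j \<noteq> 0" if "(i, j) \<in> desc_pairs n a" for i j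
      using that inj_onD[OF x, of i j] by (auto simp: desc_pairs_def)
    then have R0: "?R \<noteq> 0" by (auto simp: prod_zero_iff)
    have "(\<Prod>l<n. \<Prod>j\<in>{j. j < n \<and> nu j < nu l}. y l - y j) = (\<Prod>(l, j)\<in>(SIGMA l:{..<n}. {j. j < n \<and> nu j < nu l}). y l - y j)"
      by (rule prod.Sigma) auto
    also have "(SIGMA l:{..<n}. {j. j < n \<and> nu j < nu l}) = desc_pairs n nu" by (auto simp: desc_pairs_def)
    also have "(\<Prod>(l, j)\<in>desc_pairs n nu. y l - y j) = ?R"
      using prod_desc_pairs_permute[OF w0, where nu = nu and g = "\<lambda>i j. y i - y j"] by (simp only: yw a)
    finally have blockV: "alternant n (staircase n) y = block_alternant n nu y * ?R"
      using block_Vandermonde[of nu n y] nu(1) by (simp add: is_partition_def)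
    have "alternant n (staircase n) y = of_int (sign (inv_into UNIV w0)) * alternant n (staircase n) x"
      unfolding y_def by (rule alternant_permute_variables[OF iw])
    also have "sign (inv_into UNIV w0) = sign w0" by (rule sign_inverse[OF permutes_imp_permutation[OF finite_lessThan w0]])
    finally have "of_int (sign w0) * (of_int (sign w0) * alternant n (staircase n) x) = of_int (sign w0) * (block_alternant n nu y * ?R)"
      using blockV by simp
    moreover have "of_int (sign w0) * (of_int (sign w0) :: complex) = 1"
      by (simp flip: of_int_mult)
    ultimately have V: "alternant n (staircase n) x = of_int (sign w0) * block_alternant n nu y * ?R"
      by (simp only: mult.assoc[symmetric] mult_1)
    have "sum ?h {w \<in> ?P. nu \<circ> w = a} = (\<Sum>u\<in>stab n nu. ?h (u \<circ> w0))"
      unfolding a by (rule sum.reindex_bij_betw[OF rearrangement_fibre[OF w0], symmetric])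
    also have "\<dots> = (\<Sum>u\<in>stab n nu. (\<Prod>l<n. x l ^ a l) * ?Q * (of_int (sign w0) * (of_int (sign u) * (\<Prod>l<n. y l ^ ?bs (u l)))))"
    proof (intro sum.cong refl)
      fix u assume u: "u \<in> stab n nu"
      then have up: "u permutes {..<n}" by (simp add: stab_def)
      have nuu: "nu (u i) = nu i" for i using u by (cases "i < n") (auto simp: stab_def permutes_def)
      have "(\<Prod>l<n. y l ^ ?bs (u l)) = (\<Prod>l<n. y (w0 l) ^ ?bs (u (w0 l)))"
        by (rule trans[OF prod.permute[OF w0]]) (simp only: o_def)
      also have "\<dots> = (\<Prod>l<n. x l ^ ?bs (u (w0 l)))" by (simp only: yw)
      finally have y: "(\<Prod>l<n. y l ^ ?bs (u l)) = (\<Prod>l<n. x l ^ ?bs (u (w0 l)))" .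
      have "nu \<circ> (u \<circ> w0) = a" by (simp add: a fun_eq_iff nuu)
      then show "?h (u \<circ> w0) = (\<Prod>l<n. x l ^ a l) * ?Q * (of_int (sign w0) * (of_int (sign u) * (\<Prod>l<n. y l ^ ?bs (u l))))"
        by (simp add: sign_permutes_comp[OF up w0] y power_add prod.distrib nuu a)
    qed
    also have "\<dots> = (\<Prod>l<n. x l ^ a l) * ?Q * (of_int (sign w0) * block_alternant n nu y)"
      unfolding block_alternant_def sum_distrib_left ..
    also have "\<dots> = (\<Prod>l<n. x l ^ a l) * (?Q / ?R) * (of_int (sign w0) * block_alternant n nu y * ?R)"
      using R0 by simp
    also have "?Q / ?R = (\<Prod>(i, j)\<in>desc_pairs n a. (x i - q * x j) / (x i - x j))"
      by (simp add: prod_dividef[symmetric] case_prod_unfold)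
    finally show "sum ?h {w \<in> ?P. nu \<circ> w = a} = alternant n (staircase n) x *
     ((\<Prod>i<n. x i ^ a i) * (\<Prod>(i, j)\<in>desc_pairs n a. (x i - q * x j) / (x i - x j)))"
      unfolding V[symmetric] by (simp only: mult.commute mult.left_commute)
  qed
  finally show ?thesis
    unfolding hall_littlewood_P_desc_pairs[OF nu(2)] sum_distrib_left by (rule sym)
qed

text \<open>The exponents obtained when the product of y i - q y j over all descent pairs is
  expanded: S collects the pairs from which - q y j is taken, the other pairs contribute y
  i.\<close>

definition raise :: "nat \<Rightarrow> (nat \<Rightarrow> nat) \<Rightarrow> (nat \<times> nat) set \<Rightarrow> nat \<Rightarrow> nat" where
  "raise n nu S i = nu i + block_stair n nu i + card {j. (i, j) \<in> desc_pairs n nu - S} + card {j. (j, i) \<in> S}"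

lemma prod_fst_power:
  fixes y :: "nat \<Rightarrow> 'a :: comm_monoid_mult"
  assumes "T \<subseteq> {..<n} \<times> {..<n}"
  shows "(\<Prod>(i, j)\<in>T. y i) = (\<Prod>i<n. y i ^ card {j. (i, j) \<in> T})"
proof -
  have fin: "finite {j. (i, j) \<in> T}" for i by (rule finite_subset[of _ "{..<n}"]) (use assms in auto)
  have "T = (SIGMA i:{..<n}. {j. (i, j) \<in> T})" using assms by auto
  then have "(\<Prod>(i, j)\<in>T. y i) = (\<Prod>(i, j)\<in>(SIGMA i:{..<n}. {j. (i, j) \<in> T}). y i)" by (rule arg_cong)
  also have "\<dots> = (\<Prod>i<n. \<Prod>j\<in>{j. (i, j) \<in> T}. y i)" by (rule prod.Sigma[symmetric]) (use fin in auto)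
  finally show ?thesis by simp
qed

lemma prod_snd_power:
  fixes y :: "nat \<Rightarrow> 'a :: comm_monoid_mult"
  assumes "T \<subseteq> {..<n} \<times> {..<n}"
  shows "(\<Prod>(i, j)\<in>T. y j) = (\<Prod>i<n. y i ^ card {j. (j, i) \<in> T})"
proof -
  have "(\<Prod>(i, j)\<in>T. y j) = (\<Prod>(i, j)\<in>prod.swap ` T. y i)"
    by (subst prod.reindex) (auto simp: inj_on_def case_prod_unfold)
  also have "\<dots> = (\<Prod>i<n. y i ^ card {j. (i, j) \<in> prod.swap ` T})"
    by (rule prod_fst_power) (use assms in auto)
  also have "\<dots> = (\<Prod>i<n. y i ^ card {j. (j, i) \<in> T})"
    by (intro prod.cong refl arg_cong2[where f = "(^)"] arg_cong[where f = card]) force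
  finally show ?thesis .
qed

lemma desc_pairs_subset: "desc_pairs n nu \<subseteq> {..<n} \<times> {..<n}"
  by (auto simp: desc_pairs_def)

lemma alternant_mult_hall_littlewood_expand:
  assumes nu: "is_partition nu" "plength nu \<le> n" and x: "inj_on x {..<n}"
  shows "alternant n (staircase n) x * hall_littlewood_P nu q n x =
    (\<Sum>S\<in>Pow (desc_pairs n nu). (- q) ^ card S * alternant n (raise n nu S) x)"
proof -
  let ?D = "desc_pairs n nu"
  let ?bs = "block_stair n nu"
  have "of_int (sign w) * (\<Prod>l<n. x l ^ (nu (w l) + ?bs (w l))) * (\<Prod>(l, m)\<in>desc_pairs n (nu \<circ> w). x l - q * x m)
     = (\<Sum>S\<in>Pow ?D. (- q) ^ card S * (of_int (sign w) * (\<Prod>l<n. x l ^ raise n nu S (w l))))"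
    if w: "w permutes {..<n}" for w
  proof -
    define y where "y = x \<circ> inv_into UNIV w"
    have yw: "y (w l) = x l" for l by (simp add: y_def permutes_inverses[OF w])
    have "(\<Prod>(l, m)\<in>desc_pairs n (nu \<circ> w). x l - q * x m) = (\<Prod>(i, j)\<in>?D. y i - q * y j)"
      using prod_desc_pairs_permute[OF w, where nu = nu and g = "\<lambda>i j. y i - q * y j"] by (simp only: yw)
    also have "\<dots> = (\<Prod>p\<in>?D. - q * y (snd p) + y (fst p))"
      by (intro prod.cong) (auto simp: case_prod_unfold)
    also have "\<dots> = (\<Sum>S\<in>Pow ?D. (\<Prod>p\<in>S. - q * y (snd p)) * (\<Prod>p\<in>?D - S. y (fst p)))"
      by (rule prod_add) simp
    also have "\<dots> = (\<Sum>S\<in>Pow ?D. (- q) ^ card S * (\<Prod>l<n. x l ^ (card {j. (w l, j) \<in> ?D - S} + card {j. (j, w l) \<in> S})))"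
    proof (intro sum.cong refl)
      fix S assume S: "S \<in> Pow ?D"
      have "(\<Prod>p\<in>S. - q * y (snd p)) = (- q) ^ card S * (\<Prod>(i, j)\<in>S. y j)"
        by (simp only: prod.distrib prod_constant case_prod_unfold)
      also have "(\<Prod>(i, j)\<in>S. y j) = (\<Prod>i<n. y i ^ card {j. (j, i) \<in> S})"
        by (rule prod_snd_power) (use S desc_pairs_subset in blast)
      finally have 1: "(\<Prod>p\<in>S. - q * y (snd p)) = (- q) ^ card S * (\<Prod>i<n. y i ^ card {j. (j, i) \<in> S})" .
      have 2: "(\<Prod>p\<in>?D - S. y (fst p)) = (\<Prod>i<n. y i ^ card {j. (i, j) \<in> ?D - S})"
        using prod_fst_power[of "?D - S" n y] desc_pairs_subset[of n nu] by (auto simp: case_prod_unfold)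
      have "(\<Prod>i<n. y i ^ card {j. (i, j) \<in> ?D - S}) * (\<Prod>i<n. y i ^ card {j. (j, i) \<in> S})
         = (\<Prod>i<n. y i ^ (card {j. (i, j) \<in> ?D - S} + card {j. (j, i) \<in> S}))"
        by (simp only: power_add prod.distrib)
      also have "\<dots> = (\<Prod>l<n. y (w l) ^ (card {j. (w l, j) \<in> ?D - S} + card {j. (j, w l) \<in> S}))"
        by (rule trans[OF prod.permute[OF w]]) (simp only: o_def)
      finally show "(\<Prod>p\<in>S. - q * y (snd p)) * (\<Prod>p\<in>?D - S. y (fst p)) =
        (- q) ^ card S * (\<Prod>l<n. x l ^ (card {j. (w l, j) \<in> ?D - S} + card {j. (j, w l) \<in> S}))"
        unfolding 1 2 yw by (simp only: mult.commute mult.left_commute)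
    qed
    finally show ?thesis
      by (simp only: sum_distrib_left raise_def power_add prod.distrib mult.assoc mult.left_commute[of "(- q) ^ _"])
  qed
  then have "alternant n (staircase n) x * hall_littlewood_P nu q n x =
    (\<Sum>w | w permutes {..<n}. \<Sum>S\<in>Pow ?D. (- q) ^ card S * (of_int (sign w) * (\<Prod>l<n. x l ^ raise n nu S (w l))))"
    unfolding alternant_mult_hall_littlewood[OF assms] by (intro sum.cong refl) simp
  also have "\<dots> = (\<Sum>S\<in>Pow ?D. (- q) ^ card S * alternant n (raise n nu S) x)"
    unfolding alternant_sum sum_distrib_left by (rule sum.swap)
  finally show ?thesis .
qed

lemma desc_pairs_less: "antimono nu \<Longrightarrow> (i, j) \<in> desc_pairs n nu \<Longrightarrow> i < j"
  using antimonoD[of nu j i] by (fastforce simp: desc_pairs_def not_less[symmetric])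

text \<open>Relative to nu plus the staircase, every pair (i, j) of S moves one unit from index i to
  index j. Additions on both sides keep the identity within the naturals.\<close>

lemma raise_add:
  assumes nu: "antimono nu" and S: "S \<subseteq> desc_pairs n nu" and i: "i < n"
  shows "raise n nu S i + card {j. (i, j) \<in> S} = nu i + (n - 1 - i) + card {j. (j, i) \<in> S}"
proof -
  have fin: "finite {j. (i, j) \<in> desc_pairs n nu}"
    by (rule finite_subset[of _ "{..<n}"]) (auto simp: desc_pairs_def)
  have "{j. (i, j) \<in> desc_pairs n nu} = {j. (i, j) \<in> desc_pairs n nu - S} \<union> {j. (i, j) \<in> S}" using S by auto
  moreover have "card ({j. (i, j) \<in> desc_pairs n nu - S} \<union> {j. (i, j) \<in> S}) =
     card {j. (i, j) \<in> desc_pairs n nu - S} + card {j. (i, j) \<in> S}"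
    by (rule card_Un_disjoint) (use fin S in \<open>auto intro: finite_subset[OF _ fin]\<close>)
  moreover have "{j. (i, j) \<in> desc_pairs n nu} = {j. j < n \<and> nu j < nu i}" using i by (auto simp: desc_pairs_def)
  ultimately show ?thesis using block_stair_add[OF nu i] by (simp add: raise_def)
qed

lemma sum_raise:
  assumes nu: "is_partition nu" "plength nu \<le> n" and S: "S \<subseteq> desc_pairs n nu"
  shows "(\<Sum>i<n. raise n nu S i) = psize nu + (\<Sum>i<n. n - 1 - i)"
proof -
  have am: "antimono nu" using nu(1) by (simp add: is_partition_def)
  have T: "S \<subseteq> {..<n} \<times> {..<n}" using S desc_pairs_subset by blast
  have "(\<Sum>i<n. card {j. (i, j) \<in> S}) = (\<Sum>i<n. card {j. (j, i) \<in> S})"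
  proof -
    \<comment> \<open>Both sums count S. The count is read off as the exponent in the product of 2
      over S, so that the two product lemmas can be reused.\<close>
    have "2 ^ (\<Sum>i<n. card {j. (i, j) \<in> S}) = (\<Prod>(i, j)\<in>S. 2 :: nat)"
      unfolding prod_fst_power[OF T, of "\<lambda>_. 2"] power_sum ..
    also have "\<dots> = 2 ^ (\<Sum>i<n. card {j. (j, i) \<in> S})"
      unfolding prod_snd_power[OF T, of "\<lambda>_. 2"] power_sum ..
    finally show ?thesis by (simp only: power_inject_exp[of 2] numeral_less_iff one_less_numeral_iff semiring_norm)
  qed
  moreover have "(\<Sum>i<n. raise n nu S i) + (\<Sum>i<n. card {j. (i, j) \<in> S}) =
     ((\<Sum>i<n. nu i) + (\<Sum>i<n. n - 1 - i)) + (\<Sum>i<n. card {j. (j, i) \<in> S})"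
    unfolding sum.distrib[symmetric] by (intro sum.cong refl raise_add[OF am S]) simp
  ultimately show ?thesis unfolding psize_eq[OF nu] by simp
qed

text \<open>Comparing \<open>\<Sum>i. 2 ^ b i\<close> compares the decreasing rearrangements of injective \<open>b\<close> lexicographically.\<close>

lemma raise_smaller:
  assumes nu: "antimono nu" and S: "S \<subseteq> desc_pairs n nu" "S \<noteq> {}" and inj: "inj_on (raise n nu S) {..<n}"
  shows "(\<Sum>i<n. 2 ^ raise n nu S i) < (\<Sum>i<n. (2::nat) ^ (nu i + (n - 1 - i)))"
proof -
  let ?b = "raise n nu S"
  \<comment> \<open>The first index that gives a unit away: earlier exponents are unchanged, and
    those from k on will all lie below the old exponent at k.\<close>
  define k where "k = (LEAST i. \<exists>j. (i, j) \<in> S)"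
  have "\<exists>i j. (i, j) \<in> S" using S(2) by auto
  then have k: "\<exists>j. (k, j) \<in> S" unfolding k_def by (rule LeastI_ex)
  have min: "k \<le> i" if "(i, j) \<in> S" for i j unfolding k_def by (rule Least_le) (use that in blast)
  have kn: "k < n" using k S(1) by (auto simp: desc_pairs_def)
  have finS: "finite S" using S(1) finite_subset[OF _ finite_desc_pairs] by blast
  have lt: "i < j" if "(i, j) \<in> S" for i j using desc_pairs_less[OF nu, of i j n] that S(1) by blast
  have low: "?b i = nu i + (n - 1 - i)" if "i < k" for i
  proof -
    have "(i, j) \<notin> S" "(j, i) \<notin> S" for j
      using min[of i j] min[of j i] lt[of j i] that by auto
    then have "{j. (i, j) \<in> S} = {}" "{j. (j, i) \<in> S} = {}" by blast+
    then show ?thesis using raise_add[OF nu S(1), of i] that kn by simp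
  qed
  \<comment> \<open>An index i > k gains at most one unit from each of k, ..., i - 1, while the
    staircase has dropped by i - k. If k itself gives to i then nu i < nu k; otherwise one possible
    gain is missing. Either way the inequality is strict.\<close>
  have high: "?b i < nu k + (n - 1 - k)" if i: "k \<le> i" "i < n" for i
  proof -
    have sub: "{j. (j, i) \<in> S} \<subseteq> {k..<i}"
    proof
      fix j assume "j \<in> {j. (j, i) \<in> S}"
      then show "j \<in> {k..<i}" using min[of j i] lt[of j i] by simp
    qed
    have "nu i \<le> nu k" using antimonoD[OF nu i(1)] .
    have fin: "finite {j. (i, j) \<in> S}"
      by (rule finite_subset[of _ "{..<n}"]) (use S(1) in \<open>auto simp: desc_pairs_def\<close>)
    show ?thesis
    proof (cases "i = k")
      case True
      then have "{j. (j, i) \<in> S} = {}" using sub by simp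
      moreover have "card {j. (i, j) \<in> S} > 0" using k True fin by (auto simp: card_gt_0_iff)
      ultimately show ?thesis using raise_add[OF nu S(1) i(2)] True by simp
    next
      case False
      then have ki: "k < i" using i by simp
      have le: "card {j. (j, i) \<in> S} \<le> i - k" using card_mono[OF _ sub] by simp
      have rb: "?b i \<le> nu i + (n - 1 - i) + card {j. (j, i) \<in> S}" using raise_add[OF nu S(1) i(2)] by simp
      show ?thesis
      proof (cases "(k, i) \<in> S")
        case True
        then have "nu i < nu k" using S(1) by (auto simp: desc_pairs_def)
        then show ?thesis using le rb ki i by linarith
      next
        case False
        have "{j. (j, i) \<in> S} \<subseteq> {Suc k..<i}"
        proof
          fix j assume j: "j \<in> {j. (j, i) \<in> S}"
          then have "j \<noteq> k" using False by blast
          then show "j \<in> {Suc k..<i}" using subsetD[OF sub j] by simp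
        qed
        from card_mono[OF _ this] have "card {j. (j, i) \<in> S} \<le> i - Suc k" by simp
        then show ?thesis using rb ki i \<open>nu i \<le> nu k\<close> by linarith
      qed
    qed
  qed
  let ?T = "nu k + (n - 1 - k)"
  have split: "{..<n} = {..<k} \<union> {k..<n}" using kn by auto
  have "(\<Sum>i\<in>{k..<n}. 2 ^ ?b i) = (\<Sum>t\<in>?b ` {k..<n}. (2::nat) ^ t)"
    by (rule sum.reindex[symmetric, unfolded o_def], rule inj_on_subset[OF inj]) auto
  \<comment> \<open>By injectivity this is a binary number whose ones occupy distinct places below
    \<open>?T\<close>, hence it is less than 2 ^ \<open>?T\<close>.\<close>
  also have "\<dots> \<le> (\<Sum>t<?T. 2 ^ t)"
  proof (rule sum_mono2)
    show "?b ` {k..<n} \<subseteq> {..<?T}"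
    proof
      fix t assume "t \<in> ?b ` {k..<n}"
      then obtain i where "k \<le> i" "i < n" "t = ?b i" by auto
      then show "t \<in> {..<?T}" using high[of i] by simp
    qed
  qed simp_all
  also have "\<dots> < 2 ^ ?T" unfolding lessThan_atLeast0 sum_power2 by simp
  also have "\<dots> \<le> (\<Sum>i\<in>{k..<n}. 2 ^ (nu i + (n - 1 - i)))"
    by (rule member_le_sum[of k]) (use kn in auto)
  finally have less: "(\<Sum>i\<in>{k..<n}. 2 ^ ?b i) < (\<Sum>i\<in>{k..<n}. (2::nat) ^ (nu i + (n - 1 - i)))" .
  have eq: "(\<Sum>i<k. 2 ^ ?b i) = (\<Sum>i<k. (2::nat) ^ (nu i + (n - 1 - i)))"
    by (intro sum.cong refl) (simp add: low)
  have "sum f {..<n} = sum f {..<k} + sum f {k..<n}" for f :: "nat \<Rightarrow> nat"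
    unfolding split by (rule sum.union_disjoint) auto
  then show ?thesis using add_strict_left_mono[OF less] by (simp only: eq)
qed

lemma raise_empty: "antimono nu \<Longrightarrow> i < n \<Longrightarrow> raise n nu {} i = nu i + (n - 1 - i)"
  using raise_add[of nu "{}" n i] by simp

text \<open>The binary number with ones at the beads: an order on shapes along which the transition
  matrix can be inverted by induction.\<close>

definition weight :: "nat \<Rightarrow> (nat \<Rightarrow> nat) \<Rightarrow> nat" where
  "weight n g = (\<Sum>i<n. 2 ^ (g i + (n - 1 - i)))"

lemma weight_straight:
  assumes "inj_on b {..<n}"
  shows "weight n (straight n b) = (\<Sum>i<n. 2 ^ b i)"
proof -
  have C: "finite (b ` {..<n})" "card (b ` {..<n}) = n" using card_image[OF assms] by auto
  have "weight n (straight n b) = (\<Sum>i<n. 2 ^ bead_enum (Suc 0) (b ` {..<n}) i)"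
    unfolding weight_def by (intro sum.cong refl arg_cong[where f = "power 2"] straight_bead_enum[OF assms]) simp
  also have "\<dots> = (\<Sum>t\<in>b ` {..<n}. 2 ^ t)"
    using sum.reindex_bij_betw[OF bead_enum_bij[OF C(1), of "Suc 0"], of "\<lambda>t. 2 ^ t"] C(2) by simp
  also have "\<dots> = (\<Sum>i<n. 2 ^ b i)"
    by (rule trans[OF sum.reindex[OF assms]]) (simp only: o_def)
  finally show ?thesis .
qed

text \<open>A rearrangement with nonzero last entry contributes a positive power of 0. In the others
  each pair (i, n) contributes (x i - q * 0) / (x i - 0) = 1, which is where x i must be
  nonzero.\<close>

lemma hall_littlewood_append_zero:
  assumes nu: "is_partition nu" and x: "generic n x"
  shows "hall_littlewood_P nu q (Suc n) (x(n := 0)) = hall_littlewood_P nu q n x"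
proof -
  let ?x = "x(n := 0)"
  let ?t = "\<lambda>a. (\<Prod>i<Suc n. ?x i ^ a i) * (\<Prod>(i, j)\<in>desc_pairs (Suc n) a. (?x i - q * ?x j) / (?x i - ?x j))"
  have z: "?t a = 0" if "a n \<noteq> 0" for a using that by simp
  show ?thesis
  proof (cases "plength nu \<le> n")
    case True
    have nun: "nu n = 0" using is_partition_zero_ge[OF nu True order_refl] .
    have sub: "rearrangements n nu = {a \<in> rearrangements (Suc n) nu. a n = 0}"
    proof (intro equalityI subsetI)
      fix a assume "a \<in> rearrangements n nu"
      then obtain w where w: "w permutes {..<n}" "a = nu \<circ> w" by (auto simp: rearrangements_def)
      have "w permutes {..<Suc n}" by (rule permutes_subset[OF w(1)]) auto
      moreover have "w n = n" using w(1) by (simp add: permutes_def)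
      ultimately show "a \<in> {a \<in> rearrangements (Suc n) nu. a n = 0}"
        using w(2) nun by (auto simp: rearrangements_def)
    next
      fix a assume "a \<in> {a \<in> rearrangements (Suc n) nu. a n = 0}"
      then obtain w where w: "w permutes {..<Suc n}" "a = nu \<circ> w" "nu (w n) = 0" by (auto simp: rearrangements_def)
      \<comment> \<open>Swapping two indices at which nu is 0 makes w fix n without changing the
        rearrangement.\<close>
      define v where "v = transpose (w n) n \<circ> w"
      have "w n \<in> {..<Suc n}" using permutes_lessThan_less[OF w(1), of n] by simp
      then have "transpose (w n) n permutes {..<Suc n}" by (intro permutes_swap_id) auto
      then have "v permutes {..<Suc n}" unfolding v_def by (rule permutes_compose[OF w(1)])
      moreover have "v n = n" by (simp add: v_def)
      ultimately have "v permutes {..<n}"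
        using permutes_superset[of v "{..<Suc n}" "{..<n}"] by (auto simp: less_Suc_eq)
      moreover have "a = nu \<circ> v" using w(2,3) nun by (auto simp: v_def fun_eq_iff transpose_def)
      ultimately show "a \<in> rearrangements n nu" unfolding rearrangements_def by blast
    qed
    have "hall_littlewood_P nu q (Suc n) ?x = sum ?t (rearrangements (Suc n) nu)"
      by (rule hall_littlewood_P_desc_pairs) (use True in simp)
    also have "\<dots> = sum ?t (rearrangements n nu)"
      unfolding sub by (rule sum.mono_neutral_right) (use z finite_rearrangements in auto)
    also have "\<dots> = (\<Sum>a\<in>rearrangements n nu. (\<Prod>i<n. x i ^ a i) *
        (\<Prod>(i, j)\<in>desc_pairs n a. (x i - q * x j) / (x i - x j)))"
    proof (intro sum.cong refl arg_cong2[where f = "(*)"])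
      fix a assume "a \<in> rearrangements n nu"
      then have an: "a n = 0" using sub by blast
      then show "(\<Prod>i<Suc n. ?x i ^ a i) = (\<Prod>i<n. x i ^ a i)" by simp
      show "(\<Prod>(i, j)\<in>desc_pairs (Suc n) a. (?x i - q * ?x j) / (?x i - ?x j)) =
        (\<Prod>(i, j)\<in>desc_pairs n a. (x i - q * x j) / (x i - x j))"
      proof (rule prod.mono_neutral_cong_right)
        show "desc_pairs n a \<subseteq> desc_pairs (Suc n) a" by (auto simp: desc_pairs_def)
        show "\<forall>p\<in>desc_pairs (Suc n) a - desc_pairs n a. (case p of (i, j) \<Rightarrow> (?x i - q * ?x j) / (?x i - ?x j)) = 1"
          using an x by (auto simp: desc_pairs_def generic_def less_Suc_eq)
      qed (rule finite_desc_pairs, auto simp: desc_pairs_def)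
    qed
    also have "\<dots> = hall_littlewood_P nu q n x" by (rule hall_littlewood_P_desc_pairs[OF True, symmetric])
    finally show ?thesis .
  next
    case False
    have "hall_littlewood_P nu q (Suc n) ?x = 0"
    proof (cases "plength nu \<le> Suc n")
      case True
      have "?t a = 0" if "a \<in> rearrangements (Suc n) nu" for a
      proof (rule z)
        obtain w where w: "w permutes {..<Suc n}" "a = nu \<circ> w" using \<open>a \<in> _\<close> by (auto simp: rearrangements_def)
        have "w n < plength nu" using permutes_lessThan_less[OF w(1), of n] False by simp
        then show "a n \<noteq> 0" using w(2) is_partition_nonzero_iff[OF nu] by simp
      qed
      then show ?thesis unfolding hall_littlewood_P_desc_pairs[OF True] by (rule sum.neutral[OF ballI])
    next
      case False
      then show ?thesis by (simp add: hall_littlewood_P_def)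
    qed
    then show ?thesis using False by (simp add: hall_littlewood_P_def)
  qed
qed

lemma tendsto_hall_littlewood:
  assumes x: "inj_on x {..<n}"
  shows "((\<lambda>t. hall_littlewood_P nu q n (perturb x t)) \<longlongrightarrow> hall_littlewood_P nu q n x) (at 0)"
proof (cases "plength nu \<le> n")
  case True
  have "((\<lambda>t. (perturb x t i - q * perturb x t j) / (perturb x t i - perturb x t j)) \<longlongrightarrow> (x i - q * x j) / (x i - x j)) (at 0)"
    if "(i, j) \<in> desc_pairs n a" for a i j
  proof (rule tendsto_divide)
    show "x i - x j \<noteq> 0" using that x by (auto simp: desc_pairs_def inj_on_def)
  qed (rule tendsto_diff tendsto_mult_left tendsto_perturb)+
  then have pairs: "((\<lambda>t. \<Prod>(i, j)\<in>desc_pairs n a. (perturb x t i - q * perturb x t j) / (perturb x t i - perturb x t j))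
     \<longlongrightarrow> (\<Prod>(i, j)\<in>desc_pairs n a. (x i - q * x j) / (x i - x j))) (at 0)" for a
    by (intro tendsto_prod) auto
  have "((\<lambda>t. \<Prod>i<n. perturb x t i ^ a i) \<longlongrightarrow> (\<Prod>i<n. x i ^ a i)) (at 0)" for a
    by (rule tendsto_prod, rule tendsto_power, rule tendsto_perturb)
  then show ?thesis
    unfolding hall_littlewood_P_desc_pairs[OF True] by (rule tendsto_sum[OF tendsto_mult[OF _ pairs]])
next
  case False
  then show ?thesis by (simp add: hall_littlewood_P_def)
qed

lemma hall_littlewood_schur_span:
  assumes nu: "nu \<in> partitions_of d" and "d \<le> n"
  shows "\<exists>c. \<forall>x :: nat \<Rightarrow> complex. inj_on x {..<n} \<longrightarrow> hall_littlewood_P nu q n x = (\<Sum>g\<in>partitions_of d. c g * schur g n x)"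
proof -
  have p: "is_partition nu" "plength nu \<le> n" "psize nu = d"
    using partitions_of_bounds[OF nu] assms(2) by auto
  have "schur_span n d (\<lambda>x. \<Sum>S\<in>Pow (desc_pairs n nu). (- q) ^ card S * alternant n (raise n nu S) x)"
    by (rule schur_span_sum, rule schur_span_cmult, rule schur_span_alternant)
      (use sum_raise[OF p(1,2)] p(3) in simp)
  then obtain c where c: "\<And>x. (\<Sum>S\<in>Pow (desc_pairs n nu). (- q) ^ card S * alternant n (raise n nu S) x) =
      (\<Sum>g\<in>partitions_of d. c g * alternant n (\<lambda>i. g i + (n - 1 - i)) x)"
    by (auto simp: schur_span_def)
  show ?thesis
  proof (intro exI allI impI)
    fix x :: "nat \<Rightarrow> complex" assume x: "inj_on x {..<n}"
    have "alternant n (staircase n) x * hall_littlewood_P nu q n x = (\<Sum>g\<in>partitions_of d. c g * schur g n x) * alternant n (staircase n) x"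
      unfolding alternant_mult_hall_littlewood_expand[OF p(1,2) x] c sum_distrib_right
    proof (intro sum.cong refl)
      fix g assume g: "g \<in> partitions_of d"
      show "c g * alternant n (\<lambda>i. g i + (n - 1 - i)) x = c g * schur g n x * alternant n (staircase n) x"
        unfolding mult.assoc
        by (subst schur_bialternant) (use partitions_of_bounds(1,3)[OF g] assms(2) in auto)
    qed
    then show "hall_littlewood_P nu q n x = (\<Sum>g\<in>partitions_of d. c g * schur g n x)"
      using alternant_staircase_nonzero[OF x] by (simp add: mult.commute)
  qed
qed


section \<open>Kostka--Foulkes polynomials\<close>

text \<open>The coefficients of \<open>P\<^sub>\<nu>\<close> on the Schur polynomials of smaller weight.\<close>

definition transition :: "nat \<Rightarrow> (nat \<Rightarrow> nat) \<Rightarrow> (nat \<Rightarrow> nat) \<Rightarrow> complex poly" where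
  "transition n nu g = (\<Sum>S\<in>{S \<in> Pow (desc_pairs n nu) - {{}}. inj_on (raise n nu S) {..<n} \<and> straight n (raise n nu S) = g}.
     monom ((-1) ^ card S * straight_sign n (raise n nu S)) (card S))"

lemma transition_zero:
  assumes "antimono nu" "transition n nu g \<noteq> 0"
  shows "weight n g < weight n nu"
proof -
  have "\<exists>S\<in>Pow (desc_pairs n nu) - {{}}. inj_on (raise n nu S) {..<n} \<and> straight n (raise n nu S) = g"
  proof (rule ccontr)
    assume "\<not> ?thesis"
    then have "{S \<in> Pow (desc_pairs n nu) - {{}}. inj_on (raise n nu S) {..<n} \<and> straight n (raise n nu S) = g} = {}" by blast
    then have "transition n nu g = 0" unfolding transition_def by (simp only: sum.empty)
    then show False using assms(2) by simp
  qed
  then obtain S where S: "S \<subseteq> desc_pairs n nu" "S \<noteq> {}" "inj_on (raise n nu S) {..<n}" "straight n (raise n nu S) = g" by blast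
  show ?thesis
    using raise_smaller[OF assms(1) S(1-3)] weight_straight[OF S(3)] S(4) by (simp add: weight_def)
qed

text \<open>The empty S gives nu plus the staircase with coefficient 1. The other S are grouped by
  the shape to which they straighten, and non-injective exponents give alternants equal to zero.
  With as many variables as the size of nu, every shape has room.\<close>

lemma hall_littlewood_transition:
  assumes nu: "nu \<in> partitions_of n" and x: "inj_on x {..<n}"
  shows "hall_littlewood_P nu q n x = (\<Sum>g\<in>partitions_of n.
    ((if g = nu then 1 else 0) + poly (transition n nu g) q) * schur g n x)"
proof -
  have p: "is_partition nu" "plength nu \<le> n" "psize nu = n"
    using partitions_of_bounds[OF nu] by auto
  have am: "antimono nu" using p(1) by (simp add: is_partition_def)
  let ?D = "desc_pairs n nu"
  let ?b = "raise n nu"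
  let ?A = "\<lambda>g. alternant n (\<lambda>i. g i + (n - 1 - i)) x"
  let ?I = "{S \<in> Pow ?D - {{}}. inj_on (?b S) {..<n}}"
  have finI: "finite ?I" by (rule finite_subset[of _ "Pow ?D"]) auto
  have "(\<Sum>S\<in>Pow ?D - {{}}. (- q) ^ card S * alternant n (?b S) x) = (\<Sum>S\<in>?I. (- q) ^ card S * alternant n (?b S) x)"
  proof (rule sum.mono_neutral_right)
    show "\<forall>S\<in>Pow ?D - {{}} - ?I. (- q) ^ card S * alternant n (?b S) x = 0"
    proof
      fix S assume "S \<in> Pow ?D - {{}} - ?I"
      then have "\<not> inj_on (?b S) {..<n}" by blast
      then have "straight_sign n (?b S) = 0" by (simp add: straight_sign_def)
      then show "(- q) ^ card S * alternant n (?b S) x = 0" by (subst alternant_straight) simp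
    qed
  qed auto
  also have "\<dots> = (\<Sum>g\<in>partitions_of n. \<Sum>S\<in>{S \<in> ?I. straight n (?b S) = g}. (- q) ^ card S * alternant n (?b S) x)"
  proof (rule sum.group[symmetric, OF finI finite_partitions_of])
    show "(\<lambda>S. straight n (?b S)) ` ?I \<subseteq> partitions_of n"
    proof (rule image_subsetI)
      fix S assume "S \<in> ?I"
      then have S: "S \<subseteq> ?D" "inj_on (?b S) {..<n}" by blast+
      then show "straight n (?b S) \<in> partitions_of n"
        using is_partition_straight[OF S(2)] psize_straight[OF S(2)] sum_raise[OF p(1,2) S(1)] p(3)
        by (simp add: partitions_of_def)
    qed
  qed
  also have "\<dots> = (\<Sum>g\<in>partitions_of n. poly (transition n nu g) q * ?A g)"
  proof (intro sum.cong refl)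
    fix g
    have "(\<Sum>S\<in>{S \<in> ?I. straight n (?b S) = g}. (- q) ^ card S * alternant n (?b S) x)
      = (\<Sum>S\<in>{S \<in> ?I. straight n (?b S) = g}. (-1) ^ card S * straight_sign n (?b S) * q ^ card S * ?A g)"
    proof (intro sum.cong refl)
      fix S assume "S \<in> {S \<in> ?I. straight n (?b S) = g}"
      then have g: "straight n (?b S) = g" by blast
      show "(- q) ^ card S * alternant n (?b S) x = (-1) ^ card S * straight_sign n (?b S) * q ^ card S * ?A g"
        unfolding alternant_straight[of n "?b S" x] g power_minus[of q] by (simp only: mult.assoc mult.left_commute)
    qed
    also have "\<dots> = (\<Sum>S\<in>{S \<in> ?I. straight n (?b S) = g}. (-1) ^ card S * straight_sign n (?b S) * q ^ card S) * ?A g"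
      by (rule sum_distrib_right[symmetric])
    also have "(\<Sum>S\<in>{S \<in> ?I. straight n (?b S) = g}. (-1) ^ card S * straight_sign n (?b S) * q ^ card S) = poly (transition n nu g) q"
      unfolding transition_def poly_sum poly_monom by (rule sum.cong) auto
    finally show "(\<Sum>S\<in>{S \<in> ?I. straight n (?b S) = g}. (- q) ^ card S * alternant n (?b S) x) = poly (transition n nu g) q * ?A g" .
  qed
  finally have rest: "(\<Sum>S\<in>Pow ?D - {{}}. (- q) ^ card S * alternant n (?b S) x) = (\<Sum>g\<in>partitions_of n. poly (transition n nu g) q * ?A g)" .
  have empty: "alternant n (?b {}) x = ?A nu" by (rule alternant_cong) (rule raise_empty[OF am])
  have "alternant n (staircase n) x * hall_littlewood_P nu q n x = ?A nu + (\<Sum>S\<in>Pow ?D - {{}}. (- q) ^ card S * alternant n (?b S) x)"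
    unfolding alternant_mult_hall_littlewood_expand[OF p(1,2) x]
    by (subst sum.remove[of _ "{}"]) (simp_all add: empty)
  also have "?A nu = (\<Sum>g\<in>partitions_of n. if nu = g then ?A g else 0)"
    using nu finite_partitions_of by simp
  finally have "alternant n (staircase n) x * hall_littlewood_P nu q n x =
      (\<Sum>g\<in>partitions_of n. (if nu = g then ?A g else 0) + poly (transition n nu g) q * ?A g)"
    unfolding rest sum.distrib .
  also have "\<dots> = (\<Sum>g\<in>partitions_of n. ((if g = nu then 1 else 0) + poly (transition n nu g) q) * schur g n x) * alternant n (staircase n) x"
    unfolding sum_distrib_right
  proof (intro sum.cong refl)
    fix g assume g: "g \<in> partitions_of n"
    have "schur g n x * alternant n (staircase n) x = ?A g"
      by (rule schur_bialternant) (use partitions_of_bounds(1,3)[OF g] in auto)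
    then show "(if nu = g then ?A g else 0) + poly (transition n nu g) q * ?A g =
      ((if g = nu then 1 else 0) + poly (transition n nu g) q) * schur g n x * alternant n (staircase n) x"
      unfolding mult.assoc by (auto simp: distrib_right)
  qed
  finally show ?thesis using alternant_staircase_nonzero[OF x] by (simp add: mult.commute)
qed

text \<open>The coefficients found in d variables are valid in any number of variables by
  stability.\<close>

theorem hall_littlewood_schur:
  assumes nu: "nu \<in> partitions_of d" and x: "inj_on x {..<n}"
  shows "hall_littlewood_P nu q n x = (\<Sum>g\<in>partitions_of d.
    ((if g = nu then 1 else 0) + poly (transition d nu g) q) * schur g n x)"
proof (rule schur_expansion_stable[of "hall_littlewood_P nu q" d])
  show "hall_littlewood_P nu q (Suc n) (x(n := 0)) = hall_littlewood_P nu q n x" if "generic n x" for n x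
    by (rule hall_littlewood_append_zero[OF partitions_of_bounds(1)[OF nu] that])
  show "\<exists>c. \<forall>x. inj_on x {..<n} \<longrightarrow> hall_littlewood_P nu q n x = (\<Sum>g\<in>partitions_of d. c g * schur g n x)" if "d \<le> n" for n
    by (rule hall_littlewood_schur_span[OF nu that])
  show "((\<lambda>t. hall_littlewood_P nu q n (perturb x t)) \<longlongrightarrow> hall_littlewood_P nu q n x) (at 0)" if "inj_on x {..<n}" for n x
    by (rule tendsto_hall_littlewood[OF that])
  show "hall_littlewood_P nu q d x = (\<Sum>g\<in>partitions_of d. ((if g = nu then 1 else 0) + poly (transition d nu g) q) * schur g d x)"
    if "inj_on x {..<d}" for x
    by (rule hall_littlewood_transition[OF nu that])
qed (rule x)

text \<open>Induction on the weight inverts the transition matrix. Its diagonal entries are 1, so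
  the inverse again has entries polynomial in q.\<close>

lemma kostka_foulkes_exists:
  assumes "lam \<in> partitions_of d"
  shows "\<exists>K :: (nat \<Rightarrow> nat) \<Rightarrow> complex poly. (\<forall>nu. nu \<notin> partitions_of d \<longrightarrow> K nu = 0) \<and>
     (\<forall>q n x. inj_on x {..<n} \<longrightarrow> schur lam n x = (\<Sum>nu\<in>partitions_of d. poly (K nu) q * hall_littlewood_P nu q n x))"
  using assms
proof (induction "weight d lam" arbitrary: lam rule: less_induct)
  case less
  let ?P = "partitions_of d"
  let ?G = "{g \<in> ?P. weight d g < weight d lam}"
  have am: "antimono lam" using partitions_of_bounds(1)[OF less.prems] by (simp add: is_partition_def)
  have "\<forall>g\<in>?G. \<exists>K :: (nat \<Rightarrow> nat) \<Rightarrow> complex poly. (\<forall>nu. nu \<notin> ?P \<longrightarrow> K nu = 0) \<and>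
     (\<forall>q n x. inj_on x {..<n} \<longrightarrow> schur g n x = (\<Sum>nu\<in>?P. poly (K nu) q * hall_littlewood_P nu q n x))"
  proof
    fix g assume g: "g \<in> ?G"
    show "\<exists>K :: (nat \<Rightarrow> nat) \<Rightarrow> complex poly. (\<forall>nu. nu \<notin> ?P \<longrightarrow> K nu = 0) \<and>
     (\<forall>q n x. inj_on x {..<n} \<longrightarrow> schur g n x = (\<Sum>nu\<in>?P. poly (K nu) q * hall_littlewood_P nu q n x))"
      by (rule less.hyps) (use g in auto)
  qed
  from bchoice[OF this] obtain K :: "(nat \<Rightarrow> nat) \<Rightarrow> (nat \<Rightarrow> nat) \<Rightarrow> complex poly"
    where K: "\<And>g nu. g \<in> ?G \<Longrightarrow> nu \<notin> ?P \<Longrightarrow> K g nu = 0"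
      "\<And>g q n x. g \<in> ?G \<Longrightarrow> inj_on x {..<n} \<Longrightarrow> schur g n x = (\<Sum>nu\<in>?P. poly (K g nu) q * hall_littlewood_P nu q n x)"
    by blast
  define K' where "K' nu = (if nu = lam then 1 else 0) - (\<Sum>g\<in>?G. transition d lam g * K g nu)" for nu
  have finG: "finite ?G" using finite_partitions_of[of d] by simp
  show ?case
  proof (intro exI[of _ K'] conjI allI impI)
    fix nu assume nu: "nu \<notin> ?P"
    then have "(\<Sum>g\<in>?G. transition d lam g * K g nu) = 0" by (intro sum.neutral ballI) (simp add: K(1))
    moreover have "nu \<noteq> lam" using nu less.prems by blast
    ultimately show "K' nu = 0" by (simp only: K'_def if_False diff_0_right)
  next
    fix q n and x :: "nat \<Rightarrow> complex" assume x: "inj_on x {..<n}"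
    let ?h = "\<lambda>nu. hall_littlewood_P nu q n x"
    have 1: "(\<Sum>nu\<in>?P. (if nu = lam then 1 else 0) * ?h nu) = ?h lam"
    proof -
      have "(\<Sum>nu\<in>?P. (if nu = lam then 1 else 0) * ?h nu) = (\<Sum>nu\<in>?P. if lam = nu then ?h nu else 0)"
        by (rule sum.cong) auto
      then show ?thesis using less.prems finite_partitions_of by simp
    qed
    have 2: "(\<Sum>g\<in>?P. poly (transition d lam g) q * schur g n x) = (\<Sum>g\<in>?G. poly (transition d lam g) q * schur g n x)"
    proof (rule sum.mono_neutral_right[OF finite_partitions_of])
      show "\<forall>g\<in>?P - ?G. poly (transition d lam g) q * schur g n x = 0"
      proof
        fix g assume "g \<in> ?P - ?G"
        then have "\<not> weight d g < weight d lam" by blast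
        then have "transition d lam g = 0" using transition_zero[OF am] by blast
        then show "poly (transition d lam g) q * schur g n x = 0" by simp
      qed
    qed blast
    have "(\<Sum>nu\<in>?P. poly (K' nu) q * ?h nu) = (\<Sum>nu\<in>?P. (if nu = lam then 1 else 0) * ?h nu) -
        (\<Sum>nu\<in>?P. \<Sum>g\<in>?G. poly (transition d lam g) q * (poly (K g nu) q * ?h nu))"
      unfolding sum_subtractf[symmetric]
    proof (intro sum.cong refl)
      fix nu
      have "poly (K' nu) q = (if nu = lam then 1 else 0) - (\<Sum>g\<in>?G. poly (transition d lam g) q * poly (K g nu) q)"
        unfolding K'_def by (simp only: poly_diff poly_sum poly_mult) simp
      then show "poly (K' nu) q * ?h nu = (if nu = lam then 1 else 0) * ?h nu -
          (\<Sum>g\<in>?G. poly (transition d lam g) q * (poly (K g nu) q * ?h nu))"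
        by (simp only: left_diff_distrib sum_distrib_right mult.assoc)
    qed
    also have "(\<Sum>nu\<in>?P. \<Sum>g\<in>?G. poly (transition d lam g) q * (poly (K g nu) q * ?h nu)) =
       (\<Sum>g\<in>?G. \<Sum>nu\<in>?P. poly (transition d lam g) q * (poly (K g nu) q * ?h nu))"
      by (rule sum.swap)
    also have "\<dots> = (\<Sum>g\<in>?G. poly (transition d lam g) q * schur g n x)"
      unfolding sum_distrib_left[symmetric] by (intro sum.cong refl arg_cong2[where f = "(*)"] K(2)[symmetric] x)
    also have "(\<Sum>nu\<in>?P. (if nu = lam then 1 else 0) * ?h nu) - (\<Sum>g\<in>?G. poly (transition d lam g) q * schur g n x) = schur lam n x"
    proof -
      have "(\<Sum>g\<in>?P. (if g = lam then 1 else 0) * schur g n x) = schur lam n x"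
      proof -
        have "(\<Sum>g\<in>?P. (if g = lam then 1 else 0) * schur g n x) = (\<Sum>g\<in>?P. if lam = g then schur g n x else 0)"
          by (rule sum.cong) auto
        then show ?thesis using less.prems finite_partitions_of by simp
      qed
      then have "?h lam = schur lam n x + (\<Sum>g\<in>?P. poly (transition d lam g) q * schur g n x)"
        unfolding hall_littlewood_schur[OF less.prems x] distrib_right sum.distrib by simp
      then show ?thesis unfolding 1 2 by simp
    qed
    finally show "schur lam n x = (\<Sum>nu\<in>?P. poly (K' nu) q * ?h nu)" by (rule sym)
  qed
qed

lemma kostka_foulkes_expansion:
  assumes "lam \<in> partitions_of d"
  shows "inj_on x {..<n} \<Longrightarrow> schur lam n x = (\<Sum>nu\<in>partitions_of d. poly (kostka_foulkes lam nu) q * hall_littlewood_P nu q n x)"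
proof -
  have d: "psize lam = d" using assms by (simp add: partitions_of_def)
  show "inj_on x {..<n} \<Longrightarrow> schur lam n x = (\<Sum>nu\<in>partitions_of d. poly (kostka_foulkes lam nu) q * hall_littlewood_P nu q n x)"
    using someI_ex[OF kostka_foulkes_exists[OF assms]] unfolding kostka_foulkes_def d by blast
qed

section \<open>Hall-Littlewood polynomials at the roots of unity\<close>

lemma primitive_root_powers_inj:
  assumes w: "primitive_root_of_unity N w"
  shows "inj_on ((^) w) {..<N}"
proof -
  have *: False if "i < j" "j < N" "w ^ i = w ^ j" for i j
  proof -
    have "w \<noteq> 0" using w that by (auto simp: primitive_root_of_unity_def power_0_left split: if_splits)
    then have "w ^ (j - i) = 1" using that by (simp add: power_diff)
    then show False using w that by (simp add: primitive_root_of_unity_def)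
  qed
  show ?thesis
  proof (rule inj_onI)
    fix i j assume "i \<in> {..<N}" "j \<in> {..<N}" "w ^ i = w ^ j"
    then show "i = j" using *[of i j] *[of j i] by (cases i j rule: linorder_cases) auto
  qed
qed

text \<open>The exponent of w is N (N - 1) / 2. For odd N this is a multiple of N; for even N, w ^
  (N / 2) is the square root of 1 different from 1.\<close>

lemma prod_primitive_root_powers:
  assumes N: "N > 0" and w: "primitive_root_of_unity N w"
  shows "(\<Prod>i<N. w ^ i) = (-1) ^ (N - 1)"
proof -
  have wN: "w ^ N = 1" using w by (simp add: primitive_root_of_unity_def)
  have e: "(\<Prod>i<N. w ^ i) = w ^ (\<Sum>i<N. i)" by (rule power_sum[symmetric])
  have s: "(\<Sum>i<N. i) = N * (N - 1) div 2" using gauss_sum_nat[of "N - 1"] N by (simp add: lessThan_Suc_atMost[symmetric] atMost_atLeast0[symmetric] mult.commute)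
  show ?thesis
  proof (cases "even N")
    case True
    then obtain k where k: "N = 2 * k" by blast
    have "(w ^ k) ^ 2 = 1" using wN k by (simp flip: power_mult add: mult.commute)
    moreover have "w ^ k \<noteq> 1" using w k N by (simp add: primitive_root_of_unity_def)
    ultimately have "w ^ k = -1" by (simp add: power2_eq_1_iff)
    moreover have "(\<Sum>i<N. i) = k * (N - 1)"
    proof -
      have "N * (N - 1) = 2 * (k * (N - 1))" by (simp only: k mult.assoc)
      then show ?thesis unfolding s by (metis nonzero_mult_div_cancel_left zero_neq_numeral)
    qed
    ultimately show ?thesis unfolding e by (simp add: power_mult)
  next
    case False
    then obtain k where k: "N = 2 * k + 1" by (rule oddE)
    have "N * (N - 1) = 2 * (N * k)" by (simp add: k)
    then have "(\<Sum>i<N. i) = N * k" unfolding s by (metis nonzero_mult_div_cancel_left zero_neq_numeral)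
    then have "(\<Prod>i<N. w ^ i) = 1" unfolding e by (simp add: power_mult wN)
    then show ?thesis using k by simp
  qed
qed

text \<open>A non-constant rearrangement has a cyclic descent, where a factor \<open>w ^ i - w * w ^ j\<close> vanishes.\<close>

lemma hall_littlewood_primitive_root:
  assumes N: "N > 0" and w: "primitive_root_of_unity N w" and nu: "nu \<in> partitions_of (N * m)"
  shows "hall_littlewood_P nu w N ((^) w) = (if nu = rect m N then (-1) ^ ((N - 1) * m) else 0)"
proof -
  have wN: "w ^ N = 1" using w by (simp add: primitive_root_of_unity_def)
  note b = partitions_of_bounds[OF nu]
  show ?thesis
  proof (cases "nu = rect m N")
    case True
    have len: "plength nu \<le> N" using b(1) True by (simp add: plength_le_iff rect_def)
    have "nu \<circ> v = nu" if "v permutes {..<N}" for v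
    proof
      fix i
      show "(nu \<circ> v) i = nu i"
        using that permutes_lessThan_less[OF that, of i] by (cases "i < N") (auto simp: True rect_def permutes_def)
    qed
    then have "rearrangements N nu \<subseteq> {nu}" unfolding rearrangements_def by blast
    moreover have "nu \<circ> id \<in> rearrangements N nu"
      unfolding rearrangements_def using permutes_id[of "{..<N}"] by blast
    ultimately have "rearrangements N nu = {nu}" by auto
    moreover have "desc_pairs N nu = {}" by (auto simp: desc_pairs_def True rect_def)
    ultimately have "hall_littlewood_P nu w N ((^) w) = (\<Prod>i<N. (w ^ i) ^ nu i)"
      unfolding hall_littlewood_P_desc_pairs[OF len] by simp
    also have "\<dots> = (\<Prod>i<N. w ^ i) ^ m"
      unfolding prod_power_distrib by (rule prod.cong) (auto simp: True rect_def)
    finally show ?thesis using True by (simp add: prod_primitive_root_powers[OF N w] power_mult)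
  next
    case False
    show ?thesis
    proof (cases "plength nu \<le> N")
      case True
      have "(\<Prod>i<N. (w ^ i) ^ a i) * (\<Prod>(i, j)\<in>desc_pairs N a. (w ^ i - w * w ^ j) / (w ^ i - w ^ j)) = 0"
        if a: "a \<in> rearrangements N nu" for a
      proof -
        obtain v where v: "v permutes {..<N}" "a = nu \<circ> v" using a by (auto simp: rearrangements_def)
        have "\<exists>(i, j)\<in>desc_pairs N a. w ^ i = w * w ^ j"
        proof (rule ccontr)
          assume neg: "\<not> ?thesis"
          have step: "a (Suc j) \<le> a j" if "Suc j < N" for j
          proof (rule ccontr)
            assume "\<not> a (Suc j) \<le> a j"
            then have "(Suc j, j) \<in> desc_pairs N a" using that by (simp add: desc_pairs_def)
            then show False using neg by force
          qed
          \<comment> \<open>The pair (0, N - 1) closes the cycle, because w * w ^ (N - 1) = w ^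
            0.\<close>
          have wrap: "a 0 \<le> a (N - 1)"
          proof (rule ccontr)
            assume "\<not> a 0 \<le> a (N - 1)"
            then have "(0, N - 1) \<in> desc_pairs N a" using N by (simp add: desc_pairs_def)
            moreover have "w ^ 0 = w * w ^ (N - 1)" using wN N by (simp flip: power_Suc)
            ultimately show False using neg by blast
          qed
          have le: "a j \<le> a i" if "i \<le> j" "j < N" for i j
            using that by (induction j rule: dec_induct) (auto intro: order_trans[OF step])
          have const: "a i = a 0" if "i < N" for i
            using le[of 0 i] le[of i "N - 1"] wrap that by fastforce
          have nuc: "nu i = a 0" if "i < N" for i
          proof -
            have "inv_into UNIV v i < N" using permutes_lessThan_less[OF permutes_inv[OF v(1)] that] .
            then have "a (inv_into UNIV v i) = a 0" by (rule const)
            then show ?thesis by (simp add: v(2) permutes_inverses[OF v(1)])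
          qed
          have "(\<Sum>i<N. nu i) = N * m" using psize_eq[OF b(1) True] b(4) by simp
          moreover have "(\<Sum>i<N. nu i) = N * a 0" using nuc by simp
          ultimately have "a 0 = m" using N by simp
          then have "nu = rect m N"
            using nuc is_partition_zero_ge[OF b(1) True] by (auto simp: rect_def fun_eq_iff)
          then show False using False by simp
        qed
        then obtain i j where ij: "(i, j) \<in> desc_pairs N a" "w ^ i = w * w ^ j" by blast
        have "(\<Prod>(i, j)\<in>desc_pairs N a. (w ^ i - w * w ^ j) / (w ^ i - w ^ j)) = 0"
          by (rule prod_zero[OF finite_desc_pairs], rule bexI[OF _ ij(1)]) (simp add: ij(2))
        then show ?thesis by (simp only: mult_zero_right)
      qed
      then have "hall_littlewood_P nu w N ((^) w) = 0"
        unfolding hall_littlewood_P_desc_pairs[OF True] by (rule sum.neutral[OF ballI])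
      then show ?thesis using False by (simp only: if_False)
    next
      case nle: False
      then show ?thesis using False by (simp add: hall_littlewood_P_def)
    qed
  qed
qed

text \<open>When a Schur polynomial is expanded in Hall-Littlewood polynomials at the roots of
  unity, only nu = (m^N) survives; so its value there is the Kostka-Foulkes value up to the sign,
  and the Hall inner product extends this linearly to skew shapes. The sign changes sides since its
  square is 1.\<close>

theorem skew_kostka_foulkes_primitive_root:
  assumes N: "N > 0" and w: "primitive_root_of_unity N w" and sk: "skew_partition lam mu"
    and size: "skew_size lam mu = N * m"
  shows "skew_kostka_foulkes lam mu (rect m N) w = (-1) ^ ((N - 1) * m) * skew_schur lam mu N ((^) w)"
proof -
  let ?P = "partitions_of (N * m)"
  let ?R = "rect m N"
  obtain c0 where c0: "\<And>n x. skew_schur lam mu n x = (\<Sum>g\<in>?P. c0 g * schur g n x)"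
    using skew_schur_expansion[OF sk] unfolding size by blast
  have coeff: "schur_coeff f = (\<lambda>g. if g \<in> ?P then c g else 0)"
    if f: "\<And>n x. f n x = (\<Sum>g\<in>?P. c g * schur g n x)" for f c
  proof (rule schur_coeff_eqI)
    let ?c = "\<lambda>g. if g \<in> ?P then c g else 0"
    have sub: "{g. ?c g \<noteq> 0} \<subseteq> ?P" by auto
    show "finite {g. ?c g \<noteq> 0}" by (rule finite_subset[OF sub finite_partitions_of])
    show "is_partition g" if "?c g \<noteq> 0" for g using that sub partitions_of_bounds(1) by blast
    show "f n x = (\<Sum>g | ?c g \<noteq> 0. ?c g * schur g n x)" for n x
      unfolding f by (rule sum.mono_neutral_cong_right[OF finite_partitions_of sub]) auto
  qed
  have rect: "psize ?R = N * m"
  proof -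
    have "is_partition ?R" by (rule is_partitionI[of _ N]) (auto simp: rect_def)
    moreover from this have "plength ?R \<le> N" by (simp add: plength_le_iff rect_def)
    ultimately show ?thesis by (simp add: psize_eq rect_def)
  qed
  have Q: "schur_coeff (Q_prime ?R w) = (\<lambda>g. if g \<in> ?P then poly (kostka_foulkes g ?R) w else 0)"
    by (rule coeff) (simp add: Q_prime_def rect)
  have RP: "?R \<in> ?P"
  proof -
    have "is_partition ?R" by (rule is_partitionI[of _ N]) (auto simp: rect_def)
    then show ?thesis using rect by (simp add: partitions_of_def)
  qed
  let ?s = "(-1) ^ ((N - 1) * m) :: complex"
  have val: "schur g N ((^) w) = poly (kostka_foulkes g ?R) w * ?s" if g: "g \<in> ?P" for g
  proof -
    have "schur g N ((^) w) = (\<Sum>nu\<in>?P. poly (kostka_foulkes g nu) w * hall_littlewood_P nu w N ((^) w))"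
      by (rule kostka_foulkes_expansion[OF g primitive_root_powers_inj[OF w]])
    also have "\<dots> = (\<Sum>nu\<in>?P. if ?R = nu then poly (kostka_foulkes g ?R) w * ?s else 0)"
      by (rule sum.cong) (auto simp: hall_littlewood_primitive_root[OF N w])
    also have "\<dots> = poly (kostka_foulkes g ?R) w * ?s"
      using RP finite_partitions_of by simp
    finally show ?thesis .
  qed
  have "skew_kostka_foulkes lam mu ?R w = (\<Sum>g\<in>?P. c0 g * poly (kostka_foulkes g ?R) w)"
    unfolding skew_kostka_foulkes_def hall_inner_def coeff[OF c0] Q
    by (rule sum.mono_neutral_cong_left[OF finite_partitions_of]) auto
  moreover have "skew_schur lam mu N ((^) w) = (\<Sum>g\<in>?P. c0 g * poly (kostka_foulkes g ?R) w) * ?s"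
    unfolding c0 sum_distrib_right by (intro sum.cong refl) (simp add: val)
  moreover have "?s * ?s = 1" by (simp flip: power_add mult_2)
  ultimately show ?thesis by (simp only: mult.left_commute[of ?s] mult_1_right)
qed


section \<open>Border strips, cores and bead moves\<close>

definition bead_move :: "nat \<Rightarrow> nat set \<Rightarrow> nat set \<Rightarrow> bool" where
  "bead_move N B C \<longleftrightarrow> (\<exists>b\<in>B. N \<le> b \<and> b - N \<notin> B \<and> C = insert (b - N) (B - {b}))"

lemma in_cells: "(i, j) \<in> cells lam mu \<longleftrightarrow> mu i \<le> j \<and> j < lam i"
  by (simp add: cells_def)

text \<open>On a path of adjacent cells from c to d, the step that leaves the rows up to i is
  vertical and yields the shared column.\<close>

lemma connected_cells_crossing:
  assumes con: "connected_cells Q" and c: "c \<in> Q" "fst c \<le> i" and d: "d \<in> Q" "i < fst d"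
  shows "\<exists>j. (i, j) \<in> Q \<and> (Suc i, j) \<in> Q"
proof (rule ccontr)
  assume neg: "\<not> ?thesis"
  let ?R = "\<lambda>a b. a \<in> Q \<and> b \<in> Q \<and> adjacent_cells a b"
  have "?R\<^sup>*\<^sup>* c d" using con c d by (simp add: connected_cells_def)
  then have "fst d \<le> i"
  proof (induction rule: rtranclp_induct)
    case base
    then show ?case by (rule c(2))
  next
    case (step y z)
    show ?case
    proof (rule ccontr)
      assume "\<not> fst z \<le> i"
      then have "snd y = snd z" "fst y = i" "fst z = Suc i" using step.IH step.hyps(2) by (auto simp: adjacent_cells_def)
      then have yz: "y = (i, snd y)" "z = (Suc i, snd y)" by (simp_all add: prod_eq_iff)
      have "y \<in> Q" "z \<in> Q" using step.hyps(2) by blast+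
      then have "(i, snd y) \<in> Q \<and> (Suc i, snd y) \<in> Q" using yz by argo
      then show False using neg by blast
    qed
  qed
  then show False using d(2) by simp
qed

text \<open>In a border strip consecutive rows overlap in exactly one column, which determines all rows
  of the inner shape except the last.\<close>

lemma border_strip_rows:
  assumes bs: "border_strip lam mu" and ne: "lam \<noteq> mu"
  obtains i k where "i \<le> k" "\<And>j. j < i \<Longrightarrow> mu j = lam j" "\<And>j. k < j \<Longrightarrow> mu j = lam j"
    "\<And>j. i \<le> j \<Longrightarrow> j < k \<Longrightarrow> lam (Suc j) = Suc (mu j)" "mu k < lam k"
proof -
  have sk: "skew_partition lam mu" and con: "connected_cells (cells lam mu)"
    and sq: "\<And>i j. \<not> {(i, j), (i, Suc j), (Suc i, j), (Suc i, Suc j)} \<subseteq> cells lam mu"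
    using bs by (auto simp: border_strip_def)
  note p = skew_partitionD[OF sk]
  let ?S = "{j. mu j < lam j}"
  have "?S \<noteq> {}"
  proof
    assume "?S = {}"
    then have "\<not> mu j < lam j" for j by blast
    then have "lam j = mu j" for j using p(3)[of j] by (meson le_antisym not_less)
    then show False using ne by blast
  qed
  have finS: "finite ?S"
    by (rule finite_subset[of _ "{i. lam i \<noteq> 0}"]) (use p(1) in \<open>auto simp: is_partition_def\<close>)
  define i where "i = Min ?S"
  define k where "k = Max ?S"
  have iS: "mu i < lam i" and kS: "mu k < lam k"
    using Min_in[OF finS \<open>?S \<noteq> {}\<close>] Max_in[OF finS \<open>?S \<noteq> {}\<close>] by (auto simp: i_def k_def)
  have out: "mu j = lam j" if "j < i \<or> k < j" for j
  proof (rule ccontr)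
    assume "mu j \<noteq> lam j"
    then have "j \<in> ?S" using p(3)[of j] by simp
    then have "i \<le> j" "j \<le> k" unfolding i_def k_def using finS by auto
    then show False using that by simp
  qed
  have step: "lam (Suc j) = Suc (mu j)" if j: "i \<le> j" "j < k" for j
  proof -
    obtain c where c: "(j, c) \<in> cells lam mu" "(Suc j, c) \<in> cells lam mu"
      using connected_cells_crossing[OF con, of "(i, mu i)" j "(k, mu k)"] iS kS j by (auto simp: in_cells)
    then have lt: "mu j < lam (Suc j)" by (simp add: in_cells)
    \<comment> \<open>An overlap in two columns would contain a 2 x 2 square.\<close>
    have "\<not> Suc (mu j) < lam (Suc j)"
    proof
      assume "Suc (mu j) < lam (Suc j)"
      then have "{(j, mu j), (j, Suc (mu j)), (Suc j, mu j), (Suc j, Suc (mu j))} \<subseteq> cells lam mu"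
        using is_partition_le[OF p(1), of j "Suc j"] is_partition_le[OF p(2), of j "Suc j"] by (simp add: in_cells)
      then show False using sq by blast
    qed
    then show ?thesis using lt by simp
  qed
  show ?thesis
  proof (rule that[of i k])
    show "i \<le> k" unfolding k_def using iS by (intro Max_ge finS) simp
  qed (use out step kS in auto)
qed

definition shifted_beads :: "(nat \<Rightarrow> nat) \<Rightarrow> nat \<Rightarrow> nat \<Rightarrow> nat" where
  "shifted_beads p r i = p i + (r - 1 - i)"

lemma beads_shifted: "beads r p = shifted_beads p r ` {..<r}"
  by (simp add: beads_def shifted_beads_def)

lemma shifted_beads_less:
  assumes "is_partition p" "i < j" "j < r"
  shows "shifted_beads p r j < shifted_beads p r i"
  unfolding shifted_beads_def by (rule lexdec_1D[OF lexdec_beads[OF assms(1)] assms(2,3)])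

text \<open>Removing a border strip and moving a bead up by one row both amount to the bead with index \<open>i\<close>
  jumping over the following \<open>k - i\<close> beads.\<close>

definition bead_jump :: "nat \<Rightarrow> nat \<Rightarrow> (nat \<Rightarrow> nat) \<Rightarrow> (nat \<Rightarrow> nat) \<Rightarrow> nat \<Rightarrow> nat \<Rightarrow> bool" where
  "bead_jump N r lam mu i k \<longleftrightarrow> i \<le> k \<and> k < r \<and> (\<forall>j. j < i \<or> k < j \<longrightarrow> mu j = lam j) \<and>
     (\<forall>j. i \<le> j \<and> j < k \<longrightarrow> shifted_beads mu r j = shifted_beads lam r (Suc j)) \<and>
     shifted_beads mu r k + N = shifted_beads lam r i"

lemma bead_jumpD:
  assumes "bead_jump N r lam mu i k"
  shows "i \<le> k" "k < r" "shifted_beads mu r k + N = shifted_beads lam r i"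
    "j < i \<or> k < j \<Longrightarrow> mu j = lam j"
    "i \<le> j \<Longrightarrow> j < k \<Longrightarrow> shifted_beads mu r j = shifted_beads lam r (Suc j)"
  using assms unfolding bead_jump_def by blast+

lemma bead_jump_shift:
  assumes "bead_jump N r lam mu i k" "i \<le> j" "j < k"
  shows "lam (Suc j) = Suc (mu j)"
proof -
  have "mu j + (r - 1 - j) = lam (Suc j) + (r - 1 - Suc j)" "k < r"
    using bead_jumpD(2,5)[OF assms(1)] assms(2,3) unfolding shifted_beads_def by blast+
  then show ?thesis using assms(3) by linarith
qed

lemma bead_jump_size:
  assumes "bead_jump N r lam mu i k" "is_partition lam" "is_partition mu" "plength lam \<le> r" "plength mu \<le> r"
  shows "psize mu + N = psize lam"
proof -
  note b = bead_jumpD[OF assms(1)]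
  let ?m = "shifted_beads mu r" and ?l = "shifted_beads lam r"
  have split: "sum f {..<r} = sum f {..<i} + sum f {i..<Suc k} + sum f {Suc k..<r}" for f :: "nat \<Rightarrow> nat"
  proof -
    have "{..<r} = {..<i} \<union> {i..<Suc k} \<union> {Suc k..<r}" using b by auto
    then have "sum f {..<r} = sum f ({..<i} \<union> {i..<Suc k} \<union> {Suc k..<r})" by simp
    also have "\<dots> = sum f ({..<i} \<union> {i..<Suc k}) + sum f {Suc k..<r}" by (rule sum.union_disjoint) (use b in auto)
    also have "sum f ({..<i} \<union> {i..<Suc k}) = sum f {..<i} + sum f {i..<Suc k}" by (rule sum.union_disjoint) auto
    finally show ?thesis .
  qed
  have "sum ?m {i..<Suc k} + N = sum ?m {i..<k} + (?m k + N)" using b(1) by simp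
  also have "sum ?m {i..<k} = (\<Sum>j\<in>{i..<k}. ?l (Suc j))" by (rule sum.cong) (use b(5) in auto)
  also have "(\<Sum>j\<in>{i..<k}. ?l (Suc j)) = sum ?l {Suc i..<Suc k}" by (rule sum.shift_bounds_Suc_ivl[symmetric])
  also have "sum ?l {Suc i..<Suc k} + (?m k + N) = sum ?l {i..<Suc k}"
  proof -
    have "sum ?l {i..<Suc k} = ?l i + sum ?l {Suc i..<Suc k}"
      by (rule sum.atLeast_Suc_lessThan) (use b(1) in simp)
    then show ?thesis unfolding b(3) by (simp only: add.commute)
  qed
  finally have mid: "sum ?m {i..<Suc k} + N = sum ?l {i..<Suc k}" .
  have lo: "sum ?m {..<i} = sum ?l {..<i}" "sum ?m {Suc k..<r} = sum ?l {Suc k..<r}"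
    using b(4) by (auto simp: shifted_beads_def intro!: sum.cong)
  have "sum ?m {..<r} + N = sum ?l {..<r}" unfolding split[of ?m] split[of ?l] lo using mid by simp
  then show ?thesis
    unfolding shifted_beads_def sum.distrib psize_eq[OF assms(2,4)] psize_eq[OF assms(3,5)] by simp
qed

text \<open>The beads i + 1 to k keep their positions and change only their indices, so as sets the
  bead of index i is replaced by one N positions earlier. That place was free, as otherwise mu would
  have too few beads.\<close>

lemma bead_jump_beads:
  assumes "bead_jump N r lam mu i k" "is_partition lam" "is_partition mu" "N > 0"
  shows "bead_move N (beads r lam) (beads r mu)"
proof -
  note b = bead_jumpD[OF assms(1)]
  let ?m = "shifted_beads mu r" and ?l = "shifted_beads lam r"
  have injl: "inj_on ?l {..<r}" and injm: "inj_on ?m {..<r}"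
    using lexdec_inj_on[OF lexdec_beads[OF assms(2), of r]] lexdec_inj_on[OF lexdec_beads[OF assms(3), of r]]
    by (simp_all add: shifted_beads_def[abs_def])
  have split: "{..<r} = insert k ({..<i} \<union> {i..<k} \<union> {Suc k..<r})" using b by auto
  have split': "{..<r} - {i} = {..<i} \<union> Suc ` {i..<k} \<union> {Suc k..<r}"
    using b by (auto simp: image_Suc_atLeastLessThan)
  have mid: "?m ` {i..<k} = ?l ` Suc ` {i..<k}" unfolding image_image by (rule image_cong) (use b(5) in auto)
  have lo: "?m ` {..<i} = ?l ` {..<i}" "?m ` {Suc k..<r} = ?l ` {Suc k..<r}"
    using b(4) by (auto simp: shifted_beads_def intro!: image_cong)
  have bm: "?m ` {..<r} = insert (?m k) (?l ` ({..<r} - {i}))"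
    unfolding split' by (subst split) (simp only: image_insert image_Un lo mid)
  have "?l ` ({..<r} - {i}) = ?l ` {..<r} - {?l i}"
    using inj_on_image_set_diff[OF injl, of "{..<r}" "{i}"] b by auto
  then have eq: "beads r mu = insert (?m k) (beads r lam - {?l i})" unfolding beads_shifted bm by simp
  have "?m k \<notin> beads r lam"
  proof
    assume "?m k \<in> beads r lam"
    moreover have "?m k \<noteq> ?l i" using b(3) assms(4) by simp
    ultimately have "beads r mu = beads r lam - {?l i}" unfolding eq by auto
    moreover have "?l i \<in> beads r lam" unfolding beads_shifted using b by auto
    ultimately have "card (beads r mu) < card (beads r lam)" by (metis card_Diff1_less finite_beads)
    then show False using assms by simp
  qed
  moreover have "?m k = ?l i - N" "N \<le> ?l i" using b(3) by linarith+
  moreover have "?l i \<in> beads r lam" unfolding beads_shifted using b by auto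
  ultimately show ?thesis unfolding bead_move_def using eq by metis
qed

lemma remove_strip_bead_jump:
  assumes rs: "remove_strip N lam mu" and N: "N > 0" and r: "plength lam \<le> r"
  obtains i k where "bead_jump N r lam mu i k"
proof -
  have bs: "border_strip lam mu" and size: "skew_size lam mu = N" using rs by (auto simp: remove_strip_def)
  have sk: "skew_partition lam mu" using bs by (simp add: border_strip_def)
  note p = skew_partitionD[OF sk]
  have "lam \<noteq> mu" using size N by (auto simp: skew_size_def)
  then obtain i k where ik: "i \<le> k" "\<And>j. j < i \<Longrightarrow> mu j = lam j" "\<And>j. k < j \<Longrightarrow> mu j = lam j"
    "\<And>j. i \<le> j \<Longrightarrow> j < k \<Longrightarrow> lam (Suc j) = Suc (mu j)" "mu k < lam k"
    using border_strip_rows[OF bs] by blast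
  have kr: "k < r"
  proof (rule ccontr)
    assume "\<not> k < r"
    then show False using is_partition_zero_ge[OF p(1) r, of k] ik(5) by simp
  qed
  let ?m = "shifted_beads mu r" and ?l = "shifted_beads lam r"
  have step: "?m j = ?l (Suc j)" if "i \<le> j" "j < k" for j
    using ik(4)[OF that] that kr by (simp add: shifted_beads_def)
  have lek: "?m k \<le> ?l i"
  proof -
    have "?m k < ?l k" using ik(5) by (simp add: shifted_beads_def)
    also have "?l k \<le> ?l i" using shifted_beads_less[OF p(1), of i k r] ik(1) kr by (cases "i = k") auto
    finally show ?thesis by simp
  qed
  \<comment> \<open>The length of the jump is first left open and then identified with N by
    comparing sizes.\<close>
  have j: "bead_jump (?l i - ?m k) r lam mu i k"
    unfolding bead_jump_def using ik(1-3) kr step lek by auto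
  have "psize mu + (?l i - ?m k) = psize lam"
    by (rule bead_jump_size[OF j p(1,2) r]) (use p(4) r in simp)
  then have "?l i - ?m k = N" using size skew_size_diff[OF sk] by simp
  with j have "bead_jump N r lam mu i k" by simp
  then show ?thesis by (rule that)
qed

text \<open>For connectedness, go left from any cell to the start of its row x, then down in column
  \<open>mu x\<close>, which the next row shares, and so on until (k, mu k). A 2 x 2 square is
  impossible because consecutive rows overlap in one column.\<close>

lemma bead_jump_remove_strip:
  assumes j: "bead_jump N r lam mu i k" and N: "N > 0" and p: "is_partition lam" "is_partition mu"
    and r: "plength lam \<le> r" "plength mu \<le> r"
  shows "remove_strip N lam mu"
proof -
  note b = bead_jumpD[OF j]
  have step: "lam (Suc j) = Suc (mu j)" if "i \<le> j" "j < k" for j by (rule bead_jump_shift[OF j that])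
  have lt: "mu j < lam j" if "i \<le> j" "j < k" for j
    using step[OF that] is_partition_le[OF p(1), of j "Suc j"] by simp
  have ltk: "mu k < lam k"
  proof (cases "i = k")
    case True
    then show ?thesis using b(3) N by (simp add: shifted_beads_def)
  next
    case False
    then obtain k' where k': "k = Suc k'" "i \<le> k'" using b(1) by (cases k) auto
    have "mu k \<le> mu k'" using is_partition_le[OF p(2), of k' k] k' by simp
    then show ?thesis using step[of k'] k' by simp
  qed
  have le: "mu j \<le> lam j" for j
  proof -
    consider "j < i \<or> k < j" | "i \<le> j" "j < k" | "j = k" by linarith
    then show ?thesis using lt[of j] ltk b(4)[of j] by cases auto
  qed
  have sk: "skew_partition lam mu" using p le by (simp add: skew_partition_def)
  have rows: "i \<le> x \<and> x \<le> k" if "(x, y) \<in> cells lam mu" for x y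
    using that b(4)[of x] by (auto simp: in_cells not_less[symmetric])
  let ?R = "\<lambda>a b. a \<in> cells lam mu \<and> b \<in> cells lam mu \<and> adjacent_cells a b"
  have symR: "symp ?R" by (auto simp: symp_def adjacent_cells_def)
  have row: "?R\<^sup>*\<^sup>* (x, y) (x, mu x)" if "(x, y) \<in> cells lam mu" for x y
    using that
  proof (induction y)
    case 0
    then show ?case by (simp add: in_cells)
  next
    case (Suc y)
    show ?case
    proof (cases "mu x = Suc y")
      case False
      then have "(x, y) \<in> cells lam mu" using Suc.prems by (simp add: in_cells)
      moreover have "?R (x, Suc y) (x, y)" using Suc.prems calculation by (simp add: adjacent_cells_def)
      ultimately show ?thesis using Suc.IH converse_rtranclp_into_rtranclp[of ?R "(x, Suc y)" "(x, y)"] by blast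
    qed simp
  qed
  have col: "?R\<^sup>*\<^sup>* (x, mu x) (k, mu k)" if "i \<le> x" "x \<le> k" for x
    using that(2,1)
  proof (induction rule: inc_induct)
    case (step x)
    have "lam (Suc x) = Suc (mu x)" using step.hyps step.prems assms(1) bead_jump_shift by blast
    moreover have "mu (Suc x) \<le> mu x" using is_partition_le[OF p(2), of x "Suc x"] by simp
    moreover have "mu x < lam x" using lt[of x] step.hyps step.prems by blast
    ultimately have c: "(x, mu x) \<in> cells lam mu" "(Suc x, mu x) \<in> cells lam mu" by (simp_all add: in_cells)
    then have "?R (x, mu x) (Suc x, mu x)" by (simp add: adjacent_cells_def)
    then have "?R\<^sup>*\<^sup>* (x, mu x) (Suc x, mu (Suc x))" using row[OF c(2)] converse_rtranclp_into_rtranclp[of ?R] by blast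
    moreover have "?R\<^sup>*\<^sup>* (Suc x, mu (Suc x)) (k, mu k)" by (rule step.IH) (use step.prems in simp)
    ultimately show ?case by (rule rtranclp_trans)
  qed simp
  have base: "?R\<^sup>*\<^sup>* c (k, mu k)" if "c \<in> cells lam mu" for c
  proof -
    obtain x y where c: "c = (x, y)" by (cases c)
    then have xy: "(x, y) \<in> cells lam mu" using that by simp
    show ?thesis unfolding c using rtranclp_trans[OF row[OF xy] col] rows[OF xy] by blast
  qed
  have "connected_cells (cells lam mu)"
    unfolding connected_cells_def
  proof (intro ballI)
    fix c d assume cd: "c \<in> cells lam mu" "d \<in> cells lam mu"
    have "?R\<^sup>*\<^sup>* (k, mu k) d" using base[OF cd(2)] sympD[OF symp_rtranclp[OF symR]] by blast
    then show "?R\<^sup>*\<^sup>* c d" using base[OF cd(1)] by (rule rtranclp_trans[rotated])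
  qed
  moreover have "\<not> (\<exists>x y. {(x, y), (x, Suc y), (Suc x, y), (Suc x, Suc y)} \<subseteq> cells lam mu)"
  proof
    assume "\<exists>x y. {(x, y), (x, Suc y), (Suc x, y), (Suc x, Suc y)} \<subseteq> cells lam mu"
    then obtain x y where c: "(x, y) \<in> cells lam mu" "(Suc x, Suc y) \<in> cells lam mu" by auto
    have "i \<le> x" "x < k" using rows[OF c(1)] rows[OF c(2)] by auto
    then have "lam (Suc x) = Suc (mu x)" by (rule step)
    then show False using c by (simp add: in_cells)
  qed
  ultimately have "border_strip lam mu" using sk by (simp add: border_strip_def)
  moreover have "skew_size lam mu = N" using bead_jump_size[OF j p r] skew_size_diff[OF sk] by simp
  ultimately show ?thesis by (simp add: remove_strip_def)
qed

lemma bead_move_bead_jump: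
  assumes p: "is_partition lam" "plength lam \<le> r" and mv: "bead_move N (beads r lam) C" and N: "N > 0"
  obtains mu i k where "is_partition mu" "plength mu \<le> r" "beads r mu = C" "bead_jump N r lam mu i k"
proof -
  let ?l = "shifted_beads lam r"
  obtain b where b: "b \<in> beads r lam" "N \<le> b" "b - N \<notin> beads r lam" "C = insert (b - N) (beads r lam - {b})"
    using mv by (auto simp: bead_move_def)
  obtain i where i: "i < r" "b = ?l i" using b(1) by (auto simp: beads_shifted)
  \<comment> \<open>The last bead still beyond the target position: the moved bead receives index k,
    and the beads i + 1 to k each take the preceding index.\<close>
  define k where "k = Max {j. j < r \<and> b - N < ?l j}"
  let ?S = "{j. j < r \<and> b - N < ?l j}"
  have iS: "i \<in> ?S" using i b(2) N by simp
  have finS: "finite ?S" by simp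
  have "k \<in> ?S" unfolding k_def by (rule Max_in[OF finS]) (use iS in blast)
  then have kS: "k < r" "b - N < ?l k" by blast+
  have ik: "i \<le> k" unfolding k_def by (rule Max_ge[OF finS iS])
  have dec: "?l y < ?l x" if "x < y" "y < r" for x y by (rule shifted_beads_less[OF p(1) that])
  have after: "?l j < b - N" if "k < j" "j < r" for j
  proof -
    have "j \<notin> ?S"
    proof
      assume "j \<in> ?S"
      then have "j \<le> k" unfolding k_def by (rule Max_ge[OF finS])
      then show False using that(1) by simp
    qed
    moreover have "?l j \<noteq> b - N"
    proof
      have "?l j \<in> beads r lam" unfolding beads_shifted using that(2) by blast
      moreover assume "?l j = b - N"
      ultimately show False using b(3) by simp
    qed
    ultimately show ?thesis using that by simp
  qed
  define m where "m j = (if j < i then ?l j else if j < k then ?l (Suc j) else if j = k then b - N else ?l j)" for j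
  have mdec: "m y < m x" if "x < y" "y < r" for x y
  proof -
    consider "y < i" | "x < i" "i \<le> y" | "i \<le> x" "y < k" | "i \<le> x" "x < k" "k \<le> y" | "k \<le> x" using that by linarith
    then show ?thesis
    proof cases
      case 1
      then show ?thesis using dec[OF that] that by (simp add: m_def)
    next
      case 2
      have "m y \<le> ?l y"
        using dec[of y "Suc y"] kS 2 by (cases "y < k"; cases "y = k") (auto simp: m_def)
      also have "\<dots> < ?l x" by (rule dec[OF that])
      finally show ?thesis using 2 by (simp add: m_def)
    next
      case 3
      then show ?thesis using dec[of "Suc x" "Suc y"] that kS by (simp add: m_def)
    next
      case 4
      have "m y \<le> b - N" using after[of y] 4 that ik by (cases "y = k") (auto simp: m_def)
      also have "\<dots> < ?l (Suc x)"
        using kS dec[of "Suc x" k] 4 by (cases "Suc x = k") auto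
      finally show ?thesis using 4 by (simp add: m_def)
    next
      case 5
      then show ?thesis using after[of y] dec[OF that] that ik by (cases "x = k") (auto simp: m_def)
    qed
  qed
  have lexm: "lexdec (Suc 0) r m" unfolding lexdec_def using mdec by simp
  define M where "M = m ` {..<r}"
  have enM: "card M = r" "\<And>j. j < r \<Longrightarrow> bead_enum (Suc 0) M j = m j"
    using bead_enum_eqI[OF lexm M_def[symmetric]] i(1) by blast+
  have fM: "finite M" by (simp add: M_def)
  define mu where "mu = of_beads r M"
  have mu: "is_partition mu" "plength mu \<le> r" "beads r mu = M"
    unfolding mu_def by (rule is_partition_of_beads[OF fM enM(1)] plength_of_beads[OF fM enM(1)] beads_of_beads[OF fM enM(1)])+
  have smu: "shifted_beads mu r j = m j" if "j < r" for j
    using of_beads_add[OF fM enM(1) that] enM(2)[OF that] by (simp add: shifted_beads_def mu_def)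
  have jump: "bead_jump N r lam mu i k"
    unfolding bead_jump_def
  proof (intro conjI allI impI)
    fix j assume j: "j < i \<or> k < j"
    show "mu j = lam j"
    proof (cases "j < r")
      case True
      then have "shifted_beads mu r j = ?l j" using smu[OF True] j ik by (auto simp: m_def)
      then show ?thesis by (simp add: shifted_beads_def)
    next
      case False
      then show ?thesis using is_partition_zero_ge[OF mu(1,2), of j] is_partition_zero_ge[OF p, of j] by simp
    qed
  next
    fix j assume "i \<le> j \<and> j < k"
    then show "shifted_beads mu r j = shifted_beads lam r (Suc j)" using smu[of j] kS by (simp add: m_def)
  next
    show "shifted_beads mu r k + N = shifted_beads lam r i" using smu[OF kS(1)] ik b(2) i by (simp add: m_def)
  qed (use ik kS in auto)
  have "?l i = b" using i by simp
  have "M = C"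
  proof (rule card_subset_eq[symmetric, OF fM])
    show "C \<subseteq> M"
    proof
      fix x assume "x \<in> C"
      then consider "x = b - N" | "x \<in> beads r lam" "x \<noteq> b" using b(4) by blast
      then show "x \<in> M"
      proof cases
        case 1
        then show ?thesis unfolding M_def using kS ik by (intro image_eqI[of _ _ k]) (auto simp: m_def)
      next
        case 2
        then obtain j where j: "j < r" "x = ?l j" "j \<noteq> i" using i by (auto simp: beads_shifted)
        consider "j < i" | "i < j" "j \<le> k" | "k < j" using j(3) by linarith
        then show ?thesis
        proof cases
          case 1
          then show ?thesis unfolding M_def using j by (intro image_eqI[of _ _ j]) (auto simp: m_def)
        next
          case 2
          then show ?thesis unfolding M_def using j by (intro image_eqI[of _ _ "j - 1"]) (auto simp: m_def)
        next
          case 3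
          then show ?thesis unfolding M_def using j ik by (intro image_eqI[of _ _ j]) (auto simp: m_def)
        qed
      qed
    qed
    have "card C = Suc (card (beads r lam - {b}))" unfolding b(4) using b(3) by (subst card_insert_disjoint) auto
    also have "\<dots> = card (beads r lam)" by (rule card_Suc_Diff1[OF finite_beads b(1)])
    finally show "card C = card M" using enM(1) p(1) by simp
  qed
  then show ?thesis using that[OF mu(1,2)] mu(3) jump by blast
qed

lemma remove_strip_bead_move:
  assumes rs: "remove_strip N lam mu" and N: "N > 0" and r: "plength lam \<le> r"
  shows "bead_move N (beads r lam) (beads r mu)" "is_partition mu" "plength mu \<le> r" "psize mu < psize lam"
proof -
  have bs: "border_strip lam mu" and size: "skew_size lam mu = N" using rs by (auto simp: remove_strip_def)
  then have sk: "skew_partition lam mu" by (simp add: border_strip_def)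
  note p = skew_partitionD[OF sk]
  obtain i k where "bead_jump N r lam mu i k" using remove_strip_bead_jump[OF rs N r] .
  then show "bead_move N (beads r lam) (beads r mu)" by (rule bead_jump_beads[OF _ p(1,2) N])
  show "is_partition mu" "plength mu \<le> r" using p r by auto
  show "psize mu < psize lam" using skew_size_diff[OF sk] size N by simp
qed

section \<open>Runners and cores\<close>

definition runner_rows :: "nat \<Rightarrow> nat set \<Rightarrow> nat \<Rightarrow> nat set" where
  "runner_rows N B c = {row. row * N + c \<in> B}"

lemma finite_runner_rows:
  assumes "finite B" "N > 0" shows "finite (runner_rows N B c)"
proof -
  have "inj_on (\<lambda>row. row * N + c) (runner_rows N B c)" using assms(2) by (auto simp: inj_on_def)
  moreover have "finite ((\<lambda>row. row * N + c) ` runner_rows N B c)"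
    by (rule finite_subset[OF _ assms(1)]) (auto simp: runner_rows_def)
  ultimately show ?thesis by (rule finite_imageD[rotated])
qed

text \<open>A shift by N keeps the residue: on the runner of the moved bead one row is exchanged for
  the preceding one, and the other runners are untouched.\<close>

lemma bead_move_card_runner:
  assumes mv: "bead_move N B C" and N: "N > 0" and fin: "finite B" and c: "c < N"
  shows "card (runner_rows N C c) = card (runner_rows N B c)"
proof -
  obtain b where b: "b \<in> B" "N \<le> b" "b - N \<notin> B" "C = insert (b - N) (B - {b})"
    using mv by (auto simp: bead_move_def)
  have iff: "row * N + c = x \<longleftrightarrow> row = x div N \<and> c = x mod N" for row x using c by auto
  obtain d where "b = N + d" using b(2) le_Suc_ex by blast
  then have dm: "(b - N) div N = b div N - 1" "(b - N) mod N = b mod N" "b div N \<ge> 1"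
    using N by simp_all
  show ?thesis
  proof (cases "c = b mod N")
    case True
    let ?q = "b div N"
    have "row \<in> runner_rows N C c \<longleftrightarrow> row \<in> insert (?q - 1) (runner_rows N B c - {?q})" for row
      unfolding runner_rows_def b(4) mem_Collect_eq insert_iff Diff_iff iff dm using True by blast
    then have "runner_rows N C c = insert (?q - 1) (runner_rows N B c - {?q})" by blast
    moreover have "?q - 1 \<notin> runner_rows N B c"
    proof -
      have "(?q - 1) * N + c = b - N" unfolding iff dm using True by blast
      then show ?thesis using b(3) by (simp add: runner_rows_def)
    qed
    moreover have "?q \<in> runner_rows N B c"
    proof -
      have "?q * N + c = b" by (simp add: True)
      then show ?thesis using b(1) by (simp add: runner_rows_def)
    qed
    ultimately show ?thesis using finite_runner_rows[OF fin N, of c]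
      using card_Suc_Diff1[of "runner_rows N B c" ?q] by (simp del: card_Diff_insert)
  next
    case False
    then have "row \<in> runner_rows N C c \<longleftrightarrow> row \<in> runner_rows N B c" for row
      unfolding runner_rows_def b(4) mem_Collect_eq insert_iff Diff_iff iff dm by blast
    then have "runner_rows N C c = runner_rows N B c" by blast
    then show ?thesis by simp
  qed
qed

lemma remove_strips_card_runner:
  assumes "(remove_strip N)\<^sup>*\<^sup>* lam kap" and N: "N > 0" and p: "is_partition lam" "plength lam \<le> r" and c: "c < N"
  shows "is_partition kap \<and> plength kap \<le> r \<and> card (runner_rows N (beads r kap) c) = card (runner_rows N (beads r lam) c)"
  using assms(1)
proof (induction rule: rtranclp_induct)
  case base
  then show ?case using p by simp
next
  case (step y z)
  have y: "plength y \<le> r" using step.IH by simp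
  note m = remove_strip_bead_move[OF step.hyps(2) N y]
  show ?case using m(2,3) bead_move_card_runner[OF m(1) N finite_beads c] step.IH by simp
qed

lemma core_exists:
  assumes N: "N > 0" and "is_partition lam"
  shows "\<exists>kap. is_core_of N lam kap"
  using assms(2)
proof (induction "psize lam" arbitrary: lam rule: less_induct)
  case less
  show ?case
  proof (cases "\<exists>rho. remove_strip N lam rho")
    case True
    then obtain rho where rho: "remove_strip N lam rho" by blast
    note m = remove_strip_bead_move[OF rho N order_refl]
    obtain kap where "is_core_of N rho kap" using less.hyps[OF m(4,2)] by blast
    then have "is_core_of N lam kap" using rho by (auto simp: is_core_of_def intro: converse_rtranclp_into_rtranclp)
    then show ?thesis by blast
  next
    case False
    then show ?thesis unfolding is_core_of_def by blast
  qed
qed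

text \<open>A gap directly above a bead on its runner would allow a bead move, hence the removal of
  a border strip, which a core excludes.\<close>

lemma core_runner_flush:
  assumes N: "N > 0" and p: "is_partition kap" "plength kap \<le> r" and core: "\<not> (\<exists>rho. remove_strip N kap rho)" and c: "c < N"
  shows "runner_rows N (beads r kap) c = {..<card (runner_rows N (beads r kap) c)}"
proof (rule lessThan_card_of_downward_closed)
  show "finite (runner_rows N (beads r kap) c)" by (rule finite_runner_rows[OF finite_beads N])
  have step: "i \<in> runner_rows N (beads r kap) c" if i: "Suc i \<in> runner_rows N (beads r kap) c" for i
  proof (rule ccontr)
    assume ni: "i \<notin> runner_rows N (beads r kap) c"
    let ?b = "Suc i * N + c"
    have "?b \<in> beads r kap" "?b - N \<notin> beads r kap" "N \<le> ?b" using i ni by (auto simp: runner_rows_def)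
    then have "bead_move N (beads r kap) (insert (?b - N) (beads r kap - {?b}))" unfolding bead_move_def by blast
    then show False
    proof (rule bead_move_bead_jump[OF p _ N])
      fix mu i k assume "is_partition mu" "plength mu \<le> r" "bead_jump N r kap mu i k"
      then have "remove_strip N kap mu" using bead_jump_remove_strip[OF _ N p(1) _ p(2)] by blast
      then show False using core by blast
    qed
  qed
  fix i j assume "i \<in> runner_rows N (beads r kap) c" "j < i"
  then show "j \<in> runner_rows N (beads r kap) c"
  proof (induction i)
    case (Suc i)
    have "i \<in> runner_rows N (beads r kap) c" by (rule step[OF Suc.prems(1)])
    then show ?case using Suc by (cases "j = i") auto
  qed simp
qed

lemma beads_eq_if_runners_eq:
  assumes N: "N > 0" and "\<And>c. c < N \<Longrightarrow> runner_rows N B c = runner_rows N C c"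
  shows "B = C"
proof (rule Set.set_eqI)
  fix x
  have "x div N \<in> runner_rows N B (x mod N) \<longleftrightarrow> x div N \<in> runner_rows N C (x mod N)"
    using assms(2)[of "x mod N"] N by simp
  then show "x \<in> B \<longleftrightarrow> x \<in> C" by (simp add: runner_rows_def)
qed

text \<open>Strip removals preserve the number of beads on each runner, and in a core all runners
  are packed to the top, so these numbers determine the core.\<close>

theorem common_core_iff:
  assumes N: "N > 0" and lam: "is_partition lam" "plength lam \<le> r" and mu: "is_partition mu" "plength mu \<le> r"
  shows "(\<exists>kap. is_core_of N lam kap \<and> is_core_of N mu kap) \<longleftrightarrow>
    (\<forall>c<N. card (runner_rows N (beads r lam) c) = card (runner_rows N (beads r mu) c))"
proof
  assume "\<exists>kap. is_core_of N lam kap \<and> is_core_of N mu kap"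
  then obtain kap where k: "(remove_strip N)\<^sup>*\<^sup>* lam kap" "(remove_strip N)\<^sup>*\<^sup>* mu kap" by (auto simp: is_core_of_def)
  show "\<forall>c<N. card (runner_rows N (beads r lam) c) = card (runner_rows N (beads r mu) c)"
    using remove_strips_card_runner[OF k(1) N lam] remove_strips_card_runner[OF k(2) N mu] by simp
next
  assume eq: "\<forall>c<N. card (runner_rows N (beads r lam) c) = card (runner_rows N (beads r mu) c)"
  obtain kap where kap: "is_core_of N lam kap" using core_exists[OF N lam(1)] by blast
  obtain kap' where kap': "is_core_of N mu kap'" using core_exists[OF N mu(1)] by blast
  have a: "is_partition kap \<and> plength kap \<le> r \<and> card (runner_rows N (beads r kap) c) = card (runner_rows N (beads r lam) c)" if "c < N" for c
    by (rule remove_strips_card_runner[OF _ N lam that]) (use kap in \<open>simp add: is_core_of_def\<close>)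
  have b: "is_partition kap' \<and> plength kap' \<le> r \<and> card (runner_rows N (beads r kap') c) = card (runner_rows N (beads r mu) c)" if "c < N" for c
    by (rule remove_strips_card_runner[OF _ N mu that]) (use kap' in \<open>simp add: is_core_of_def\<close>)
  have pk: "is_partition kap" "plength kap \<le> r" "is_partition kap'" "plength kap' \<le> r" using a[OF N] b[OF N] by blast+
  have ck: "\<not> (\<exists>rho. remove_strip N kap rho)" "\<not> (\<exists>rho. remove_strip N kap' rho)" using kap kap' unfolding is_core_of_def by blast+
  have "beads r kap = beads r kap'"
  proof (rule beads_eq_if_runners_eq[OF N])
    fix c assume c: "c < N"
    let ?K = "runner_rows N (beads r kap) c" and ?K' = "runner_rows N (beads r kap') c"
    have "card ?K = card ?K'" using a[OF c] b[OF c] spec[OF eq, of c] c by linarith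
    have "?K = {..<card ?K}" by (rule core_runner_flush[OF N pk(1,2) ck(1) c])
    also have "\<dots> = {..<card ?K'}" unfolding \<open>card ?K = card ?K'\<close> ..
    also have "\<dots> = ?K'" by (rule core_runner_flush[OF N pk(3,4) ck(2) c, symmetric])
    finally show "?K = ?K'" .
  qed
  then have "kap = kap'" using beads_inject[OF pk(1,3,2,4)] by blast
  then show "\<exists>kap. is_core_of N lam kap \<and> is_core_of N mu kap" using kap kap' by blast
qed


section \<open>Quotients and interlacing beads\<close>

lemma strict_sorted_bead_enum:
  assumes "finite R" "j < card R"
  shows "rev (sorted_list_of_set R) ! j = bead_enum (Suc 0) R j"
proof -
  let ?xs = "rev (sorted_list_of_set R)"
  have len: "length ?xs = card R" by simp
  have "lexdec (Suc 0) (card R) (\<lambda>j. ?xs ! j)"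
    unfolding lexdec_def
  proof (intro allI impI disjI2)
    fix i j assume ij: "i < j \<and> j < card R"
    have "sorted_wrt (<) (sorted_list_of_set R)" by simp
    then have "sorted_wrt (\<lambda>x y. y < x) ?xs" by (simp only: sorted_wrt_rev)
    then have "?xs ! j < ?xs ! i" using ij len by (simp only: sorted_wrt_iff_nth_less)
    then show "?xs ! i mod Suc 0 = ?xs ! j mod Suc 0 \<and> ?xs ! j < ?xs ! i" by simp
  qed
  moreover have "(\<lambda>j. ?xs ! j) ` {..<card R} = R"
    using nth_image[of "card R" ?xs] len assms(1) by (simp add: lessThan_atLeast0)
  ultimately show ?thesis using bead_enum_eqI(2)[of "Suc 0" "card R" "\<lambda>j. ?xs ! j" R j] assms(2) by simp
qed

lemma runner_eq: "runner N r kap c = runner_rows N (beads r kap) c"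
  by (simp add: runner_def runner_rows_def)

text \<open>Among the rows above bead j of a runner with n beads, n - 1 - j are occupied, so the
  number of gaps is the row of the bead minus the staircase. The quotient part is therefore the
  partition whose bead set is the runner.\<close>

lemma quotient_part_of_beads:
  assumes N: "N > 0"
  shows "quotient_part N r kap c = of_beads (card (runner_rows N (beads r kap) c)) (runner_rows N (beads r kap) c)"
proof
  fix j
  let ?R = "runner_rows N (beads r kap) c"
  let ?n = "card ?R"
  let ?e = "bead_enum (Suc 0) ?R"
  have fin: "finite ?R" by (rule finite_runner_rows[OF finite_beads N])
  show "quotient_part N r kap c j = of_beads ?n ?R j"
  proof (cases "j < ?n")
    case True
    have lex: "lexdec (Suc 0) ?n ?e" by (rule bead_enum_lexdec[OF fin])
    have im: "?e ` {..<?n} = ?R" using bead_enum_bij[OF fin, of "Suc 0"] by (simp add: bij_betw_def)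
    have eq: "{a. a < ?e j \<and> a \<notin> ?R} = {..<?e j} - ?e ` {j<..<?n}"
    proof (intro equalityI subsetI)
      fix a assume a: "a \<in> {..<?e j} - ?e ` {j<..<?n}"
      have "a \<notin> ?R"
      proof
        assume "a \<in> ?R"
        then have "a \<in> ?e ` {..<?n}" by (simp only: im)
        then obtain i where i: "i < ?n" "a = ?e i" by blast
        have "\<not> i \<le> j"
        proof
          assume "i \<le> j"
          then have "?e j \<le> ?e i" using lexdec_1D[OF lex, of i j] True by (cases "i = j") auto
          then show False using a i by simp
        qed
        then show False using a i by auto
      qed
      then show "a \<in> {a. a < ?e j \<and> a \<notin> ?R}" using a by simp
    next
      fix a assume a: "a \<in> {a. a < ?e j \<and> a \<notin> ?R}"
      have "?e ` {j<..<?n} \<subseteq> ?e ` {..<?n}" by (rule image_mono) auto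
      then have "?e ` {j<..<?n} \<subseteq> ?R" by (simp only: im)
      then show "a \<in> {..<?e j} - ?e ` {j<..<?n}" using a by blast
    qed
    have "inj_on ?e {j<..<?n}" by (rule inj_on_subset[OF lexdec_inj_on[OF lex]]) auto
    then have "card (?e ` {j<..<?n}) = ?n - 1 - j" by (simp add: card_image)
    moreover have "?e ` {j<..<?n} \<subseteq> {..<?e j}"
    proof (rule image_subsetI)
      fix i assume "i \<in> {j<..<?n}"
      then show "?e i \<in> {..<?e j}" using lexdec_1D[OF lex, of j i] by simp
    qed
    ultimately have "card {a. a < ?e j \<and> a \<notin> ?R} = ?e j - (?n - 1 - j)"
      unfolding eq by (subst card_Diff_subset) auto
    then show ?thesis
      using True unfolding quotient_part_def of_beads_def runner_eq strict_sorted_bead_enum[OF fin True] by simp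
  next
    case False
    then show ?thesis by (simp add: quotient_part_def of_beads_def runner_eq)
  qed
qed

text \<open>If lam (i+1) exceeded mu i, column \<open>mu i\<close> would meet rows i and i + 1; two
  rows further apart reduce to consecutive ones because lam decreases.\<close>

lemma horizontal_strip_iff:
  "horizontal_strip lam mu \<longleftrightarrow> skew_partition lam mu \<and> (\<forall>i. lam (Suc i) \<le> mu i)"
proof (intro iffI conjI allI)
  assume h: "horizontal_strip lam mu"
  then show sk: "skew_partition lam mu" by (simp add: horizontal_strip_def)
  note p = skew_partitionD[OF sk]
  fix i
  show "lam (Suc i) \<le> mu i"
  proof (rule ccontr)
    assume lt: "\<not> lam (Suc i) \<le> mu i"
    then have "(i, mu i) \<in> cells lam mu" "(Suc i, mu i) \<in> cells lam mu"
      using is_partition_le[OF p(1), of i "Suc i"] is_partition_le[OF p(2), of i "Suc i"] by (auto simp: in_cells)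
    then have "i = Suc i" using h unfolding horizontal_strip_def by blast
    then show False by simp
  qed
next
  assume a: "skew_partition lam mu \<and> (\<forall>i. lam (Suc i) \<le> mu i)"
  then have p: "is_partition lam" by (simp add: skew_partition_def)
  have *: False if "(i, j) \<in> cells lam mu" "(i', j) \<in> cells lam mu" "i < i'" for i i' j
  proof -
    have "lam i' \<le> lam (Suc i)" using is_partition_le[OF p, of "Suc i" i'] that(3) by simp
    also have "\<dots> \<le> mu i" using a by blast
    finally show False using that by (simp add: in_cells)
  qed
  show "horizontal_strip lam mu"
    unfolding horizontal_strip_def
  proof (intro conjI allI impI)
    show "skew_partition lam mu" using a by blast
    fix i i' j assume "(i, j) \<in> cells lam mu \<and> (i', j) \<in> cells lam mu"
    then show "i = i'" using *[of i j i'] *[of i' j i] by (meson linorder_neqE_nat)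
  qed
qed

text \<open>In the enumeration \<open>b\<close> of \<open>B\<close>, the beads on runner \<open>c\<close> form one block of consecutive indices.\<close>

lemma lexdec_runner:
  assumes lex: "lexdec N r b" and N: "N > 0" and c: "c < N" and B: "B = b ` {..<r}"
  defines "off \<equiv> \<Sum>d<c. card (runner_rows N B d)" and "n \<equiv> card (runner_rows N B c)"
  shows "\<And>j. j < n \<Longrightarrow> off + j < r \<and> b (off + j) = bead_enum (Suc 0) (runner_rows N B c) j * N + c"
    and "\<And>i. i < r \<Longrightarrow> b i mod N = c \<Longrightarrow> \<exists>j<n. i = off + j"
proof -
  have bij: "bij_betw (\<lambda>i. b i div N) {i. i < r \<and> b i mod N = d} (runner_rows N B d)" if d: "d < N" for d
  proof (rule bij_betw_imageI)
    show "inj_on (\<lambda>i. b i div N) {i. i < r \<and> b i mod N = d}"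
    proof (rule inj_onI)
      fix x y assume xy: "x \<in> {i. i < r \<and> b i mod N = d}" "y \<in> {i. i < r \<and> b i mod N = d}" "b x div N = b y div N"
      then have "b x = b y" using div_mult_mod_eq[of "b x" N] div_mult_mod_eq[of "b y" N] by simp
      then show "x = y" using inj_onD[OF lexdec_inj_on[OF lex], of x y] xy by simp
    qed
    show "(\<lambda>i. b i div N) ` {i. i < r \<and> b i mod N = d} = runner_rows N B d"
    proof (intro equalityI subsetI)
      fix t assume "t \<in> (\<lambda>i. b i div N) ` {i. i < r \<and> b i mod N = d}"
      then obtain i where i: "i < r" "b i mod N = d" "t = b i div N" by blast
      then have "t * N + d = b i" using div_mult_mod_eq[of "b i" N] by simp
      then show "t \<in> runner_rows N B d" using i(1) by (simp add: runner_rows_def B)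
    next
      fix t assume "t \<in> runner_rows N B d"
      then obtain i where i: "i < r" "t * N + d = b i" by (auto simp: runner_rows_def B)
      have "b i div N = t" "b i mod N = d" unfolding i(2)[symmetric] using d by simp_all
      then show "t \<in> (\<lambda>i. b i div N) ` {i. i < r \<and> b i mod N = d}" using i(1) by blast
    qed
  qed
  have card: "card {i. i < r \<and> b i mod N = d} = card (runner_rows N B d)" if "d < N" for d
    by (rule bij_betw_same_card[OF bij[OF that]])
  \<comment> \<open>Residues increase along b, so the indices belonging to the runners before d form
    an initial segment.\<close>
  have below: "{i. i < r \<and> b i mod N < d} = {..<\<Sum>e<d. card (runner_rows N B e)}" if "d \<le> N" for d
  proof -
    have "card {i. i < r \<and> b i mod N < d} = (\<Sum>e<d. card (runner_rows N B e))"
      using that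
    proof (induction d)
      case (Suc d)
      have "{i. i < r \<and> b i mod N < Suc d} = {i. i < r \<and> b i mod N < d} \<union> {i. i < r \<and> b i mod N = d}" by auto
      then have "card {i. i < r \<and> b i mod N < Suc d} = card {i. i < r \<and> b i mod N < d} + card {i. i < r \<and> b i mod N = d}"
        by (simp add: card_Un_disjoint disjoint_iff)
      then show ?case using Suc card[of d] by simp
    qed simp
    moreover have "{i. i < r \<and> b i mod N < d} = {..<card {i. i < r \<and> b i mod N < d}}"
    proof (rule lessThan_card_of_downward_closed)
      fix i j assume "i \<in> {i. i < r \<and> b i mod N < d}" "j < i"
      then show "j \<in> {i. i < r \<and> b i mod N < d}" using lexdec_mod_mono[OF lex, of j i] by simp
    qed simp
    ultimately show ?thesis by simp
  qed
  have block: "i < r \<and> b i mod N = c \<longleftrightarrow> off \<le> i \<and> i < off + n" for i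
  proof -
    have "i < r \<and> b i mod N = c \<longleftrightarrow> i \<in> {i. i < r \<and> b i mod N < Suc c} \<and> i \<notin> {i. i < r \<and> b i mod N < c}" by auto
    also have "{i. i < r \<and> b i mod N < Suc c} = {..<off + n}"
      using below[of "Suc c"] c by (simp add: off_def n_def)
    also have "{i. i < r \<and> b i mod N < c} = {..<off}"
      unfolding off_def by (rule below) (use c in simp)
    also have "i \<in> {..<off + n} \<and> i \<notin> {..<off} \<longleftrightarrow> off \<le> i \<and> i < off + n" by auto
    finally show ?thesis .
  qed
  show "\<exists>j<n. i = off + j" if "i < r" "b i mod N = c" for i
  proof -
    have "off \<le> i" "i < off + n" using block[of i] that by blast+
    then have "i - off < n \<and> i = off + (i - off)" by linarith
    then show ?thesis by blast
  qed
  have im: "(\<lambda>j. b (off + j) div N) ` {..<n} = runner_rows N B c"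
  proof -
    have "{i. i < r \<and> b i mod N = c} = (\<lambda>j. off + j) ` {..<n}"
    proof (intro equalityI subsetI)
      fix i assume "i \<in> {i. i < r \<and> b i mod N = c}"
      then have "off \<le> i \<and> i < off + n" using block by blast
      then show "i \<in> (\<lambda>j. off + j) ` {..<n}" by (intro image_eqI[of _ _ "i - off"]) auto
    next
      fix i assume "i \<in> (\<lambda>j. off + j) ` {..<n}"
      then have "off \<le> i \<and> i < off + n" by auto
      then show "i \<in> {i. i < r \<and> b i mod N = c}" using block by blast
    qed
    then show ?thesis using bij_betw_imp_surj_on[OF bij[OF c]] by (simp add: image_image)
  qed
  have "lexdec (Suc 0) n (\<lambda>j. b (off + j) div N)"
    unfolding lexdec_def
  proof (intro allI impI disjI2)
    fix i j assume ij: "i < j \<and> j < n"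
    have bl: "off + i < r \<and> b (off + i) mod N = c" "off + j < r \<and> b (off + j) mod N = c"
      using block[of "off + i"] block[of "off + j"] ij by auto
    then have "b (off + j) < b (off + i)" using lexdecD[OF lex, of "off + i" "off + j"] ij by auto
    then have "b (off + j) div N * N + c < b (off + i) div N * N + c"
      using div_mult_mod_eq[of "b (off + j)" N] div_mult_mod_eq[of "b (off + i)" N] bl by simp
    then show "b (off + i) div N mod Suc 0 = b (off + j) div N mod Suc 0 \<and> b (off + j) div N < b (off + i) div N"
      by simp
  qed
  note bead_enum = bead_enum_eqI(2)[OF this im]
  show "off + j < r \<and> b (off + j) = bead_enum (Suc 0) (runner_rows N B c) j * N + c" if "j < n" for j
  proof -
    have bl: "off + j < r \<and> b (off + j) mod N = c" using block[of "off + j"] that by auto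
    then show ?thesis using bead_enum[OF that] div_mult_mod_eq[of "b (off + j)" N] by simp
  qed
qed

text \<open>Equal bead counts place the block of each runner at the same indices in both
  enumerations, so the inequalities split runner by runner.\<close>

lemma interlaced_iff_runners:
  assumes N: "N > 0" and fin: "finite B" "finite A" and card: "card A = card B"
  shows "interlaced N B A \<longleftrightarrow> (\<forall>c<N. card (runner_rows N B c) = card (runner_rows N A c) \<and>
     interlaced (Suc 0) (runner_rows N B c) (runner_rows N A c))"
proof -
  let ?r = "card B"
  let ?b = "bead_enum N B" and ?a = "bead_enum N A"
  let ?R = "runner_rows N B" and ?S = "runner_rows N A"
  let ?p = "\<lambda>c. bead_enum (Suc 0) (?R c)" and ?s = "\<lambda>c. bead_enum (Suc 0) (?S c)"
  let ?off = "\<lambda>c. \<Sum>d<c. card (?R d)"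
  have lb: "lexdec N ?r ?b" and la: "lexdec N ?r ?a"
    using bead_enum_lexdec[OF fin(1), of N] bead_enum_lexdec[OF fin(2), of N] card by auto
  have B: "B = ?b ` {..<?r}" and A: "A = ?a ` {..<?r}"
    using bead_enum_bij[OF fin(1), of N] bead_enum_bij[OF fin(2), of N] card by (auto simp: bij_betw_def)
  note rb = lexdec_runner[OF lb N _ B] and ra = lexdec_runner[OF la N _ A]
  show ?thesis
  proof
    assume "interlaced N B A"
    then have dom: "\<And>i. i < ?r \<Longrightarrow> ?b i mod N = ?a i mod N \<and> ?a i \<le> ?b i"
      and nxt: "\<And>i. Suc i < ?r \<Longrightarrow> ?b i mod N = ?b (Suc i) mod N \<Longrightarrow> ?b (Suc i) < ?a i"
      by (auto simp: interlaced_def interlacing_def dominated_def)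
    \<comment> \<open>Domination makes residues agree index by index, so the beads of X on a runner
      inject into those of Y; it is applied in both directions.\<close>
    have le: "card (runner_rows N X c) \<le> card (runner_rows N Y c)"
      if c: "c < N" and X: "X = x ` {..<?r}" and Y: "Y = y ` {..<?r}" "lexdec N ?r y" "lexdec N ?r x" and fY: "finite Y"
        and mod: "\<And>i. i < ?r \<Longrightarrow> x i mod N = y i mod N" for X Y x y c
    proof -
      note rx = lexdec_runner[OF Y(3) N c X]
      let ?o = "\<Sum>d<c. card (runner_rows N X d)"
      have "inj_on (\<lambda>j. y (?o + j) div N) {..<card (runner_rows N X c)}"
      proof (rule inj_onI)
        fix i j assume ij: "i \<in> {..<card (runner_rows N X c)}" "j \<in> {..<card (runner_rows N X c)}"
          and eq: "y (?o + i) div N = y (?o + j) div N"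
        have i: "?o + i < ?r" "y (?o + i) mod N = c" and j: "?o + j < ?r" "y (?o + j) mod N = c"
          using rx(1)[of i] rx(1)[of j] mod[of "?o + i"] mod[of "?o + j"] ij c by auto
        have "y (?o + i) = y (?o + j)"
          using div_mult_mod_eq[of "y (?o + i)" N] div_mult_mod_eq[of "y (?o + j)" N] eq i j by simp
        then show "i = j" using inj_onD[OF lexdec_inj_on[OF Y(2)], of "?o + i" "?o + j"] i j by simp
      qed
      moreover have "(\<lambda>j. y (?o + j) div N) ` {..<card (runner_rows N X c)} \<subseteq> runner_rows N Y c"
      proof clarify
        fix j assume "j < card (runner_rows N X c)"
        then have j: "?o + j < ?r" "y (?o + j) mod N = c" using rx(1)[of j] mod[of "?o + j"] c by auto
        then have "y (?o + j) div N * N + c = y (?o + j)" using div_mult_mod_eq[of "y (?o + j)" N] by simp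
        then show "y (?o + j) div N \<in> runner_rows N Y c" using j(1) by (simp add: runner_rows_def Y(1))
      qed
      ultimately show ?thesis using card_inj_on_le[OF _ _ finite_runner_rows[OF fY N]] by fastforce
    qed
    have eq: "card (?R c) = card (?S c)" if "c < N" for c
      using le[OF that B A la lb fin(2)] le[OF that A B lb la fin(1)] dom by (simp add: le_antisym)
    have off: "(\<Sum>d<c. card (?S d)) = ?off c" if "c < N" for c
      by (rule sum.cong) (use eq that in auto)
    show "\<forall>c<N. card (?R c) = card (?S c) \<and> interlaced (Suc 0) (?R c) (?S c)"
    proof (intro allI impI conjI)
      fix c assume c: "c < N"
      show "card (?R c) = card (?S c)" by (rule eq[OF c])
      have b: "?off c + j < ?r" "?b (?off c + j) = ?p c j * N + c" if "j < card (?R c)" for j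
        using rb(1)[OF c that] by auto
      have a: "?a (?off c + j) = ?s c j * N + c" if "j < card (?R c)" for j
        using ra(1)[OF c, of j] that eq[OF c] off[OF c] by simp
      show "interlaced (Suc 0) (?R c) (?S c)"
        unfolding interlaced_def interlacing_def dominated_def
      proof (intro conjI allI impI)
        fix j assume j: "j < card (?R c)"
        show "?p c j mod Suc 0 = ?s c j mod Suc 0" by simp
        show "?s c j \<le> ?p c j" using dom[OF b(1)[OF j]] a[OF j] b(2)[OF j] N by simp
      next
        fix j assume "Suc j < card (?R c) \<and> ?p c j mod Suc 0 = ?p c (Suc j) mod Suc 0"
        then have j: "j < card (?R c)" "Suc j < card (?R c)" by auto
        have "?b (Suc (?off c + j)) < ?a (?off c + j)"
          using nxt[of "?off c + j"] b[OF j(1)] b[OF j(2)] c by simp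
        then show "?p c (Suc j) < ?s c j" using a[OF j(1)] b(2)[OF j(2)] by simp
      qed
    qed
  next
    assume h: "\<forall>c<N. card (?R c) = card (?S c) \<and> interlaced (Suc 0) (?R c) (?S c)"
    have eq: "card (?R c) = card (?S c)" if "c < N" for c using h that by blast
    have off: "(\<Sum>d<c. card (?S d)) = ?off c" if "c < N" for c
      by (rule sum.cong) (use eq that in auto)
    have il: "\<And>j. j < card (?R c) \<Longrightarrow> ?s c j \<le> ?p c j" "\<And>j. Suc j < card (?R c) \<Longrightarrow> ?p c (Suc j) < ?s c j" if "c < N" for c
      using h that by (auto simp: interlaced_def interlacing_def dominated_def)
    have b: "?off c + j < ?r" "?b (?off c + j) = ?p c j * N + c" if "c < N" "j < card (?R c)" for c j
      using rb(1)[OF that] by auto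
    have a: "?a (?off c + j) = ?s c j * N + c" if "c < N" "j < card (?R c)" for c j
      using ra(1)[OF that(1), of j] that(2) eq[OF that(1)] off[OF that(1)] by simp
    show "interlaced N B A"
      unfolding interlaced_def interlacing_def dominated_def
    proof (intro conjI allI impI)
      fix i assume i: "i < ?r"
      define c where "c = ?b i mod N"
      have c: "c < N" using N by (simp add: c_def)
      obtain j where j: "j < card (?R c)" "i = ?off c + j" using rb(2)[OF c i] c_def by blast
      show "?b i mod N = ?a i mod N" unfolding j(2) b(2)[OF c j(1)] a[OF c j(1)] by simp
      show "?a i \<le> ?b i" unfolding j(2) b(2)[OF c j(1)] a[OF c j(1)] using il(1)[OF c j(1)] by simp
    next
      fix i assume i: "Suc i < ?r \<and> ?b i mod N = ?b (Suc i) mod N"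
      define c where "c = ?b i mod N"
      have c: "c < N" using N by (simp add: c_def)
      have ir: "i < ?r" using i by simp
      obtain j where j: "j < card (?R c)" "i = ?off c + j" using rb(2)[OF c ir] c_def by blast
      have "Suc i < ?r" "?b (Suc i) mod N = c" using i by (simp_all add: c_def)
      \<comment> \<open>Two consecutive indices with equal residue lie in one block, so they are
        consecutive on the runner as well.\<close>
      then obtain j' where j': "j' < card (?R c)" "Suc i = ?off c + j'" using rb(2)[OF c] by blast
      have "j' = Suc j" using j j' by simp
      then show "?b (Suc i) < ?a i"
        unfolding j'(2) unfolding j(2) b(2)[OF c j'(1)] a[OF c j(1)] using il(2)[OF c, of j] j'(1) N by simp
    qed
  qed
qed

text \<open>A common core amounts to equal bead counts on all runners. On each runner
  \<open>interlaced_1_beads_iff\<close> turns interlacing into the horizontal strip condition, which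
  includes the containment of the quotient parts.\<close>

theorem quotient_horizontal_iff_interlaced:
  assumes N: "N > 0" and sk: "skew_partition lam mu" and r: "r = plength lam"
  shows "quotient_exists N lam mu \<and>
      (\<forall>c<N. horizontal_strip (quotient_outer N lam mu c) (quotient_inner N lam mu c)) \<longleftrightarrow>
    interlaced N (beads r lam) (beads r mu)"
proof -
  note p = skew_partitionD[OF sk]
  have lr: "plength lam \<le> r" "plength mu \<le> r" using p(4) r by auto
  let ?R = "runner_rows N (beads r lam)" and ?S = "runner_rows N (beads r mu)"
  let ?o = "quotient_outer N lam mu" and ?i = "quotient_inner N lam mu"
  have fin: "finite (?R c)" "finite (?S c)" for c by (rule finite_runner_rows[OF finite_beads N])+
  have o: "?o c = of_beads (card (?R c)) (?R c)" and i: "?i c = of_beads (card (?S c)) (?S c)" for c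
    unfolding quotient_outer_def quotient_inner_def r[symmetric] by (rule quotient_part_of_beads[OF N])+
  have po: "is_partition (?o c)" "plength (?o c) \<le> card (?R c)" "beads (card (?R c)) (?o c) = ?R c" for c
    unfolding o by (rule is_partition_of_beads[OF fin(1) refl] plength_of_beads[OF fin(1) refl] beads_of_beads[OF fin(1) refl])+
  have pi: "is_partition (?i c)" "plength (?i c) \<le> card (?S c)" "beads (card (?S c)) (?i c) = ?S c" for c
    unfolding i by (rule is_partition_of_beads[OF fin(2) refl] plength_of_beads[OF fin(2) refl] beads_of_beads[OF fin(2) refl])+
  have runner: "interlaced (Suc 0) (?R c) (?S c) \<longleftrightarrow> (\<forall>j. ?i c j \<le> ?o c j \<and> ?o c (Suc j) \<le> ?i c j)"
    if eq: "card (?R c) = card (?S c)" for c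
    using interlaced_1_beads_iff[OF po(1,2) pi(1), of c c] pi(2,3)[of c] po(3)[of c] eq by simp
  have hs: "horizontal_strip (?o c) (?i c) \<longleftrightarrow> (\<forall>j. ?i c j \<le> ?o c j) \<and> (\<forall>j. ?o c (Suc j) \<le> ?i c j)" for c
    unfolding horizontal_strip_iff skew_partition_def using po(1) pi(1) by blast
  have "interlaced N (beads r lam) (beads r mu) \<longleftrightarrow>
     (\<forall>c<N. card (?R c) = card (?S c) \<and> interlaced (Suc 0) (?R c) (?S c))"
    by (rule interlaced_iff_runners[OF N]) (simp_all add: p(1,2))
  also have "\<dots> \<longleftrightarrow> (\<forall>c<N. card (?R c) = card (?S c)) \<and> (\<forall>c<N. horizontal_strip (?o c) (?i c))"
    using runner hs by blast
  also have "(\<forall>c<N. card (?R c) = card (?S c)) \<longleftrightarrow> (\<exists>kap. is_core_of N lam kap \<and> is_core_of N mu kap)"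
    by (rule common_core_iff[OF N p(1) lr(1) p(2) lr(2), symmetric])
  finally show ?thesis unfolding quotient_exists_def using hs by blast
qed

theorem corollary5p6:
  fixes N :: nat and w :: complex and lam mu :: "nat \<Rightarrow> nat"
  assumes "N > 0"
    and "primitive_root_of_unity N w"
    and "skew_partition lam mu"
  shows
   "(\<not> (quotient_exists N lam mu \<and>
        (\<forall>i<N. horizontal_strip (quotient_outer N lam mu i) (quotient_inner N lam mu i)))
      \<longrightarrow> skew_schur lam mu N (\<lambda>i. w ^ i) = 0) \<and>
    (quotient_exists N lam mu \<and>
        (\<forall>i<N. horizontal_strip (quotient_outer N lam mu i) (quotient_inner N lam mu i))
      \<longrightarrow> (\<exists>m. skew_size lam mu = N * m \<and>
              skew_character lam mu (rect N m) \<noteq> 0 \<and>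
              skew_schur lam mu N (\<lambda>i. w ^ i) = of_int (sgn (skew_character lam mu (rect N m))))) \<and>
    (\<forall>m. skew_size lam mu = N * m \<longrightarrow>
      (\<not> (quotient_exists N lam mu \<and>
          (\<forall>i<N. horizontal_strip (quotient_outer N lam mu i) (quotient_inner N lam mu i)))
        \<longrightarrow> skew_kostka_foulkes lam mu (rect m N) w = 0) \<and>
      (quotient_exists N lam mu \<and>
          (\<forall>i<N. horizontal_strip (quotient_outer N lam mu i) (quotient_inner N lam mu i))
        \<longrightarrow> skew_kostka_foulkes lam mu (rect m N) w =
              (-1) ^ ((N - 1) * m) * of_int (sgn (skew_character lam mu (rect N m)))))"
proof -
  define r where "r = plength lam"
  let ?B = "beads r lam" and ?A = "beads r mu"
  let ?E = "sort_sign N ?B * sort_sign N ?A"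
  let ?s = "skew_schur lam mu N (\<lambda>i. w ^ i)"
  note p = skew_partitionD[OF assms(3)]
  have r: "plength lam \<le> r" "plength mu \<le> r" using p(4) by (auto simp: r_def)
  define M where "M = Suc (Max (?B \<union> ?A))"
  have M: "?B \<subseteq> {..<M}" "?A \<subseteq> {..<M}" by (auto simp: M_def less_Suc_eq_le)
  \<comment> \<open>A single copy of the roots means chains with one link, so the evaluation is the
    product of the two sorting signs or zero.\<close>
  have c1: "num_chains N M 1 ?B ?A = (if interlaced N ?B ?A then 1 else 0)"
    by (rule num_chains_1[OF M]) (simp add: p(1,2))
  have s: "?s = (if interlaced N ?B ?A then of_int ?E else 0)"
    using skew_schur_primitive_root[OF assms r(1) M, of 1] unfolding c1 by simp
  have sgn: "sgn (skew_character lam mu (rect N m)) = ?E"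
    if il: "interlaced N ?B ?A" and m: "skew_size lam mu = N * m" for m
    by (rule sgn_skew_character_rect[OF assms r(1) _ m])
      (use il p(1) in \<open>simp add: interlaced_def interlacing_def\<close>)
  \<comment> \<open>Interlacing moves every bead by a multiple of N, so N divides the size of the
    skew shape.\<close>
  have size: "\<exists>m. skew_size lam mu = N * m" if il: "interlaced N ?B ?A"
  proof -
    have dom: "dominated N r (bead_enum N ?B) (bead_enum N ?A)"
      using il p(1) by (simp add: interlaced_def interlacing_def)
    have sums: "(\<Sum>i<r. bead_enum N ?B i) = \<Sum>?B" "(\<Sum>i<r. bead_enum N ?A i) = \<Sum>?A"
      using sum.reindex_bij_betw[OF bead_enum_bij[of ?B N], of "\<lambda>x. x"] sum.reindex_bij_betw[OF bead_enum_bij[of ?A N], of "\<lambda>x. x"] p(1,2)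
      by simp_all
    have "(\<Sum>i<r. bead_enum N ?B i - bead_enum N ?A i) = \<Sum>?B - \<Sum>?A"
      unfolding sums[symmetric] using dom by (intro sum_subtractf_nat) (auto simp: dominated_def)
    also have "\<dots> = skew_size lam mu"
      using sum_beads[OF p(1) r(1)] sum_beads[OF p(2) r(2)] skew_size_diff[OF assms(3)] by simp
    finally have e: "skew_size lam mu = (\<Sum>i<r. bead_enum N ?B i - bead_enum N ?A i)" by simp
    have "N dvd (\<Sum>i<r. bead_enum N ?B i - bead_enum N ?A i)"
    proof (rule dvd_sum)
      fix i assume "i \<in> {..<r}"
      then have "bead_enum N ?B i mod N = bead_enum N ?A i mod N" "bead_enum N ?A i \<le> bead_enum N ?B i" using dom by (auto simp: dominated_def)
      then show "N dvd bead_enum N ?B i - bead_enum N ?A i" by (simp add: mod_eq_dvd_iff_nat)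
    qed
    then show ?thesis unfolding e by (auto simp: dvd_def)
  qed
  \<comment> \<open>A product of signs is never 0, so the character value having it as its sign
    cannot vanish.\<close>
  have E: "?E \<noteq> 0" using sort_sign_cases[of N ?B] sort_sign_cases[of N ?A] by auto
  have K: "skew_kostka_foulkes lam mu (rect m N) w = (-1) ^ ((N - 1) * m) * ?s" if "skew_size lam mu = N * m" for m
    by (rule skew_kostka_foulkes_primitive_root[OF assms that])
  show ?thesis
    unfolding quotient_horizontal_iff_interlaced[OF assms(1,3) r_def]
  proof (intro conjI impI allI)
    assume "\<not> interlaced N ?B ?A"
    then show "?s = 0" by (simp only: s if_False)
  next
    assume il: "interlaced N ?B ?A"
    then obtain m where m: "skew_size lam mu = N * m" using size by blast
    have "skew_character lam mu (rect N m) \<noteq> 0"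
    proof
      assume "skew_character lam mu (rect N m) = 0"
      then have "?E = 0" unfolding sgn[OF il m, symmetric] by simp
      then show False using E by contradiction
    qed
    then show "\<exists>m. skew_size lam mu = N * m \<and> skew_character lam mu (rect N m) \<noteq> 0 \<and>
        ?s = of_int (sgn (skew_character lam mu (rect N m)))"
      using m il sgn[OF il m] by (intro exI[of _ m]) (simp only: s if_True simp_thms)
  next
    fix m assume "skew_size lam mu = N * m" "\<not> interlaced N ?B ?A"
    then show "skew_kostka_foulkes lam mu (rect m N) w = 0" by (simp only: K s if_False mult_zero_right)
  next
    fix m assume m: "skew_size lam mu = N * m" and il: "interlaced N ?B ?A"
    then show "skew_kostka_foulkes lam mu (rect m N) w =
        (-1) ^ ((N - 1) * m) * of_int (sgn (skew_character lam mu (rect N m)))"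
      by (simp only: K[OF m] s if_True sgn[OF il m])
  qed
qed


end
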